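(* Let $g$ be the accelerating Kerr metric with real parameters $a,m,\alpha$ (see context) and write $c=\cos\theta$. Then $I_3=\nabla_\mu C_{\alpha\beta\gamma\delta}\nabla^\mu C^{\alpha\beta\gamma\delta}$ of $g$ equals $$\begin{aligned} I_3=-\frac{720(\alpha rc-1)^7m^2}{(r^2+a^2c^2)^9}\Big(&\alpha a^{10}\Big(a^4\alpha^4r-2\alpha^2(\alpha^2mr^2-m-r)a^2+2\alpha^2mr^2-2m+r\Big)c^{11}\\ &+\Big(a^6\alpha^4+(-2\alpha^4mr+2\alpha^2)a^4+(34\alpha^4mr^3-38\alpha^2mr+1)a^2-2mr^3\alpha^2\Big)a^8c^{10}\\ &-2\Big[\alpha^2\big(\tfrac{27r^3\alpha^2}{2}+m\big)a^4+\big(-28mr^4\alpha^4+31\alpha^2mr^2+27r^3\alpha^2-m\big)a^2\\ &\qquad+44\alpha^2mr^4-43mr^2+\tfrac{27r^3}{2}\Big]\alpha a^8c^9\\ &-27\Big(a^6r\alpha^4-\tfrac{22(\alpha^2mr^2+\frac{17}{11}m-\frac{27}{11}r)\alpha^2a^4}{27}+\big(\tfrac{280}{27}mr^4\alpha^4-\tfrac{394}{27}\alpha^2mr^2+\tfrac2{27}m+r\big)a^2-\tfrac{56\alpha^2mr^4}{27}\Big)a^6rc^8\\ &+56\Big(\alpha^2\big(\tfrac{3r^3\alpha^2}{4}+m\big)a^4+\big(-\tfrac52mr^4\alpha^4+\tfrac{85}{14}\alpha^2mr^2+\tfrac32r^3\alpha^2-\tfrac{11}{7}m\big)a^2\\ &\qquad+\tfrac{13(\alpha^2mr^2-\frac{11}{13}m+\frac3{26}r)r^2}{2}\Big)\alpha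 a^6r^2c^7\\ &+42a^4r^3\Big(a^6r\alpha^4+\tfrac{10(\alpha^2mr^2-2m+\frac35r)\alpha^2a^4}{3}+\big(\tfrac{26}{3}mr^4\alpha^4-\tfrac{50}{3}\alpha^2mr^2+\tfrac43m+r\big)a^2-\tfrac{10\alpha^2mr^4}{3}\Big)c^6\\ &-140\Big[\alpha^2\big(-\tfrac{3r^3\alpha^2}{10}+m\big)a^4+\big(-\tfrac25mr^4\alpha^4+5\alpha^2mr^2-\tfrac35r^3\alpha^2-\tfrac{13}{5}m\big)a^2\\ &\qquad+2r^2\big(\alpha^2mr^2-\tfrac12m-\tfrac3{20}r\big)\Big]\alpha a^4r^4c^5\\ &+42\Big\{a^6r\alpha^4-\tfrac{22(\alpha^2mr^2-\frac{13}{11}m-\frac3{11}r)\alpha^2a^4}{3}+\big(-\tfrac{44}{21}mr^4\alpha^4+\tfrac{170}{21}\alpha^2mr^2-\tfrac{10}{3}m+r\big)a^2+\tfrac{4\alpha^2mr^4}{3}\Big\}a^2r^5c^4\\ &+56\alpha a^2r^6\Big(\alpha^2\big(-\tfrac{27r^3\alpha^2}{56}+m\big)a^4+\big(-\tfrac1{28}mr^4\alpha^4+\tfrac{197}{28}\alpha^2mr^2-\tfrac{27}{28}r^3\alpha^2-5m\big)a^2\\ &\qquad+\tfrac{17(\alpha^2mr^2+\frac{11}{17}m-\frac{27}{34}r)r^2}{28}\Big)c^3\\ &-27\Big(a^6r\alpha^4-\tfrac{86(\alpha^2mr^2-\frac{44}{43}m-\frac{27}{43}r)\alpha^2a^4}{27}+\big(-\tfrac2{27}mr^4\alpha^4+\tfrac{62}{27}\alpha^2mr^2-\tfrac{56}{27}m+r\big)a^2+\tfrac{2\alpha^2mr^4}{27}\Big)r^7c^2\\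 &-2\alpha\Big(\alpha^2\big(-\tfrac{r^3\alpha^2}{2}+m\big)a^4+\big(19\alpha^2mr^2-r^3\alpha^2-17m\big)a^2+r^2\big(m-\tfrac r2\big)\Big)r^8c\\ &+r^9\Big(a^4\alpha^4r-2\alpha^2(\alpha^2mr^2-m-r)a^2+2\alpha^2mr^2-2m+r\Big)\Big). \end{aligned}$$
   Context: Accelerating Kerr black hole metric: in coordinates $(t,r,\theta,\phi)$, signature $(-,+,+,+)$, $$ds^2=\frac1{\Omega^2}\Big\{-\frac{Q}{\rho^2}\big[dt-a\sin^2\theta\,d\phi\big]^2+\frac{\rho^2}{Q}dr^2+\frac{\rho^2}{P}d\theta^2+\frac{P}{\rho^2}\sin^2\theta\big[a\,dt-(r^2+a^2)d\phi\big]^2\Big\},$$ $\Omega=1-\alpha r\cos\theta$, $\rho^2=r^2+a^2\cos^2\theta$, $P=1-2\alpha m\cos\theta+\alpha^2a^2\cos^2\theta$, $Q=(a^2-2mr+r^2)(1-\alpha^2r^2)$. Here $\alpha$ is the acceleration parameter, $a$ the Kerr parameter, $m$ the mass. The identity is on the domain where the metric is regular ($\Omega>0$, $\rho^2\ne0$, $Q\neq0$, $P>0$, $\sin\theta\neq0$). $C_{\alpha\beta\gamma\delta}$ is the Weyl tensor (its Greek indices are unrelated to the parameter $\alpha$) and $\nabla$ the Levi-Civita connection of $g$. *)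

theory Defs
  imports "HOL-Analysis.Analysis"
begin

text \<open>A point is given by its coordinate vector in \<open>real ^ 'n\<close>, and tensor fields by their
  components in the coordinate frame. Partial derivatives use the total function \<open>deriv\<close>, so all
  notions below have their usual meaning wherever the metric components are smooth and the
  metric is nondegenerate.\<close>

type_synonym 'n metric = "real ^ 'n \<Rightarrow> real ^ 'n ^ 'n"

type_synonym 'n cotensor4 = "real ^ 'n \<Rightarrow> 'n \<Rightarrow> 'n \<Rightarrow> 'n \<Rightarrow> 'n \<Rightarrow> real"

definition partial_deriv :: "'n::finite \<Rightarrow> (real ^ 'n \<Rightarrow> real) \<Rightarrow> real ^ 'n \<Rightarrow> real" where
  "partial_deriv i f x = deriv (\<lambda>s. f (x + s *\<^sub>R axis i 1)) 0"

definition metric_inv :: "'n::finite metric \<Rightarrow> 'n metric" where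
  "metric_inv g x = matrix_inv (g x)"

text \<open>\<open>christoffel g x k i j\<close> is $\Gamma^k{}_{ij}$, the connection coefficient of the
  Levi-Civita connection of \<open>g\<close>.\<close>

definition christoffel :: "'n::finite metric \<Rightarrow> real ^ 'n \<Rightarrow> 'n \<Rightarrow> 'n \<Rightarrow> 'n \<Rightarrow> real" where
  "christoffel g x k i j =
     (\<Sum>l\<in>UNIV. metric_inv g x $ k $ l *
        (partial_deriv i (\<lambda>y. g y $ l $ j) x + partial_deriv j (\<lambda>y. g y $ l $ i) x
          - partial_deriv l (\<lambda>y. g y $ i $ j) x)) / 2"

text \<open>\<open>riemann_up g x a b c d\<close> is $R^a{}_{bcd} = \partial_c \Gamma^a{}_{db} - \partial_d
  \Gamma^a{}_{cb} + \Gamma^a{}_{ce} \Gamma^e{}_{db} - \Gamma^a{}_{de} \Gamma^e{}_{cb}$, and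
  the Ricci tensor is $R_{bd} = R^a{}_{bad}$.\<close>

definition riemann_up :: "'n::finite metric \<Rightarrow> 'n cotensor4" where
  "riemann_up g x a b c d =
     partial_deriv c (\<lambda>y. christoffel g y a d b) x - partial_deriv d (\<lambda>y. christoffel g y a c b) x
     + (\<Sum>e\<in>UNIV. christoffel g x a c e * christoffel g x e d b)
     - (\<Sum>e\<in>UNIV. christoffel g x a d e * christoffel g x e c b)"

definition riemann :: "'n::finite metric \<Rightarrow> 'n cotensor4" where
  "riemann g x a b c d = (\<Sum>e\<in>UNIV. g x $ a $ e * riemann_up g x e b c d)"

definition ricci :: "'n::finite metric \<Rightarrow> real ^ 'n \<Rightarrow> 'n \<Rightarrow> 'n \<Rightarrow> real" where
  "ricci g x b d = (\<Sum>a\<in>UNIV. riemann_up g x a b a d)"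

definition scalar_curvature :: "'n::finite metric \<Rightarrow> real ^ 'n \<Rightarrow> real" where
  "scalar_curvature g x = (\<Sum>a\<in>UNIV. \<Sum>b\<in>UNIV. metric_inv g x $ a $ b * ricci g x a b)"

text \<open>All indices down; meaningful in dimension at least 3.\<close>

definition weyl :: "'n::finite metric \<Rightarrow> 'n cotensor4" where
  "weyl g x a b c d =
     riemann g x a b c d
     - (g x $ a $ c * ricci g x b d - g x $ a $ d * ricci g x b c
        - g x $ b $ c * ricci g x a d + g x $ b $ d * ricci g x a c) / (real CARD('n) - 2)
     + scalar_curvature g x * (g x $ a $ c * g x $ b $ d - g x $ a $ d * g x $ b $ c)
        / ((real CARD('n) - 1) * (real CARD('n) - 2))"

text \<open>\<open>cov_deriv4 g T x \<mu> a b c d\<close> is $\nabla_\mu T_{abcd}$.\<close>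

definition cov_deriv4 ::
    "'n::finite metric \<Rightarrow> 'n cotensor4 \<Rightarrow> real ^ 'n \<Rightarrow> 'n \<Rightarrow> 'n \<Rightarrow> 'n \<Rightarrow> 'n \<Rightarrow> 'n \<Rightarrow> real" where
  "cov_deriv4 g T x \<mu> a b c d =
     partial_deriv \<mu> (\<lambda>y. T y a b c d) x
     - (\<Sum>e\<in>UNIV. christoffel g x e \<mu> a * T x e b c d)
     - (\<Sum>e\<in>UNIV. christoffel g x e \<mu> b * T x a e c d)
     - (\<Sum>e\<in>UNIV. christoffel g x e \<mu> c * T x a b e d)
     - (\<Sum>e\<in>UNIV. christoffel g x e \<mu> d * T x a b c e)"

definition raise5 :: "'n::finite metric \<Rightarrow> real ^ 'n \<Rightarrow> ('n \<Rightarrow> 'n \<Rightarrow> 'n \<Rightarrow> 'n \<Rightarrow> 'n \<Rightarrow> real)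
    \<Rightarrow> 'n \<Rightarrow> 'n \<Rightarrow> 'n \<Rightarrow> 'n \<Rightarrow> 'n \<Rightarrow> real" where
  "raise5 g x S \<mu> a b c d =
     (\<Sum>\<mu>'\<in>UNIV. \<Sum>a'\<in>UNIV. \<Sum>b'\<in>UNIV. \<Sum>c'\<in>UNIV. \<Sum>d'\<in>UNIV.
        metric_inv g x $ \<mu> $ \<mu>' * metric_inv g x $ a $ a' * metric_inv g x $ b $ b'
        * metric_inv g x $ c $ c' * metric_inv g x $ d $ d' * S \<mu>' a' b' c' d')"

definition I3 :: "'n::finite metric \<Rightarrow> real ^ 'n \<Rightarrow> real" where
  "I3 g x =
     (\<Sum>\<mu>\<in>UNIV. \<Sum>a\<in>UNIV. \<Sum>b\<in>UNIV. \<Sum>c\<in>UNIV. \<Sum>d\<in>UNIV.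
        cov_deriv4 g (weyl g) x \<mu> a b c d * raise5 g x (cov_deriv4 g (weyl g) x) \<mu> a b c d)"

definition Omega :: "real \<Rightarrow> real \<Rightarrow> real \<Rightarrow> real" where
  "Omega \<alpha> r \<theta> = 1 - \<alpha> * r * cos \<theta>"

definition rho2 :: "real \<Rightarrow> real \<Rightarrow> real \<Rightarrow> real" where
  "rho2 a r \<theta> = r\<^sup>2 + a\<^sup>2 * (cos \<theta>)\<^sup>2"

definition Pfun :: "real \<Rightarrow> real \<Rightarrow> real \<Rightarrow> real \<Rightarrow> real" where
  "Pfun a m \<alpha> \<theta> = 1 - 2 * \<alpha> * m * cos \<theta> + \<alpha>\<^sup>2 * a\<^sup>2 * (cos \<theta>)\<^sup>2"

definition Qfun :: "real \<Rightarrow> real \<Rightarrow> real \<Rightarrow> real \<Rightarrow> real" where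
  "Qfun a m \<alpha> r = (a\<^sup>2 - 2 * m * r + r\<^sup>2) * (1 - \<alpha>\<^sup>2 * r\<^sup>2)"

text \<open>The coordinates \<open>(t, r, \<theta>, \<phi>)\<close> have indices \<open>1, 2, 3, 4\<close>; covectors are represented by
  their component vectors, so that \<open>dt = axis 1 1\<close> and so on.\<close>

definition acc_kerr :: "real \<Rightarrow> real \<Rightarrow> real \<Rightarrow> 4 metric" where
  "acc_kerr a m \<alpha> x =
     (let r = x $ 2; \<theta> = x $ 3;
          \<rho>2 = rho2 a r \<theta>; P = Pfun a m \<alpha> \<theta>; Q = Qfun a m \<alpha> r;
          dt = axis 1 1; dr = axis 2 1; d\<theta> = axis 3 1; d\<phi> = axis 4 1;
          \<omega> = dt - (a * (sin \<theta>)\<^sup>2) *\<^sub>R d\<phi>;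
          \<eta> = a *\<^sub>R dt - (r\<^sup>2 + a\<^sup>2) *\<^sub>R d\<phi>
      in \<chi> i j. 1 / (Omega \<alpha> r \<theta>)\<^sup>2 *
           (- (Q / \<rho>2) * (\<omega> $ i * \<omega> $ j)
            + \<rho>2 / Q * (dr $ i * dr $ j)
            + \<rho>2 / P * (d\<theta> $ i * d\<theta> $ j)
            + P / \<rho>2 * (sin \<theta>)\<^sup>2 * (\<eta> $ i * \<eta> $ j)))"

lemma vector_4:
  "(vector [w, x, y, z] :: 'a::zero ^ 4) $ 1 = w"
  "(vector [w, x, y, z] :: 'a::zero ^ 4) $ 2 = x"
  "(vector [w, x, y, z] :: 'a::zero ^ 4) $ 3 = y"
  "(vector [w, x, y, z] :: 'a::zero ^ 4) $ 4 = z"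
  by (simp_all add: vector_def)

lemma acc_kerr_line_element:
  fixes t r \<theta> \<phi> dt dr d\<theta> d\<phi> a m \<alpha> :: real
  shows "vector [dt, dr, d\<theta>, d\<phi>] \<bullet> (acc_kerr a m \<alpha> (vector [t, r, \<theta>, \<phi>]) *v vector [dt, dr, d\<theta>, d\<phi>])
    = 1 / (Omega \<alpha> r \<theta>)\<^sup>2 *
       (- (Qfun a m \<alpha> r / rho2 a r \<theta>) * (dt - a * (sin \<theta>)\<^sup>2 * d\<phi>)\<^sup>2
        + rho2 a r \<theta> / Qfun a m \<alpha> r * dr\<^sup>2
        + rho2 a r \<theta> / Pfun a m \<alpha> \<theta> * d\<theta>\<^sup>2
        + Pfun a m \<alpha> \<theta> / rho2 a r \<theta> * (sin \<theta>)\<^sup>2 * (a * dt - (r\<^sup>2 + a\<^sup>2) * d\<phi>)\<^sup>2)"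
proof -
  have quad: "v \<bullet> ((\<chi> i j. k * (- k1 * (\<omega> $ i * \<omega> $ j) + k2 * (\<xi> $ i * \<xi> $ j)
        + k3 * (\<zeta> $ i * \<zeta> $ j) + k4 * s * (\<eta> $ i * \<eta> $ j))) *v v)
      = k * (- k1 * (\<omega> \<bullet> v)\<^sup>2 + k2 * (\<xi> \<bullet> v)\<^sup>2 + k3 * (\<zeta> \<bullet> v)\<^sup>2 + k4 * s * (\<eta> \<bullet> v)\<^sup>2)"
    for v \<omega> \<xi> \<zeta> \<eta> :: "real ^ 4" and k k1 k2 k3 k4 s :: real
    by (simp add: inner_vec_def matrix_vector_mult_def sum_4 power2_eq_square) algebra
  show ?thesis
    unfolding acc_kerr_def Let_def quad
    by (simp add: inner_diff_left inner_axis' vector_4)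
qed

end

(* With x = cos theta, the metric is diagonal in the coframe dt - a (1 - x^2) dphi, dr, dx,
   a dt - (r^2 + a^2) dphi, whose connection coefficients are rational in r and x. In this frame
   the Ricci tensor vanishes and the Weyl tensor is of type D: its components are the real and
   imaginary parts of Psi = m (1 - i alpha a) (Omega / (r + i a x))^3 times monomials in the metric.
   By the Bianchi identity the components of its covariant derivative are the real and imaginary
   parts of the derivatives of Psi, again times such monomials. Hence I3 is 80 times the real part
   of g(grad Psi, grad Psi), that is, of
     Omega^2 (Q Psi_r^2 + P sin^2(theta) Psi_x^2) / rho^2,
   and Psi_r = - 3 m (1 - i alpha a) (1 + i alpha a x^2) Omega^2 / (r + i a x)^4,
   Psi_x = - 3 m (1 - i alpha a) (alpha r^2 + i a) Omega^2 / (r + i a x)^4.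
   Expanding gives the stated polynomial; one further factor Omega splits off. *)
theory Submission
  imports Defs
begin

section \<open>Partial derivatives\<close>

text \<open>Two obstacles shape the development. The tensors are built from the total operators
  \<open>deriv\<close> and \<open>matrix_inv\<close>, so a formula for a component is usable only
  together with a proof that the derivative or the inverse exists; \<open>has_pd\<close> states
  existence and value of a partial derivative at once. Moreover, a direct coordinate computation
  would meet all components of a five-index tensor with trigonometric entries. The locale
  \<open>orthogonal_frame\<close> therefore isolates what holds for every metric that is diagonal in
  some frame. Its connection coefficients are not derived from the metric: a candidate table is
  accepted once it is torsion-free and preserves the metric, because these two properties determine
  the Levi-Civita connection. For the concrete metric there remains algebra over functions of r and
  x. The complex quantities are split into real and imaginary parts so that all identities are
  between real rational functions, and antisymmetry cuts 256 components to 36 for each direction of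
  differentiation.\<close>

definition has_pd :: "'n::finite \<Rightarrow> (real ^ 'n \<Rightarrow> real) \<Rightarrow> real \<Rightarrow> real ^ 'n \<Rightarrow> bool" where
  "has_pd i f D x \<longleftrightarrow> ((\<lambda>s. f (x + s *\<^sub>R axis i 1)) has_real_derivative D) (at 0)"

lemma partial_deriv_eqI: "has_pd i f D x \<Longrightarrow> partial_deriv i f x = D"
  unfolding has_pd_def partial_deriv_def by (rule DERIV_imp_deriv)

lemma has_pd_unique: "has_pd i f D x \<Longrightarrow> has_pd i f D' x \<Longrightarrow> D = D'"
  unfolding has_pd_def by (rule DERIV_unique)

lemma has_pd_const: "has_pd i (\<lambda>y. c) 0 x"
  unfolding has_pd_def by simp

lemma has_pd_add: "has_pd i f D x \<Longrightarrow> has_pd i g D' x \<Longrightarrow> has_pd i (\<lambda>y. f y + g y) (D + D') x"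
  unfolding has_pd_def by (rule DERIV_add)

lemma has_pd_mult:
  "has_pd i f D x \<Longrightarrow> has_pd i g D' x \<Longrightarrow> has_pd i (\<lambda>y. f y * g y) (D * g x + f x * D') x"
  unfolding has_pd_def by (auto intro!: derivative_eq_intros)

lemma has_pd_sum:
  "(\<And>k. k \<in> I \<Longrightarrow> has_pd i (f k) (D k) x) \<Longrightarrow> has_pd i (\<lambda>y. \<Sum>k\<in>I. f k y) (\<Sum>k\<in>I. D k) x"
  unfolding has_pd_def by (rule DERIV_sum)

text \<open>Agreement on an open set contains agreement along a short coordinate segment. This lets
  a tensor that is itself defined through \<open>deriv\<close> be differentiated by way of a frame
  formula known only on \<open>U\<close>.\<close>

lemma has_pd_transform:
  assumes "has_pd i f D x" "open U" "x \<in> U" "\<And>y. y \<in> U \<Longrightarrow> f y = h y"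
  shows "has_pd i h D x"
proof -
  have "((\<lambda>s. x + s *\<^sub>R axis i 1) \<longlongrightarrow> x + 0 *\<^sub>R axis i 1) (nhds (0::real))"
    by (intro tendsto_intros filterlim_ident)
  then have "eventually (\<lambda>s. x + s *\<^sub>R axis i 1 \<in> U) (nhds (0::real))"
    using assms(2,3) by (auto intro: topological_tendstoD)
  then have "eventually (\<lambda>s. f (x + s *\<^sub>R axis i 1) = h (x + s *\<^sub>R axis i 1)) (nhds 0)"
    by eventually_elim (rule assms(4))
  then show ?thesis
    using assms(1) unfolding has_pd_def by (simp only: DERIV_cong_ev[OF refl _ refl])
qed

lemma sum_delta_UNIV:
  "(\<Sum>k\<in>UNIV. (if k = i then 1 else 0) * f k) = (f (i::'n::finite) :: real)"
  "(\<Sum>k\<in>UNIV. (if i = k then 1 else 0) * f k) = (f (i::'n::finite) :: real)"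
proof -
  have "(\<Sum>k\<in>UNIV. (if k = i then 1 else 0) * f k) = (\<Sum>k\<in>UNIV. if k = i then f k else 0)"
    by (rule sum.cong) auto
  then show *: "(\<Sum>k\<in>UNIV. (if k = i then 1 else 0) * f k) = f i" by simp
  show "(\<Sum>k\<in>UNIV. (if i = k then 1 else 0) * f k) = f i"
    using * by (simp only: eq_commute[of i])
qed

section \<open>Orthogonal frames\<close>

text \<open>\<open>E\<close> is the coframe, \<open>e\<close> the dual frame, the metric is $\sum_A G_A\, E^A \otimes E^A$, and
  \<open>\<gamma> A C B\<close> is the component along $e_A$ of $\nabla_{e_C} e_B$. \<open>DG M\<close> and \<open>D\<gamma> M\<close> are derivatives along
  the frame vector $e_M$, while \<open>dE i\<close> and \<open>ddE i j\<close> are coordinate derivatives.\<close>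

locale orthogonal_frame =
  fixes g :: "'n::finite metric"
    and U :: "(real ^ 'n) set"
    and E e :: "'n \<Rightarrow> 'n \<Rightarrow> real ^ 'n \<Rightarrow> real"
    and G :: "'n \<Rightarrow> real ^ 'n \<Rightarrow> real"
    and DG :: "'n \<Rightarrow> 'n \<Rightarrow> real ^ 'n \<Rightarrow> real"
    and \<gamma> :: "'n \<Rightarrow> 'n \<Rightarrow> 'n \<Rightarrow> real ^ 'n \<Rightarrow> real"
    and D\<gamma> :: "'n \<Rightarrow> 'n \<Rightarrow> 'n \<Rightarrow> 'n \<Rightarrow> real ^ 'n \<Rightarrow> real"
    and dE :: "'n \<Rightarrow> 'n \<Rightarrow> 'n \<Rightarrow> real ^ 'n \<Rightarrow> real"
    and ddE :: "'n \<Rightarrow> 'n \<Rightarrow> 'n \<Rightarrow> 'n \<Rightarrow> real ^ 'n \<Rightarrow> real"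
  assumes open_U: "open U"
    and dual: "y \<in> U \<Longrightarrow> (\<Sum>i\<in>UNIV. E A i y * e B i y) = (if A = B then 1 else 0)"
    and dual': "y \<in> U \<Longrightarrow> (\<Sum>A\<in>UNIV. E A i y * e A j y) = (if i = j then 1 else 0)"
    and metric: "y \<in> U \<Longrightarrow> g y $ i $ j = (\<Sum>A\<in>UNIV. G A y * E A i y * E A j y)"
    and G_nz: "y \<in> U \<Longrightarrow> G A y \<noteq> 0"
    and e_pd: "y \<in> U \<Longrightarrow> \<exists>D. has_pd i (e A j) D y"
    and E_pd: "y \<in> U \<Longrightarrow> has_pd i (E A j) (dE i A j y) y"
    and dE_pd: "y \<in> U \<Longrightarrow> has_pd i (dE j A k) (ddE i j A k y) y"
    and ddE_sym: "y \<in> U \<Longrightarrow> ddE i j A k y = ddE j i A k y"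
    and G_pd: "y \<in> U \<Longrightarrow> has_pd i (G A) (\<Sum>C\<in>UNIV. E C i y * DG C A y) y"
    and \<gamma>_pd: "y \<in> U \<Longrightarrow> has_pd i (\<gamma> A C B) (\<Sum>M\<in>UNIV. E M i y * D\<gamma> M A C B y) y"
    and torsion: "y \<in> U \<Longrightarrow> dE i A j y - dE j A i y
        = (\<Sum>C\<in>UNIV. \<Sum>B\<in>UNIV. (\<gamma> A B C y - \<gamma> A C B y) * (E C i y * E B j y))"
    and metricity: "y \<in> U \<Longrightarrow>
        G A y * \<gamma> A C B y + G B y * \<gamma> B C A y = (if A = B then DG C A y else 0)"
begin

definition omega :: "'n \<Rightarrow> 'n \<Rightarrow> 'n \<Rightarrow> real ^ 'n \<Rightarrow> real" where
  "omega i A B y = (\<Sum>C\<in>UNIV. E C i y * \<gamma> A C B y)"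

section \<open>Duality of frame and coframe, inverse metric, Levi-Civita connection\<close>

lemma frame_contract:
  "y \<in> U \<Longrightarrow> (\<Sum>i\<in>UNIV. e B i y * (\<Sum>A\<in>UNIV. E A i y * F A)) = F B"
proof -
  assume y: "y \<in> U"
  have "(\<Sum>i\<in>UNIV. e B i y * (\<Sum>A\<in>UNIV. E A i y * F A))
      = (\<Sum>A\<in>UNIV. (\<Sum>i\<in>UNIV. E A i y * e B i y) * F A)"
    unfolding sum_distrib_left sum_distrib_right
    by (subst sum.swap) (simp add: mult_ac)
  then show ?thesis by (simp add: dual[OF y] sum_delta_UNIV)
qed

lemma coframe_contract:
  "y \<in> U \<Longrightarrow> (\<Sum>i\<in>UNIV. E B i y * (\<Sum>A\<in>UNIV. e A i y * F A)) = F B"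
proof -
  assume y: "y \<in> U"
  have "(\<Sum>i\<in>UNIV. E B i y * (\<Sum>A\<in>UNIV. e A i y * F A))
      = (\<Sum>A\<in>UNIV. (\<Sum>i\<in>UNIV. E B i y * e A i y) * F A)"
    unfolding sum_distrib_left sum_distrib_right
    by (subst sum.swap) (simp add: mult_ac)
  then show ?thesis by (simp add: dual[OF y] sum_delta_UNIV)
qed

lemma expand_frame:
  "y \<in> U \<Longrightarrow> (\<Sum>A\<in>UNIV. e A i y * (\<Sum>j\<in>UNIV. E A j y * f j)) = f i"
proof -
  assume y: "y \<in> U"
  have "(\<Sum>A\<in>UNIV. e A i y * (\<Sum>j\<in>UNIV. E A j y * f j))
      = (\<Sum>j\<in>UNIV. (\<Sum>A\<in>UNIV. E A j y * e A i y) * f j)"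
    unfolding sum_distrib_left sum_distrib_right
    by (subst sum.swap) (simp add: mult_ac)
  then show ?thesis by (simp add: dual'[OF y] sum_delta_UNIV)
qed

lemma metric_inv_frame:
  assumes y: "y \<in> U"
  shows "metric_inv g y $ i $ j = (\<Sum>A\<in>UNIV. e A i y * (e A j y / G A y))"
proof -
  define H :: "real ^ 'n ^ 'n" where "H = (\<chi> i j. \<Sum>A\<in>UNIV. e A i y * (e A j y / G A y))"
  have a: "(\<Sum>k\<in>UNIV. g y $ i $ k * H $ k $ j) = (if i = j then 1 else 0)" for i j
  proof -
    have "(\<Sum>k\<in>UNIV. g y $ i $ k * H $ k $ j)
       = (\<Sum>k\<in>UNIV. \<Sum>A\<in>UNIV. G A y * E A i y * (E A k y * (\<Sum>B\<in>UNIV. e B k y * (e B j y / G B y))))"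
      by (simp add: metric[OF y] H_def sum_distrib_right mult.assoc)
    also have "\<dots> = (\<Sum>A\<in>UNIV. G A y * E A i y * (\<Sum>k\<in>UNIV. E A k y * (\<Sum>B\<in>UNIV. e B k y * (e B j y / G B y))))"
      by (subst sum.swap) (simp add: sum_distrib_left)
    also have "\<dots> = (\<Sum>A\<in>UNIV. E A i y * e A j y)"
      by (simp only: coframe_contract[OF y]) (simp add: G_nz[OF y] mult_ac)
    finally show ?thesis by (simp add: dual'[OF y])
  qed
  have 1: "g y ** H = mat 1"
    by (simp add: vec_eq_iff matrix_matrix_mult_def mat_def a)
  then have 2: "H ** g y = mat 1" by (simp add: matrix_left_right_inverse)
  \<comment> \<open>\<open>matrix_inv\<close> is a choice among two-sided inverses, so existence has
    to be known before uniqueness can identify it with \<open>H\<close>.\<close>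
  have "\<exists>A'. g y ** A' = mat 1 \<and> A' ** g y = mat 1" using 1 2 by blast
  then have "g y ** matrix_inv (g y) = mat 1 \<and> matrix_inv (g y) ** g y = mat 1"
    unfolding matrix_inv_def by (rule someI_ex)
  then have "matrix_inv (g y) = H" using 1 2
    by (metis matrix_mul_assoc matrix_mul_rid matrix_mul_lid)
  then show ?thesis by (simp add: metric_inv_def H_def)
qed

text \<open>Uniqueness half of the fundamental theorem of Riemannian geometry. In the combination of
  three metric derivatives that defines \<open>christoffel\<close>, symmetry of the candidate in its
  lower indices cancels all terms but two equal ones.\<close>

lemma christoffel_lower:
  fixes \<Gamma> :: "'n \<Rightarrow> 'n \<Rightarrow> 'n \<Rightarrow> real"
  assumes sym: "\<And>k i j. \<Gamma> k i j = \<Gamma> k j i"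
    and dg: "\<And>i l j. partial_deriv i (\<lambda>y. g y $ l $ j) y
        = (\<Sum>k\<in>UNIV. g y $ l $ k * \<Gamma> k i j) + (\<Sum>k\<in>UNIV. g y $ j $ k * \<Gamma> k i l)"
    and inv: "\<And>k m. (\<Sum>l\<in>UNIV. metric_inv g y $ k $ l * g y $ l $ m) = (if k = m then 1 else 0)"
  shows "christoffel g y k i j = \<Gamma> k i j"
proof -
  have "partial_deriv i (\<lambda>y. g y $ l $ j) y + partial_deriv j (\<lambda>y. g y $ l $ i) y
      - partial_deriv l (\<lambda>y. g y $ i $ j) y = 2 * (\<Sum>m\<in>UNIV. g y $ l $ m * \<Gamma> m i j)" for l
    by (simp add: dg sym[of _ j i] sym[of _ l i] sym[of _ l j])
  then have "christoffel g y k i j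
      = (\<Sum>l\<in>UNIV. metric_inv g y $ k $ l * (2 * (\<Sum>m\<in>UNIV. g y $ l $ m * \<Gamma> m i j))) / 2"
    by (simp add: christoffel_def)
  also have "\<dots> = (\<Sum>l\<in>UNIV. metric_inv g y $ k $ l * (\<Sum>m\<in>UNIV. g y $ l $ m * \<Gamma> m i j))"
    by (simp add: mult.left_commute flip: sum_distrib_left)
  also have "\<dots> = (\<Sum>m\<in>UNIV. (\<Sum>l\<in>UNIV. metric_inv g y $ k $ l * g y $ l $ m) * \<Gamma> m i j)"
    unfolding sum_distrib_left sum_distrib_right
    by (subst sum.swap) (simp add: mult_ac)
  finally show ?thesis by (simp add: inv sum_delta_UNIV)
qed

text \<open>The formula says that the coframe is parallel once \<open>omega\<close> acts on its
  frame index. Symmetry of the right-hand side in \<open>i\<close> and \<open>j\<close> is the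
  condition \<open>torsion\<close>, compatibility with \<open>g\<close> is \<open>metricity\<close>,
  so \<open>christoffel_lower\<close> applies.\<close>

lemma christoffel_frame:
  assumes y: "y \<in> U"
  shows "christoffel g y k i j
    = (\<Sum>A\<in>UNIV. e A k y * (dE i A j y + (\<Sum>B\<in>UNIV. E B j y * omega i A B y)))"
proof -
  let ?h = "\<lambda>A i j. dE i A j y + (\<Sum>B\<in>UNIV. E B j y * omega i A B y)"
  let ?\<Gamma> = "\<lambda>k i j. \<Sum>A\<in>UNIV. e A k y * ?h A i j"
  have h_sym: "?h A i j = ?h A j i" for A i j
  proof -
    have "(\<Sum>B\<in>UNIV. E B j y * omega i A B y) = (\<Sum>C\<in>UNIV. \<Sum>B\<in>UNIV. \<gamma> A C B y * (E C i y * E B j y))"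
      for i j
      unfolding omega_def sum_distrib_left by (subst sum.swap) (simp add: mult_ac)
    moreover have "(\<Sum>C\<in>UNIV. \<Sum>B\<in>UNIV. \<gamma> A C B y * (E C j y * E B i y))
        = (\<Sum>C\<in>UNIV. \<Sum>B\<in>UNIV. \<gamma> A B C y * (E C i y * E B j y))"
      by (subst sum.swap) (simp add: mult_ac)
    ultimately show ?thesis
      using torsion[OF y, of i A j] by (simp add: left_diff_distrib sum_subtractf)
  qed
  have gE: "(\<Sum>k\<in>UNIV. g y $ l $ k * (\<Sum>A\<in>UNIV. e A k y * F A)) = (\<Sum>A\<in>UNIV. G A y * E A l y * F A)"
    for l F
  proof -
    have "(\<Sum>k\<in>UNIV. g y $ l $ k * (\<Sum>A\<in>UNIV. e A k y * F A))
       = (\<Sum>k\<in>UNIV. \<Sum>A\<in>UNIV. G A y * E A l y * (E A k y * (\<Sum>B\<in>UNIV. e B k y * F B)))"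
      by (simp add: metric[OF y] sum_distrib_right mult.assoc)
    also have "\<dots> = (\<Sum>A\<in>UNIV. G A y * E A l y * (\<Sum>k\<in>UNIV. E A k y * (\<Sum>B\<in>UNIV. e B k y * F B)))"
      by (subst sum.swap) (simp add: sum_distrib_left)
    finally show ?thesis by (simp add: coframe_contract[OF y])
  qed
  \<comment> \<open>\<open>metricity\<close> contracted with the coframe: the symmetrised lowered
    connection form is the derivative of the weights.\<close>
  have om: "G A y * omega i A B y + G B y * omega i B A y
      = (if A = B then (\<Sum>C\<in>UNIV. E C i y * DG C A y) else 0)" for i A B
  proof -
    have "G A y * omega i A B y + G B y * omega i B A y
       = (\<Sum>C\<in>UNIV. E C i y * (G A y * \<gamma> A C B y + G B y * \<gamma> B C A y))"
      by (simp add: omega_def sum_distrib_left sum.distrib distrib_left mult_ac)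
    then show ?thesis by (simp add: metricity[OF y])
  qed
  show ?thesis
  proof (rule christoffel_lower[where \<Gamma> = ?\<Gamma>])
    show "?\<Gamma> k i j = ?\<Gamma> k j i" for k i j
      by (simp only: h_sym)
  next
    fix i l j
    have pd: "has_pd i (\<lambda>y. g y $ l $ j) (\<Sum>A\<in>UNIV.
        ((\<Sum>C\<in>UNIV. E C i y * DG C A y) * E A l y + G A y * dE i A l y) * E A j y
        + G A y * E A l y * dE i A j y) y" (is "has_pd i _ ?D y")
      by (rule has_pd_transform[OF _ open_U y metric[symmetric]])
        (intro has_pd_sum has_pd_mult G_pd[OF y] E_pd[OF y])
    \<comment> \<open>The derivatives of the weights in \<open>?D\<close> are traded for two
      connection terms, one for each index of the metric.\<close>
    have "(\<Sum>A\<in>UNIV. \<Sum>B\<in>UNIV. (G A y * omega i A B y + G B y * omega i B A y) * (E A l y * E B j y))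
       = (\<Sum>A\<in>UNIV. (\<Sum>B\<in>UNIV. (if A = B then 1 else 0)
            * ((\<Sum>C\<in>UNIV. E C i y * DG C A y) * (E A l y * E B j y))))"
      unfolding om by (intro sum.cong refl) simp
    also have "\<dots> = (\<Sum>A\<in>UNIV. (\<Sum>C\<in>UNIV. E C i y * DG C A y) * (E A l y * E A j y))"
      by (simp only: sum_delta_UNIV)
    finally have *: "(\<Sum>A\<in>UNIV. (\<Sum>C\<in>UNIV. E C i y * DG C A y) * (E A l y * E A j y))
       = (\<Sum>A\<in>UNIV. \<Sum>B\<in>UNIV. G A y * E A l y * (E B j y * omega i A B y))
       + (\<Sum>A\<in>UNIV. \<Sum>B\<in>UNIV. G B y * E B j y * (E A l y * omega i B A y))"
      by (simp only: distrib_right distrib_left sum.distrib mult_ac)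
    have "?D = (\<Sum>A\<in>UNIV. (\<Sum>C\<in>UNIV. E C i y * DG C A y) * (E A l y * E A j y))
       + (\<Sum>A\<in>UNIV. G A y * E A l y * dE i A j y) + (\<Sum>A\<in>UNIV. G A y * E A j y * dE i A l y)"
      by (simp add: distrib_right distrib_left sum.distrib mult_ac)
    also have "\<dots> = (\<Sum>A\<in>UNIV. G A y * E A l y * ?h A i j) + (\<Sum>A\<in>UNIV. G A y * E A j y * ?h A i l)"
      unfolding * by (subst (2) sum.swap) (simp add: distrib_left sum.distrib sum_distrib_left)
    finally show "partial_deriv i (\<lambda>y. g y $ l $ j) y
        = (\<Sum>k\<in>UNIV. g y $ l $ k * ?\<Gamma> k i j) + (\<Sum>k\<in>UNIV. g y $ j $ k * ?\<Gamma> k i l)"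
      by (simp only: gE partial_deriv_eqI[OF pd])
  next
    fix k m
    have "(\<Sum>l\<in>UNIV. metric_inv g y $ k $ l * g y $ l $ m)
       = (\<Sum>l\<in>UNIV. \<Sum>A\<in>UNIV. e A k y / G A y * (e A l y * (\<Sum>B\<in>UNIV. E B l y * (G B y * E B m y))))"
      by (simp add: metric[OF y] metric_inv_frame[OF y] sum_distrib_right mult.assoc mult.left_commute)
    also have "\<dots> = (\<Sum>A\<in>UNIV. e A k y / G A y * (\<Sum>l\<in>UNIV. e A l y * (\<Sum>B\<in>UNIV. E B l y * (G B y * E B m y))))"
      by (subst sum.swap) (simp add: sum_distrib_left)
    also have "\<dots> = (\<Sum>A\<in>UNIV. E A m y * e A k y)"
      by (simp only: frame_contract[OF y]) (simp add: G_nz[OF y] mult_ac)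
    finally show "(\<Sum>l\<in>UNIV. metric_inv g y $ k $ l * g y $ l $ m) = (if k = m then 1 else 0)"
      by (simp add: dual'[OF y] eq_commute)
  qed
qed

lemma coframe_christoffel:
  assumes y: "y \<in> U"
  shows "(\<Sum>k\<in>UNIV. E A k y * christoffel g y k i j)
    = dE i A j y + (\<Sum>B\<in>UNIV. E B j y * omega i A B y)"
  by (simp add: christoffel_frame[OF y] coframe_contract[OF y])

section \<open>Curvature in the frame\<close>

lemma omega_pd:
  assumes y: "y \<in> U"
  shows "has_pd c (omega d A B) (\<Sum>D\<in>UNIV. dE c D d y * \<gamma> A D B y
      + E D d y * (\<Sum>C\<in>UNIV. E C c y * D\<gamma> C A D B y)) y"
  unfolding omega_def[abs_def] by (intro has_pd_sum has_pd_mult E_pd[OF y] \<gamma>_pd[OF y])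

text \<open>The curvature operator of the frame vectors C and D applied to the frame vector B. The
  frame fields need not commute: the last product removes the derivative along their bracket, whose
  components are \<open>\<gamma> K C D - \<gamma> K D C\<close> because the torsion
  vanishes.\<close>

definition frame_riemann :: "'n \<Rightarrow> 'n \<Rightarrow> 'n \<Rightarrow> 'n \<Rightarrow> real ^ 'n \<Rightarrow> real" where
  "frame_riemann A B C D y = D\<gamma> C A D B y - D\<gamma> D A C B y
    + (\<Sum>K\<in>UNIV. \<gamma> A C K y * \<gamma> K D B y - \<gamma> A D K y * \<gamma> K C B y
        - (\<gamma> K C D y - \<gamma> K D C y) * \<gamma> A K B y)"

text \<open>The derivative of \<open>e\<close> is only assumed to exist. Existence suffices here,
  since its value drops out later, when the contraction with \<open>E\<close> is differentiated
  instead.\<close>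

lemma christoffel_pd:
  assumes y: "y \<in> U"
  shows "\<exists>D. has_pd c (\<lambda>y. christoffel g y a d b) D y"
proof -
  have "\<exists>D. has_pd c (\<lambda>y. \<Sum>A\<in>UNIV. e A a y * (dE d A b y + (\<Sum>B\<in>UNIV. E B b y * omega d A B y))) D y"
  proof -
    have "\<exists>De. \<forall>A. has_pd c (e A a) (De A) y"
      by (intro choice allI e_pd y)
    then obtain De where De: "has_pd c (e A a) (De A) y" for A by blast
    show ?thesis
      by (rule exI, rule has_pd_sum, rule has_pd_mult, rule De, rule has_pd_add, rule dE_pd[OF y],
          rule has_pd_sum, rule has_pd_mult, rule E_pd[OF y], rule omega_pd[OF y])
  qed
  then obtain D where "has_pd c (\<lambda>y. \<Sum>A\<in>UNIV. e A a y * (dE d A b y + (\<Sum>B\<in>UNIV. E B b y * omega d A B y))) D y"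
    by blast
  from has_pd_transform[OF this open_U y christoffel_frame[symmetric]] show ?thesis by blast
qed

text \<open>The structure equation $\partial_c \omega_d - \partial_d \omega_c + [\omega_c, \omega_d]$,
  obtained by differentiating \<open>coframe_christoffel\<close>.\<close>

lemma coframe_riemann_up:
  assumes y: "y \<in> U"
  shows "(\<Sum>a\<in>UNIV. E A a y * riemann_up g y a b c d)
    = (\<Sum>B\<in>UNIV. E B b y * (\<Sum>C\<in>UNIV. E C c y * (\<Sum>D\<in>UNIV. E D d y * frame_riemann A B C D y)))"
proof -
  define \<Gamma> where "\<Gamma> a c b = christoffel g y a c b" for a c b
  define d\<Gamma> where "d\<Gamma> c a d b = partial_deriv c (\<lambda>y. christoffel g y a d b) y" for c a d b
  define om where "om c A B = omega c A B y" for c A B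
  define dom where "dom c d A B = (\<Sum>D\<in>UNIV. dE c D d y * \<gamma> A D B y
      + E D d y * (\<Sum>C\<in>UNIV. E C c y * D\<gamma> C A D B y))" for c d A B
  have pd\<Gamma>: "has_pd c (\<lambda>y. christoffel g y a d b) (d\<Gamma> c a d b) y" for c a d b
    using christoffel_pd[OF y, of c a d b] partial_deriv_eqI unfolding d\<Gamma>_def by metis
  have E\<Gamma>: "(\<Sum>k\<in>UNIV. E A k y * \<Gamma> k i j) = dE i A j y + (\<Sum>B\<in>UNIV. E B j y * om i A B)" for A i j
    unfolding \<Gamma>_def om_def by (rule coframe_christoffel[OF y])
  \<comment> \<open>The contraction of \<open>E\<close> with the Christoffel symbols is
    differentiated in two ways, by the product rule and through \<open>coframe_christoffel\<close>.
    Comparing them gives the derivative of the Christoffel symbols without that of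
    \<open>e\<close>.\<close>
  have diff: "(\<Sum>a\<in>UNIV. E A a y * d\<Gamma> c a d b) = ddE c d A b y
      + (\<Sum>B\<in>UNIV. dE c B b y * om d A B) + (\<Sum>B\<in>UNIV. E B b y * dom c d A B)
      - (\<Sum>a\<in>UNIV. dE c A a y * \<Gamma> a d b)" for A c d b
  proof -
    have "has_pd c (\<lambda>y. \<Sum>k\<in>UNIV. E A k y * christoffel g y k d b)
       (\<Sum>k\<in>UNIV. dE c A k y * christoffel g y k d b + E A k y * d\<Gamma> c k d b) y"
      by (intro has_pd_sum has_pd_mult E_pd[OF y] pd\<Gamma>)
    moreover have "has_pd c (\<lambda>y. \<Sum>k\<in>UNIV. E A k y * christoffel g y k d b)
       (ddE c d A b y + (\<Sum>B\<in>UNIV. dE c B b y * omega d A B y + E B b y * dom c d A B)) y"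
      unfolding dom_def
      by (rule has_pd_transform[OF _ open_U y coframe_christoffel[symmetric]])
        (intro has_pd_sum has_pd_mult has_pd_add dE_pd[OF y] E_pd[OF y] omega_pd[OF y])
    ultimately have "(\<Sum>k\<in>UNIV. dE c A k y * \<Gamma> k d b + E A k y * d\<Gamma> c k d b)
       = ddE c d A b y + (\<Sum>B\<in>UNIV. dE c B b y * om d A B + E B b y * dom c d A B)"
      unfolding \<Gamma>_def om_def by (rule has_pd_unique)
    then show ?thesis by (simp add: sum.distrib)
  qed
  have quad: "(\<Sum>a\<in>UNIV. E A a y * (\<Sum>k\<in>UNIV. \<Gamma> a c k * \<Gamma> k d b))
     = (\<Sum>k\<in>UNIV. dE c A k y * \<Gamma> k d b) + (\<Sum>B\<in>UNIV. dE d B b y * om c A B)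
       + (\<Sum>B\<in>UNIV. E B b y * (\<Sum>K\<in>UNIV. om c A K * om d K B))" for A c d b
  proof -
    have "(\<Sum>a\<in>UNIV. E A a y * (\<Sum>k\<in>UNIV. \<Gamma> a c k * \<Gamma> k d b))
       = (\<Sum>k\<in>UNIV. (\<Sum>a\<in>UNIV. E A a y * \<Gamma> a c k) * \<Gamma> k d b)"
      unfolding sum_distrib_left sum_distrib_right by (subst sum.swap) (simp add: mult_ac)
    also have "\<dots> = (\<Sum>k\<in>UNIV. dE c A k y * \<Gamma> k d b)
       + (\<Sum>k\<in>UNIV. (\<Sum>B\<in>UNIV. E B k y * om c A B) * \<Gamma> k d b)"
      by (simp add: E\<Gamma> distrib_right sum.distrib)
    also have "(\<Sum>k\<in>UNIV. (\<Sum>B\<in>UNIV. E B k y * om c A B) * \<Gamma> k d b)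
       = (\<Sum>B\<in>UNIV. om c A B * (\<Sum>k\<in>UNIV. E B k y * \<Gamma> k d b))"
      unfolding sum_distrib_left sum_distrib_right by (subst sum.swap) (simp add: mult_ac)
    also have "\<dots> = (\<Sum>B\<in>UNIV. dE d B b y * om c A B)
        + (\<Sum>B\<in>UNIV. om c A B * (\<Sum>K\<in>UNIV. E K b y * om d B K))"
      by (simp add: E\<Gamma> distrib_left sum.distrib mult.commute)
    also have "(\<Sum>B\<in>UNIV. om c A B * (\<Sum>K\<in>UNIV. E K b y * om d B K))
        = (\<Sum>B\<in>UNIV. E B b y * (\<Sum>K\<in>UNIV. om c A K * om d K B))"
      unfolding sum_distrib_left sum_distrib_right by (subst sum.swap) (simp add: mult_ac)
    finally show ?thesis by (simp add: add_ac)
  qed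
  have "(\<Sum>a\<in>UNIV. E A a y * riemann_up g y a b c d)
     = (\<Sum>a\<in>UNIV. E A a y * d\<Gamma> c a d b) - (\<Sum>a\<in>UNIV. E A a y * d\<Gamma> d a c b)
       + (\<Sum>a\<in>UNIV. E A a y * (\<Sum>k\<in>UNIV. \<Gamma> a c k * \<Gamma> k d b))
       - (\<Sum>a\<in>UNIV. E A a y * (\<Sum>k\<in>UNIV. \<Gamma> a d k * \<Gamma> k c b))"
    unfolding riemann_up_def \<Gamma>_def d\<Gamma>_def
    by (simp only: distrib_left right_diff_distrib sum.distrib sum_subtractf)
  \<comment> \<open>The products of \<open>dE\<close> with \<open>\<Gamma>\<close> cancel between
    \<open>diff\<close> and \<open>quad\<close>; those of \<open>dE\<close> with \<open>om\<close>
    cancel between \<open>diff\<close> and the \<open>quad\<close> in which \<open>c\<close> and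
    \<open>d\<close> are exchanged; the second derivatives of the coframe cancel by
    \<open>ddE_sym\<close>.\<close>
  also have "\<dots> = (\<Sum>B\<in>UNIV. E B b y * (dom c d A B - dom d c A B
       + (\<Sum>K\<in>UNIV. om c A K * om d K B) - (\<Sum>K\<in>UNIV. om d A K * om c K B)))"
    unfolding diff quad
    by (simp add: ddE_sym[OF y, of c d] distrib_left right_diff_distrib sum.distrib sum_subtractf)
  also have "\<dots> = (\<Sum>B\<in>UNIV. E B b y * (\<Sum>C\<in>UNIV. E C c y * (\<Sum>D\<in>UNIV. E D d y * frame_riemann A B C D y)))"
  proof (rule sum.cong[OF refl], rule arg_cong2[where f = "(*)", OF refl])
    fix B
    have oo: "(\<Sum>K\<in>UNIV. om c A K * om d K B)
       = (\<Sum>C\<in>UNIV. \<Sum>D\<in>UNIV. E C c y * E D d y * (\<Sum>K\<in>UNIV. \<gamma> A C K y * \<gamma> K D B y))" for c d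
    proof -
      have "(\<Sum>K\<in>UNIV. om c A K * om d K B)
        = (\<Sum>K\<in>UNIV. \<Sum>C\<in>UNIV. \<Sum>D\<in>UNIV. E C c y * E D d y * (\<gamma> A C K y * \<gamma> K D B y))"
        unfolding om_def omega_def by (simp add: sum_product mult_ac)
      also have "\<dots> = (\<Sum>C\<in>UNIV. \<Sum>D\<in>UNIV. \<Sum>K\<in>UNIV. E C c y * E D d y * (\<gamma> A C K y * \<gamma> K D B y))"
        by (subst sum.swap) (intro sum.cong refl sum.swap)
      finally show ?thesis by (simp add: sum_distrib_left)
    qed
    have oo': "(\<Sum>K\<in>UNIV. om d A K * om c K B)
       = (\<Sum>C\<in>UNIV. \<Sum>D\<in>UNIV. E C c y * E D d y * (\<Sum>K\<in>UNIV. \<gamma> A D K y * \<gamma> K C B y))"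
      unfolding oo by (subst sum.swap) (simp add: mult_ac)
    have "dom c d A B - dom d c A B
       = (\<Sum>K\<in>UNIV. (dE c K d y - dE d K c y) * \<gamma> A K B y)
       + (\<Sum>D\<in>UNIV. \<Sum>C\<in>UNIV. E D d y * (E C c y * D\<gamma> C A D B y))
       - (\<Sum>C\<in>UNIV. \<Sum>D\<in>UNIV. E C c y * (E D d y * D\<gamma> D A C B y))"
      unfolding dom_def by (simp add: sum.distrib sum_distrib_left left_diff_distrib sum_subtractf)
    also have "(\<Sum>D\<in>UNIV. \<Sum>C\<in>UNIV. E D d y * (E C c y * D\<gamma> C A D B y))
       = (\<Sum>C\<in>UNIV. \<Sum>D\<in>UNIV. E C c y * E D d y * D\<gamma> C A D B y)"
      by (subst sum.swap) (simp add: mult_ac)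
    \<comment> \<open>Replacing the exterior derivative of the coframe by connection terms produces
      the bracket term of \<open>frame_riemann\<close>.\<close>
    also have "(\<Sum>K\<in>UNIV. (dE c K d y - dE d K c y) * \<gamma> A K B y)
       = (\<Sum>C\<in>UNIV. \<Sum>D\<in>UNIV. E C c y * E D d y * (\<Sum>K\<in>UNIV. (\<gamma> K D C y - \<gamma> K C D y) * \<gamma> A K B y))"
    proof -
      have "(\<Sum>K\<in>UNIV. (dE c K d y - dE d K c y) * \<gamma> A K B y)
         = (\<Sum>K\<in>UNIV. \<Sum>C\<in>UNIV. \<Sum>D\<in>UNIV. E C c y * E D d y * ((\<gamma> K D C y - \<gamma> K C D y) * \<gamma> A K B y))"
        by (simp add: torsion[OF y] sum_distrib_left sum_distrib_right mult_ac)
      also have "\<dots> = (\<Sum>C\<in>UNIV. \<Sum>D\<in>UNIV. \<Sum>K\<in>UNIV. E C c y * E D d y * ((\<gamma> K D C y - \<gamma> K C D y) * \<gamma> A K B y))"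
        by (subst sum.swap) (intro sum.cong refl sum.swap)
      finally show ?thesis by (simp add: sum_distrib_left)
    qed
    finally have "dom c d A B - dom d c A B
       + (\<Sum>K\<in>UNIV. om c A K * om d K B) - (\<Sum>K\<in>UNIV. om d A K * om c K B)
       = (\<Sum>C\<in>UNIV. \<Sum>D\<in>UNIV. E C c y * E D d y *
           ((\<Sum>K\<in>UNIV. (\<gamma> K D C y - \<gamma> K C D y) * \<gamma> A K B y) + D\<gamma> C A D B y - D\<gamma> D A C B y
            + (\<Sum>K\<in>UNIV. \<gamma> A C K y * \<gamma> K D B y) - (\<Sum>K\<in>UNIV. \<gamma> A D K y * \<gamma> K C B y)))"
      unfolding oo[of c d] oo'
      by (simp only: distrib_left right_diff_distrib sum.distrib sum_subtractf mult.assoc)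
    also have "\<dots> = (\<Sum>C\<in>UNIV. \<Sum>D\<in>UNIV. E C c y * (E D d y * frame_riemann A B C D y))"
      unfolding frame_riemann_def
      by (simp add: sum.distrib sum_subtractf left_diff_distrib mult.assoc algebra_simps)
    finally show "dom c d A B - dom d c A B
       + (\<Sum>K\<in>UNIV. om c A K * om d K B) - (\<Sum>K\<in>UNIV. om d A K * om c K B)
       = (\<Sum>C\<in>UNIV. E C c y * (\<Sum>D\<in>UNIV. E D d y * frame_riemann A B C D y))"
      by (simp add: sum_distrib_left)
  qed
  finally show ?thesis .
qed

definition pullback4 :: "('n \<Rightarrow> 'n \<Rightarrow> 'n \<Rightarrow> 'n \<Rightarrow> real ^ 'n \<Rightarrow> real) \<Rightarrow> 'n cotensor4" where
  "pullback4 T y a b c d = (\<Sum>A\<in>UNIV. E A a y * (\<Sum>B\<in>UNIV. E B b y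
     * (\<Sum>C\<in>UNIV. E C c y * (\<Sum>D\<in>UNIV. E D d y * T A B C D y))))"

lemma riemann_frame:
  assumes y: "y \<in> U"
  shows "riemann g y = pullback4 (\<lambda>A B C D y. G A y * frame_riemann A B C D y) y"
proof (intro ext)
  fix a b c d
  have "riemann g y a b c d = (\<Sum>k\<in>UNIV. \<Sum>A\<in>UNIV. G A y * E A a y * (E A k y * riemann_up g y k b c d))"
    by (simp add: riemann_def metric[OF y] sum_distrib_right mult.assoc)
  also have "\<dots> = (\<Sum>A\<in>UNIV. G A y * E A a y * (\<Sum>k\<in>UNIV. E A k y * riemann_up g y k b c d))"
    by (subst sum.swap) (simp add: sum_distrib_left)
  also have "\<dots> = pullback4 (\<lambda>A B C D y. G A y * frame_riemann A B C D y) y a b c d"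
    unfolding coframe_riemann_up[OF y] pullback4_def by (simp add: sum_distrib_left mult_ac)
  finally show "riemann g y a b c d = pullback4 (\<lambda>A B C D y. G A y * frame_riemann A B C D y) y a b c d" .
qed

lemma riemann_up_frame:
  assumes y: "y \<in> U"
  shows "riemann_up g y a b c d = (\<Sum>A\<in>UNIV. e A a y * (\<Sum>B\<in>UNIV. E B b y
     * (\<Sum>C\<in>UNIV. E C c y * (\<Sum>D\<in>UNIV. E D d y * frame_riemann A B C D y))))"
  using expand_frame[OF y, of a "\<lambda>a. riemann_up g y a b c d"]
  by (simp add: coframe_riemann_up[OF y])

text \<open>The traced upper index carries \<open>e\<close> and the traced lower one carries
  \<open>E\<close>, so duality alone, without any weights, turns the coordinate trace into the trace
  of the frame components.\<close>

lemma ricci_flat: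
  assumes y: "y \<in> U" and flat: "\<And>B D. (\<Sum>A\<in>UNIV. frame_riemann A B A D y) = 0"
  shows "ricci g y b d = 0"
proof -
  have "ricci g y b d = (\<Sum>a\<in>UNIV. \<Sum>A\<in>UNIV. e A a y * (\<Sum>C\<in>UNIV. E C a y *
      (\<Sum>B\<in>UNIV. E B b y * (\<Sum>D\<in>UNIV. E D d y * frame_riemann A B C D y))))"
  proof -
    have "(\<Sum>B\<in>UNIV. E B b y * (\<Sum>C\<in>UNIV. E C a y * (\<Sum>D\<in>UNIV. E D d y * frame_riemann A B C D y)))
       = (\<Sum>C\<in>UNIV. E C a y * (\<Sum>B\<in>UNIV. E B b y * (\<Sum>D\<in>UNIV. E D d y * frame_riemann A B C D y)))"
      for A a
      unfolding sum_distrib_left by (subst sum.swap) (simp add: mult_ac)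
    then show ?thesis by (simp add: ricci_def riemann_up_frame[OF y])
  qed
  also have "\<dots> = (\<Sum>A\<in>UNIV. \<Sum>a\<in>UNIV. e A a y * (\<Sum>C\<in>UNIV. E C a y *
      (\<Sum>B\<in>UNIV. E B b y * (\<Sum>D\<in>UNIV. E D d y * frame_riemann A B C D y))))"
    by (rule sum.swap)
  also have "\<dots> = (\<Sum>A\<in>UNIV. \<Sum>B\<in>UNIV. E B b y * (\<Sum>D\<in>UNIV. E D d y * frame_riemann A B A D y))"
    by (simp only: frame_contract[OF y])
  also have "\<dots> = (\<Sum>B\<in>UNIV. E B b y * (\<Sum>D\<in>UNIV. E D d y * (\<Sum>A\<in>UNIV. frame_riemann A B A D y)))"
    unfolding sum_distrib_left
    by (subst sum.swap) (intro sum.cong refl sum.swap)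
  finally show ?thesis by (simp add: flat)
qed

lemma weyl_frame_of_ricci_flat:
  assumes y: "y \<in> U" and flat: "\<And>B D. (\<Sum>A\<in>UNIV. frame_riemann A B A D y) = 0"
  shows "weyl g y = pullback4 (\<lambda>A B C D y. G A y * frame_riemann A B C D y) y"
proof -
  have "weyl g y = riemann g y"
    by (intro ext) (simp add: weyl_def scalar_curvature_def ricci_flat[OF y flat])
  then show ?thesis by (simp add: riemann_frame[OF y])
qed

section \<open>Covariant derivative of a covariant 4-tensor in the frame\<close>

lemma covariant_slot:
  assumes y: "y \<in> U"
  shows "(\<Sum>A\<in>UNIV. dE i A a y * F A) - (\<Sum>k\<in>UNIV. christoffel g y k i a * (\<Sum>A\<in>UNIV. E A k y * F A))
    = - (\<Sum>A\<in>UNIV. E A a y * (\<Sum>K\<in>UNIV. omega i K A y * F K))"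
proof -
  \<comment> \<open>\<open>coframe_christoffel\<close> read as the covariant derivative of a
    covector: that of \<open>E A\<close> is minus the sum over B of \<open>omega i A B\<close> times
    \<open>E B\<close>.\<close>
  have "(\<Sum>k\<in>UNIV. christoffel g y k i a * (\<Sum>A\<in>UNIV. E A k y * F A))
     = (\<Sum>A\<in>UNIV. (\<Sum>k\<in>UNIV. E A k y * christoffel g y k i a) * F A)"
    unfolding sum_distrib_left sum_distrib_right by (subst sum.swap) (simp add: mult_ac)
  also have "\<dots> = (\<Sum>A\<in>UNIV. dE i A a y * F A)
     + (\<Sum>A\<in>UNIV. (\<Sum>B\<in>UNIV. E B a y * omega i A B y) * F A)"
    by (simp add: coframe_christoffel[OF y] distrib_right sum.distrib)
  also have "(\<Sum>A\<in>UNIV. (\<Sum>B\<in>UNIV. E B a y * omega i A B y) * F A)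
     = (\<Sum>A\<in>UNIV. E A a y * (\<Sum>K\<in>UNIV. omega i K A y * F K))"
    unfolding sum_distrib_left sum_distrib_right by (subst sum.swap) (simp add: mult_ac)
  finally show ?thesis by simp
qed

text \<open>One step of the product rule: \<open>X\<close> collects the derivative and the connection terms of the
  remaining slots.\<close>

lemma covariant_slot_step:
  assumes y: "y \<in> U"
  shows "(\<Sum>A\<in>UNIV. dE i A a y * F A + E A a y * dF A)
      - (\<Sum>k\<in>UNIV. christoffel g y k i a * (\<Sum>A\<in>UNIV. E A k y * F A))
      - (\<Sum>A\<in>UNIV. E A a y * X A)
    = (\<Sum>A\<in>UNIV. E A a y * (dF A - X A - (\<Sum>K\<in>UNIV. omega i K A y * F K)))"
  using covariant_slot[OF y, of i a F]
  by (simp add: right_diff_distrib sum.distrib sum_subtractf)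

definition frame_cov_deriv4 ::
    "('n \<Rightarrow> 'n \<Rightarrow> 'n \<Rightarrow> 'n \<Rightarrow> real ^ 'n \<Rightarrow> real) \<Rightarrow> ('n \<Rightarrow> 'n \<Rightarrow> 'n \<Rightarrow> 'n \<Rightarrow> 'n \<Rightarrow> real ^ 'n \<Rightarrow> real)
      \<Rightarrow> real ^ 'n \<Rightarrow> 'n \<Rightarrow> 'n \<Rightarrow> 'n \<Rightarrow> 'n \<Rightarrow> 'n \<Rightarrow> real" where
  "frame_cov_deriv4 T DT y M A B C D = DT M A B C D y
     - (\<Sum>K\<in>UNIV. \<gamma> K M A y * T K B C D y) - (\<Sum>K\<in>UNIV. \<gamma> K M B y * T A K C D y)
     - (\<Sum>K\<in>UNIV. \<gamma> K M C y * T A B K D y) - (\<Sum>K\<in>UNIV. \<gamma> K M D y * T A B C K y)"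

lemma sum_swap_coframe:
  "(\<Sum>k\<in>UNIV. f k * (\<Sum>A\<in>UNIV. E A a y * h k A)) = (\<Sum>A\<in>UNIV. E A a y * (\<Sum>k\<in>UNIV. f k * h k A))"
  unfolding sum_distrib_left by (subst sum.swap) (simp add: mult_ac)

lemma omega_sum:
  "(\<Sum>K\<in>UNIV. omega i K A y * F K) = (\<Sum>M\<in>UNIV. E M i y * (\<Sum>K\<in>UNIV. \<gamma> K M A y * F K))"
  unfolding sum_distrib_left omega_def sum_distrib_right by (subst sum.swap) (simp add: mult_ac)

lemma cov_deriv4_frame:
  assumes y: "y \<in> U"
    and T: "\<And>z. z \<in> U \<Longrightarrow> S z = pullback4 T z"
    and DT: "\<And>A B C D i. has_pd i (T A B C D) (\<Sum>M\<in>UNIV. E M i y * DT M A B C D y) y"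
  shows "cov_deriv4 g S y i a b c d = (\<Sum>M\<in>UNIV. E M i y * (\<Sum>A\<in>UNIV. E A a y * (\<Sum>B\<in>UNIV. E B b y
     * (\<Sum>C\<in>UNIV. E C c y * (\<Sum>D\<in>UNIV. E D d y * frame_cov_deriv4 T DT y M A B C D)))))"
proof -
  \<comment> \<open>\<open>T4\<close>, \<open>T3\<close>, \<open>T2\<close> carry one, two, three
    trailing coordinate slots and keep the other slots in the frame, so the product rule and the
    Christoffel terms can be matched one slot at a time.\<close>
  define T4 where "T4 A B C d z = (\<Sum>D\<in>UNIV. E D d z * T A B C D z)" for A B C d z
  define T3 where "T3 A B c d z = (\<Sum>C\<in>UNIV. E C c z * T4 A B C d z)" for A B c d z
  define T2 where "T2 A b c d z = (\<Sum>B\<in>UNIV. E B b z * T3 A B c d z)" for A b c d z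
  define dT where "dT A B C D = (\<Sum>M\<in>UNIV. E M i y * DT M A B C D y)" for A B C D
  define dT4 where "dT4 A B C d = (\<Sum>D\<in>UNIV. dE i D d y * T A B C D y + E D d y * dT A B C D)" for A B C d
  define dT3 where "dT3 A B c d = (\<Sum>C\<in>UNIV. dE i C c y * T4 A B C d y + E C c y * dT4 A B C d)" for A B c d
  define dT2 where "dT2 A b c d = (\<Sum>B\<in>UNIV. dE i B b y * T3 A B c d y + E B b y * dT3 A B c d)" for A b c d
  define dT1 where "dT1 a b c d = (\<Sum>A\<in>UNIV. dE i A a y * T2 A b c d y + E A a y * dT2 A b c d)" for a b c d
  have S_eq: "S z a b c d = (\<Sum>A\<in>UNIV. E A a z * T2 A b c d z)" if "z \<in> U" for z a b c d
    unfolding T[OF that] pullback4_def T2_def T3_def T4_def ..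
  have "has_pd i (T4 A B C d) (dT4 A B C d) y" for A B C d
    unfolding T4_def[abs_def] dT4_def dT_def by (intro has_pd_sum has_pd_mult E_pd[OF y] DT)
  then have "has_pd i (T3 A B c d) (dT3 A B c d) y" for A B c d
    unfolding T3_def[abs_def] dT3_def by (intro has_pd_sum has_pd_mult E_pd[OF y])
  then have "has_pd i (T2 A b c d) (dT2 A b c d) y" for A b c d
    unfolding T2_def[abs_def] dT2_def by (intro has_pd_sum has_pd_mult E_pd[OF y])
  then have "has_pd i (\<lambda>z. \<Sum>A\<in>UNIV. E A a z * T2 A b c d z) (dT1 a b c d) y"
    unfolding dT1_def by (intro has_pd_sum has_pd_mult E_pd[OF y])
  then have pd: "partial_deriv i (\<lambda>z. S z a b c d) y = dT1 a b c d"
    by (intro partial_deriv_eqI has_pd_transform[OF _ open_U y S_eq[symmetric]])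
  \<comment> \<open>\<open>N4\<close>, \<open>N3\<close>, \<open>N2\<close> are the covariant
    derivatives of \<open>T4\<close>, \<open>T3\<close>, \<open>T2\<close> in which only the
    coordinate slots receive connection terms; the frame slots are mere labels.\<close>
  define N4 where "N4 A B C d = (\<Sum>D\<in>UNIV. E D d y * (dT A B C D - (\<Sum>K\<in>UNIV. omega i K D y * T A B C K y)))"
    for A B C d
  define N3 where "N3 A B c d = (\<Sum>C\<in>UNIV. E C c y * (N4 A B C d - (\<Sum>K\<in>UNIV. omega i K C y * T4 A B K d y)))"
    for A B c d
  define N2 where "N2 A b c d = (\<Sum>B\<in>UNIV. E B b y * (N3 A B c d - (\<Sum>K\<in>UNIV. omega i K B y * T3 A K c d y)))"
    for A b c d
  have N4: "dT4 A B C d - (\<Sum>k\<in>UNIV. christoffel g y k i d * T4 A B C k y) = N4 A B C d" for A B C d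
    using covariant_slot_step[OF y, of i d "\<lambda>D. T A B C D y" "dT A B C" "\<lambda>_. 0"]
    by (simp add: dT4_def T4_def N4_def)
  have N3: "dT3 A B c d - (\<Sum>k\<in>UNIV. christoffel g y k i c * T3 A B k d y)
      - (\<Sum>k\<in>UNIV. christoffel g y k i d * T3 A B c k y) = N3 A B c d" for A B c d
  proof -
    have "(\<Sum>k\<in>UNIV. christoffel g y k i d * T3 A B c k y)
       = (\<Sum>C\<in>UNIV. E C c y * (\<Sum>k\<in>UNIV. christoffel g y k i d * T4 A B C k y))"
      unfolding T3_def by (rule sum_swap_coframe)
    then show ?thesis
      unfolding N3_def dT3_def N4[symmetric]
      by (simp only: T3_def covariant_slot_step[OF y])
  qed
  have N2: "dT2 A b c d - (\<Sum>k\<in>UNIV. christoffel g y k i b * T2 A k c d y)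
      - (\<Sum>k\<in>UNIV. christoffel g y k i c * T2 A b k d y)
      - (\<Sum>k\<in>UNIV. christoffel g y k i d * T2 A b c k y) = N2 A b c d" for A b c d
  proof -
    have "(\<Sum>k\<in>UNIV. christoffel g y k i c * T2 A b k d y) + (\<Sum>k\<in>UNIV. christoffel g y k i d * T2 A b c k y)
       = (\<Sum>B\<in>UNIV. E B b y * ((\<Sum>k\<in>UNIV. christoffel g y k i c * T3 A B k d y)
          + (\<Sum>k\<in>UNIV. christoffel g y k i d * T3 A B c k y)))"
      unfolding T2_def sum_swap_coframe by (simp only: distrib_left sum.distrib)
    moreover have "dT2 A b c d - (\<Sum>k\<in>UNIV. christoffel g y k i b * T2 A k c d y)
       - (\<Sum>B\<in>UNIV. E B b y * ((\<Sum>k\<in>UNIV. christoffel g y k i c * T3 A B k d y)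
          + (\<Sum>k\<in>UNIV. christoffel g y k i d * T3 A B c k y))) = N2 A b c d"
      unfolding N2_def dT2_def N3[symmetric] diff_diff_eq[of "dT3 _ _ _ _"]
      by (simp only: T2_def covariant_slot_step[OF y]) (simp only: diff_diff_eq)
    ultimately show ?thesis by simp
  qed
  have "cov_deriv4 g S y i a b c d = dT1 a b c d - (\<Sum>k\<in>UNIV. christoffel g y k i a * (\<Sum>A\<in>UNIV. E A k y * T2 A b c d y))
     - (\<Sum>A\<in>UNIV. E A a y * ((\<Sum>k\<in>UNIV. christoffel g y k i b * T2 A k c d y)
      + (\<Sum>k\<in>UNIV. christoffel g y k i c * T2 A b k d y)
      + (\<Sum>k\<in>UNIV. christoffel g y k i d * T2 A b c k y)))"
    unfolding cov_deriv4_def pd S_eq[OF y] sum_swap_coframe by (simp add: distrib_left sum.distrib)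
  also have "\<dots> = (\<Sum>A\<in>UNIV. E A a y * (N2 A b c d - (\<Sum>K\<in>UNIV. omega i K A y * T2 K b c d y)))"
    unfolding dT1_def covariant_slot_step[OF y] N2[symmetric] by (simp add: diff_diff_eq add_ac)
  also have "\<dots> = (\<Sum>A\<in>UNIV. E A a y * (\<Sum>B\<in>UNIV. E B b y * (\<Sum>C\<in>UNIV. E C c y * (\<Sum>D\<in>UNIV. E D d y *
      (\<Sum>M\<in>UNIV. E M i y * frame_cov_deriv4 T DT y M A B C D)))))"
  proof -
    note omega_swap = sum_swap_coframe[of "\<lambda>K. omega i K X y" for X]
    note fold_diff = sum_subtractf[symmetric] right_diff_distrib[symmetric]
    have 4: "N4 A B C d - (\<Sum>K\<in>UNIV. omega i K C y * T4 A B K d y)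
      = (\<Sum>D\<in>UNIV. E D d y * (dT A B C D - (\<Sum>K\<in>UNIV. omega i K D y * T A B C K y)
          - (\<Sum>K\<in>UNIV. omega i K C y * T A B K D y)))" for A B C
      by (simp only: N4_def T4_def omega_swap fold_diff)
    have 3: "N3 A B c d - (\<Sum>K\<in>UNIV. omega i K B y * T3 A K c d y)
      = (\<Sum>C\<in>UNIV. E C c y * (\<Sum>D\<in>UNIV. E D d y * (dT A B C D - (\<Sum>K\<in>UNIV. omega i K D y * T A B C K y)
          - (\<Sum>K\<in>UNIV. omega i K C y * T A B K D y) - (\<Sum>K\<in>UNIV. omega i K B y * T A K C D y))))" for A B
      by (simp only: N3_def T3_def omega_swap, simp only: fold_diff, simp only: 4) (simp only: T4_def omega_swap, simp only: fold_diff)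
    have 2: "N2 A b c d - (\<Sum>K\<in>UNIV. omega i K A y * T2 K b c d y)
      = (\<Sum>B\<in>UNIV. E B b y * (\<Sum>C\<in>UNIV. E C c y * (\<Sum>D\<in>UNIV. E D d y * (dT A B C D
          - (\<Sum>K\<in>UNIV. omega i K D y * T A B C K y) - (\<Sum>K\<in>UNIV. omega i K C y * T A B K D y)
          - (\<Sum>K\<in>UNIV. omega i K B y * T A K C D y) - (\<Sum>K\<in>UNIV. omega i K A y * T K B C D y)))))" for A
      by (simp only: N2_def T2_def omega_swap, simp only: fold_diff, simp only: 3) (simp only: T3_def T4_def omega_swap, simp only: fold_diff)
    have 1: "dT A B C D - (\<Sum>K\<in>UNIV. omega i K D y * T A B C K y) - (\<Sum>K\<in>UNIV. omega i K C y * T A B K D y)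
        - (\<Sum>K\<in>UNIV. omega i K B y * T A K C D y) - (\<Sum>K\<in>UNIV. omega i K A y * T K B C D y)
      = (\<Sum>M\<in>UNIV. E M i y * frame_cov_deriv4 T DT y M A B C D)" for A B C D
      unfolding dT_def omega_sum fold_diff
      by (intro sum.cong refl) (simp add: frame_cov_deriv4_def)
    show ?thesis by (simp only: 1 2)
  qed
  also have "\<dots> = (\<Sum>M\<in>UNIV. E M i y * (\<Sum>A\<in>UNIV. E A a y * (\<Sum>B\<in>UNIV. E B b y
     * (\<Sum>C\<in>UNIV. E C c y * (\<Sum>D\<in>UNIV. E D d y * frame_cov_deriv4 T DT y M A B C D)))))"
    by (simp only: sum_swap_coframe[of "\<lambda>A. E A a y" i y] sum_swap_coframe[of "\<lambda>A. E A b y" i y]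
      sum_swap_coframe[of "\<lambda>A. E A c y" i y] sum_swap_coframe[of "\<lambda>A. E A d y" i y])
  finally show ?thesis .
qed

section \<open>Contraction of all five indices\<close>

lemma raise_slot:
  assumes y: "y \<in> U"
  shows "(\<Sum>a\<in>UNIV. (\<Sum>A\<in>UNIV. E A a y * F A) * (\<Sum>a'\<in>UNIV. metric_inv g y $ a $ a' * (\<Sum>A\<in>UNIV. E A a' y * H A)))
    = (\<Sum>A\<in>UNIV. F A * H A / G A y)"
proof -
  \<comment> \<open>Raising the index exchanges the coframe for the dual frame and divides by the
    weight.\<close>
  have "(\<Sum>a'\<in>UNIV. metric_inv g y $ a $ a' * (\<Sum>A\<in>UNIV. E A a' y * H A)) = (\<Sum>B\<in>UNIV. e B a y * (H B / G B y))" for a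
  proof -
    have "(\<Sum>a'\<in>UNIV. metric_inv g y $ a $ a' * (\<Sum>A\<in>UNIV. E A a' y * H A))
      = (\<Sum>B\<in>UNIV. e B a y / G B y * (\<Sum>a'\<in>UNIV. e B a' y * (\<Sum>A\<in>UNIV. E A a' y * H A)))"
      unfolding metric_inv_frame[OF y] sum_distrib_right sum_distrib_left[of "e _ a y / G _ y"]
      by (subst sum.swap) (simp add: mult.assoc)
    then show ?thesis by (simp only: frame_contract[OF y]) simp
  qed
  then have "(\<Sum>a\<in>UNIV. (\<Sum>A\<in>UNIV. E A a y * F A) * (\<Sum>a'\<in>UNIV. metric_inv g y $ a $ a' * (\<Sum>A\<in>UNIV. E A a' y * H A)))
    = (\<Sum>A\<in>UNIV. F A * (\<Sum>a\<in>UNIV. E A a y * (\<Sum>B\<in>UNIV. e B a y * (H B / G B y))))"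
    unfolding sum_distrib_left[of "F _"] sum_distrib_right[of _ _ "sum _ _"]
    by (subst sum.swap) (simp add: mult_ac)
  then show ?thesis by (simp only: coframe_contract[OF y]) simp
qed

text \<open>Orthogonality makes each of the five contractions diagonal, so no cross terms
  survive.\<close>

lemma I3_frame:
  assumes y: "y \<in> U"
    and N: "\<And>\<mu> a b c d. cov_deriv4 g (weyl g) y \<mu> a b c d = (\<Sum>M\<in>UNIV. E M \<mu> y * (\<Sum>A\<in>UNIV. E A a y
      * (\<Sum>B\<in>UNIV. E B b y * (\<Sum>C\<in>UNIV. E C c y * (\<Sum>D\<in>UNIV. E D d y * N M A B C D)))))"
  shows "I3 g y = (\<Sum>M\<in>UNIV. (\<Sum>A\<in>UNIV. (\<Sum>B\<in>UNIV. (\<Sum>C\<in>UNIV. (\<Sum>D\<in>UNIV.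
    (N M A B C D)\<^sup>2 / G D y) / G C y) / G B y) / G A y) / G M y)"
proof -
  let ?i = "metric_inv g y"
  define S4 where "S4 M A B C d = (\<Sum>D\<in>UNIV. E D d y * N M A B C D)" for M A B C d
  define S3 where "S3 M A B c d = (\<Sum>C\<in>UNIV. E C c y * S4 M A B C d)" for M A B c d
  define S2 where "S2 M A b c d = (\<Sum>B\<in>UNIV. E B b y * S3 M A B c d)" for M A b c d
  define S1 where "S1 M a b c d = (\<Sum>A\<in>UNIV. E A a y * S2 M A b c d)" for M a b c d
  define S0 where "S0 \<mu> a b c d = (\<Sum>M\<in>UNIV. E M \<mu> y * S1 M a b c d)" for \<mu> a b c d
  \<comment> \<open>\<open>R4\<close> to \<open>R0\<close> are \<open>S4\<close> to
    \<open>S0\<close> with the coordinate indices raised, nested so that every level has the shape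
    of \<open>raise_slot\<close>.\<close>
  define R4 where "R4 M A B C d = (\<Sum>d'\<in>UNIV. ?i $ d $ d' * S4 M A B C d')" for M A B C d
  define R3 where "R3 M A B c d = (\<Sum>c'\<in>UNIV. ?i $ c $ c' * (\<Sum>C\<in>UNIV. E C c' y * R4 M A B C d))" for M A B c d
  define R2 where "R2 M A b c d = (\<Sum>b'\<in>UNIV. ?i $ b $ b' * (\<Sum>B\<in>UNIV. E B b' y * R3 M A B c d))" for M A b c d
  define R1 where "R1 M a b c d = (\<Sum>a'\<in>UNIV. ?i $ a $ a' * (\<Sum>A\<in>UNIV. E A a' y * R2 M A b c d))" for M a b c d
  define R0 where "R0 \<mu> a b c d = (\<Sum>\<mu>'\<in>UNIV. ?i $ \<mu> $ \<mu>' * (\<Sum>M\<in>UNIV. E M \<mu>' y * R1 M a b c d))" for \<mu> a b c d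
  have S0: "cov_deriv4 g (weyl g) y = S0"
    unfolding S0_def S1_def S2_def S3_def S4_def by (intro ext N)
  note inv_swap = sum_swap_coframe[of "\<lambda>k. ?i $ z $ k" for z]
  have "raise5 g y S0 \<mu> a b c d = R0 \<mu> a b c d" for \<mu> a b c d
  proof -
    have "raise5 g y S0 \<mu> a b c d = (\<Sum>\<mu>'\<in>UNIV. ?i $ \<mu> $ \<mu>' * (\<Sum>a'\<in>UNIV. ?i $ a $ a' *
       (\<Sum>b'\<in>UNIV. ?i $ b $ b' * (\<Sum>c'\<in>UNIV. ?i $ c $ c' * (\<Sum>d'\<in>UNIV. ?i $ d $ d' * S0 \<mu>' a' b' c' d')))))"
      by (simp add: raise5_def sum_distrib_left mult.assoc)
    then show ?thesis
      by (simp only: R0_def R1_def R2_def R3_def R4_def S0_def S1_def S2_def S3_def inv_swap)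
  qed
  then have I: "I3 g y = (\<Sum>\<mu>\<in>UNIV. \<Sum>a\<in>UNIV. \<Sum>b\<in>UNIV. \<Sum>c\<in>UNIV. \<Sum>d\<in>UNIV. S0 \<mu> a b c d * R0 \<mu> a b c d)"
    by (simp add: I3_def S0)
  \<comment> \<open>The rotations carry the outermost sum to the innermost place, where
    \<open>raise_slot\<close> can contract that slot.\<close>
  have rot2: "(\<Sum>c\<in>UNIV. \<Sum>d\<in>UNIV. f c d) = (\<Sum>d\<in>UNIV. \<Sum>c\<in>UNIV. f c d)"
    for f :: "'n \<Rightarrow> 'n \<Rightarrow> real"
    by (rule sum.swap)
  have rot3: "(\<Sum>b\<in>UNIV. \<Sum>c\<in>UNIV. \<Sum>d\<in>UNIV. f b c d) = (\<Sum>c\<in>UNIV. \<Sum>d\<in>UNIV. \<Sum>b\<in>UNIV. f b c d)"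
    for f :: "'n \<Rightarrow> 'n \<Rightarrow> 'n \<Rightarrow> real"
    by (rule trans[OF sum.swap sum.cong[OF refl rot2]])
  have rot4: "(\<Sum>a\<in>UNIV. \<Sum>b\<in>UNIV. \<Sum>c\<in>UNIV. \<Sum>d\<in>UNIV. f a b c d)
      = (\<Sum>b\<in>UNIV. \<Sum>c\<in>UNIV. \<Sum>d\<in>UNIV. \<Sum>a\<in>UNIV. f a b c d)"
    for f :: "'n \<Rightarrow> 'n \<Rightarrow> 'n \<Rightarrow> 'n \<Rightarrow> real"
    by (rule trans[OF sum.swap sum.cong[OF refl rot3]])
  have rot5: "(\<Sum>\<mu>\<in>UNIV. \<Sum>a\<in>UNIV. \<Sum>b\<in>UNIV. \<Sum>c\<in>UNIV. \<Sum>d\<in>UNIV. f \<mu> a b c d)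
      = (\<Sum>a\<in>UNIV. \<Sum>b\<in>UNIV. \<Sum>c\<in>UNIV. \<Sum>d\<in>UNIV. \<Sum>\<mu>\<in>UNIV. f \<mu> a b c d)"
    for f :: "'n \<Rightarrow> 'n \<Rightarrow> 'n \<Rightarrow> 'n \<Rightarrow> 'n \<Rightarrow> real"
    by (rule trans[OF sum.swap sum.cong[OF refl rot4]])
  have 4: "(\<Sum>d\<in>UNIV. S4 M A B C d * R4 M A B C d) = (\<Sum>D\<in>UNIV. (N M A B C D)\<^sup>2 / G D y)" for M A B C
    unfolding R4_def S4_def raise_slot[OF y] power2_eq_square ..
  have 3: "(\<Sum>c\<in>UNIV. \<Sum>d\<in>UNIV. S3 M A B c d * R3 M A B c d)
      = (\<Sum>C\<in>UNIV. (\<Sum>d\<in>UNIV. S4 M A B C d * R4 M A B C d) / G C y)" for M A B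
  proof -
    have "(\<Sum>c\<in>UNIV. \<Sum>d\<in>UNIV. S3 M A B c d * R3 M A B c d)
       = (\<Sum>d\<in>UNIV. \<Sum>C\<in>UNIV. S4 M A B C d * R4 M A B C d / G C y)"
      by (subst rot2) (simp only: R3_def S3_def raise_slot[OF y])
    then show ?thesis unfolding sum_divide_distrib by (subst rot2)
  qed
  have 2: "(\<Sum>b\<in>UNIV. \<Sum>c\<in>UNIV. \<Sum>d\<in>UNIV. S2 M A b c d * R2 M A b c d)
      = (\<Sum>B\<in>UNIV. (\<Sum>c\<in>UNIV. \<Sum>d\<in>UNIV. S3 M A B c d * R3 M A B c d) / G B y)" for M A
  proof -
    have "(\<Sum>b\<in>UNIV. \<Sum>c\<in>UNIV. \<Sum>d\<in>UNIV. S2 M A b c d * R2 M A b c d)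
       = (\<Sum>c\<in>UNIV. \<Sum>d\<in>UNIV. \<Sum>B\<in>UNIV. S3 M A B c d * R3 M A B c d / G B y)"
      by (subst rot3) (simp only: R2_def S2_def raise_slot[OF y])
    then show ?thesis unfolding sum_divide_distrib by (subst rot3)
  qed
  have 1: "(\<Sum>a\<in>UNIV. \<Sum>b\<in>UNIV. \<Sum>c\<in>UNIV. \<Sum>d\<in>UNIV. S1 M a b c d * R1 M a b c d)
      = (\<Sum>A\<in>UNIV. (\<Sum>b\<in>UNIV. \<Sum>c\<in>UNIV. \<Sum>d\<in>UNIV. S2 M A b c d * R2 M A b c d) / G A y)" for M
  proof -
    have "(\<Sum>a\<in>UNIV. \<Sum>b\<in>UNIV. \<Sum>c\<in>UNIV. \<Sum>d\<in>UNIV. S1 M a b c d * R1 M a b c d)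
       = (\<Sum>b\<in>UNIV. \<Sum>c\<in>UNIV. \<Sum>d\<in>UNIV. \<Sum>A\<in>UNIV. S2 M A b c d * R2 M A b c d / G A y)"
      by (subst rot4) (simp only: R1_def S1_def raise_slot[OF y])
    then show ?thesis unfolding sum_divide_distrib
      by (subst rot4)
  qed
  have 0: "(\<Sum>\<mu>\<in>UNIV. \<Sum>a\<in>UNIV. \<Sum>b\<in>UNIV. \<Sum>c\<in>UNIV. \<Sum>d\<in>UNIV. S0 \<mu> a b c d * R0 \<mu> a b c d)
      = (\<Sum>M\<in>UNIV. (\<Sum>a\<in>UNIV. \<Sum>b\<in>UNIV. \<Sum>c\<in>UNIV. \<Sum>d\<in>UNIV. S1 M a b c d * R1 M a b c d) / G M y)"
  proof -
    have "(\<Sum>\<mu>\<in>UNIV. \<Sum>a\<in>UNIV. \<Sum>b\<in>UNIV. \<Sum>c\<in>UNIV. \<Sum>d\<in>UNIV. S0 \<mu> a b c d * R0 \<mu> a b c d)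
       = (\<Sum>a\<in>UNIV. \<Sum>b\<in>UNIV. \<Sum>c\<in>UNIV. \<Sum>d\<in>UNIV. \<Sum>M\<in>UNIV. S1 M a b c d * R1 M a b c d / G M y)"
      by (subst rot5) (simp only: R0_def S0_def raise_slot[OF y])
    then show ?thesis unfolding sum_divide_distrib
      by (subst rot5)
  qed
  show ?thesis by (simp only: I 0 1 2 3 4)
qed

end

section \<open>The frame of the accelerating Kerr metric\<close>

definition q4 :: "'a \<Rightarrow> 'a \<Rightarrow> 'a \<Rightarrow> 'a \<Rightarrow> 4 \<Rightarrow> 'a" where
  "q4 w x y z i = (if i = 1 then w else if i = 2 then x else if i = 3 then y else z)"

lemma q4_simps [simp]: "q4 w x y z 1 = w" "q4 w x y z 2 = x" "q4 w x y z 3 = y" "q4 w x y z 4 = z"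
  by (simp_all add: q4_def)

text \<open>The components of $\theta^p \wedge \theta^q$.\<close>

definition bivector :: "4 \<Rightarrow> 4 \<Rightarrow> 4 \<Rightarrow> 4 \<Rightarrow> real" where
  "bivector p q i j = (if i = p \<and> j = q then 1 else if i = q \<and> j = p then -1 else 0)"

lemma bivector_values:
  "bivector 1 2 = q4 (q4 0 1 0 0) (q4 (-1) 0 0 0) (q4 0 0 0 0) (q4 0 0 0 0)"
  "bivector 1 3 = q4 (q4 0 0 1 0) (q4 0 0 0 0) (q4 (-1) 0 0 0) (q4 0 0 0 0)"
  "bivector 1 4 = q4 (q4 0 0 0 1) (q4 0 0 0 0) (q4 0 0 0 0) (q4 (-1) 0 0 0)"
  "bivector 2 3 = q4 (q4 0 0 0 0) (q4 0 0 1 0) (q4 0 (-1) 0 0) (q4 0 0 0 0)"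
  "bivector 2 4 = q4 (q4 0 0 0 0) (q4 0 0 0 1) (q4 0 0 0 0) (q4 0 (-1) 0 0)"
  "bivector 3 4 = q4 (q4 0 0 0 0) (q4 0 0 0 0) (q4 0 0 0 1) (q4 0 0 (-1) 0)"
  by (simp_all add: fun_eq_iff forall_4 bivector_def)

lemma bivector_antisym: "p \<noteq> q \<Longrightarrow> bivector p q j i = - bivector p q i j"
  by (auto simp: bivector_def)

text \<open>An antisymmetric array in dimension four has six independent entries. Used on both index
  pairs of the differentiated Weyl tensor, this leaves 36 components.\<close>

lemma antisym_eqI:
  fixes f h :: "4 \<Rightarrow> 4 \<Rightarrow> real"
  assumes f: "\<And>i j. f j i = - f i j" and h: "\<And>i j. h j i = - h i j"
    and eq: "f 1 2 = h 1 2" "f 1 3 = h 1 3" "f 1 4 = h 1 4" "f 2 3 = h 2 3" "f 2 4 = h 2 4" "f 3 4 = h 3 4"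
  shows "f i j = h i j"
proof -
  have "f i i = h i i" for i using f[of i i] h[of i i] by simp
  then have "\<forall>i j. f i j = h i j"
    unfolding forall_4
    by (simp add: eq f[of 2 1] f[of 3 1] f[of 4 1] f[of 3 2] f[of 4 2] f[of 4 3]
      h[of 2 1] h[of 3 1] h[of 4 1] h[of 3 2] h[of 4 2] h[of 4 3])
  then show ?thesis by blast
qed

text \<open>Each unordered pair is met twice. Applied to both index pairs this contributes a factor
  4 to the invariant.\<close>

lemma sum_pairs:
  fixes h :: "4 \<Rightarrow> 4 \<Rightarrow> real" and G :: "4 \<Rightarrow> real"
  assumes "\<And>i j. h j i = h i j" and "\<And>i. h i i = 0"
  shows "(\<Sum>i\<in>UNIV. (\<Sum>j\<in>UNIV. h i j / G j) / G i)
    = 2 * (h 1 2 / (G 1 * G 2) + h 1 3 / (G 1 * G 3) + h 1 4 / (G 1 * G 4)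
      + h 2 3 / (G 2 * G 3) + h 2 4 / (G 2 * G 4) + h 3 4 / (G 3 * G 4))"
  by (simp add: sum_4 assms(2) assms(1)[of 2 1] assms(1)[of 3 1] assms(1)[of 4 1] assms(1)[of 3 2]
      assms(1)[of 4 2] assms(1)[of 4 3] add_divide_distrib mult.commute)

text \<open>Throughout, \<open>x\<close> stands for $\cos\theta$, and \<open>X\<close> for $P \sin^2\theta$, so that \<open>Q\<close> and \<open>X\<close> enter
  symmetrically.\<close>

locale accelerating_kerr =
  fixes a m \<alpha> :: real
begin

definition Q :: "real \<Rightarrow> real" where
  "Q r = (a\<^sup>2 - 2 * m * r + r\<^sup>2) * (1 - \<alpha>\<^sup>2 * r\<^sup>2)"

definition Q1 :: "real \<Rightarrow> real" where
  "Q1 r = (2 * r - 2 * m) * (1 - \<alpha>\<^sup>2 * r\<^sup>2) - 2 * \<alpha>\<^sup>2 * r * (a\<^sup>2 - 2 * m * r + r\<^sup>2)"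

definition Q2 :: "real \<Rightarrow> real" where
  "Q2 r = 2 * (1 - \<alpha>\<^sup>2 * r\<^sup>2) - 4 * \<alpha>\<^sup>2 * r * (2 * r - 2 * m) - 2 * \<alpha>\<^sup>2 * (a\<^sup>2 - 2 * m * r + r\<^sup>2)"

definition X :: "real \<Rightarrow> real" where
  "X x = (1 - 2 * \<alpha> * m * x + \<alpha>\<^sup>2 * a\<^sup>2 * x\<^sup>2) * (1 - x\<^sup>2)"

definition X1 :: "real \<Rightarrow> real" where
  "X1 x = (2 * \<alpha>\<^sup>2 * a\<^sup>2 * x - 2 * \<alpha> * m) * (1 - x\<^sup>2) - 2 * x * (1 - 2 * \<alpha> * m * x + \<alpha>\<^sup>2 * a\<^sup>2 * x\<^sup>2)"

definition X2 :: "real \<Rightarrow> real" where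
  "X2 x = 2 * \<alpha>\<^sup>2 * a\<^sup>2 * (1 - x\<^sup>2) - 4 * x * (2 * \<alpha>\<^sup>2 * a\<^sup>2 * x - 2 * \<alpha> * m)
    - 2 * (1 - 2 * \<alpha> * m * x + \<alpha>\<^sup>2 * a\<^sup>2 * x\<^sup>2)"

text \<open>The reciprocal of rho^2; \<open>K\<close> is the reciprocal of Omega.\<close>

definition S :: "real \<Rightarrow> real \<Rightarrow> real" where
  "S r x = 1 / (r\<^sup>2 + a\<^sup>2 * x\<^sup>2)"

definition K :: "real \<Rightarrow> real \<Rightarrow> real" where
  "K r x = 1 / (1 - \<alpha> * r * x)"

text \<open>$A - iB = 1/(r + iax)$. The derivatives of \<open>A\<close> and \<open>B\<close> are polynomials in \<open>A\<close> and \<open>B\<close>, and \<open>k1\<close>,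
  \<open>k2\<close> below are the logarithmic derivatives of \<open>K\<close>, so that only the denominators \<open>Q\<close> and \<open>X\<close>
  have to be cleared.\<close>

definition A :: "real \<Rightarrow> real \<Rightarrow> real" where
  "A r x = r * S r x"

definition B :: "real \<Rightarrow> real \<Rightarrow> real" where
  "B r x = a * x * S r x"

definition reg :: "real \<Rightarrow> real \<Rightarrow> bool" where
  "reg r x \<longleftrightarrow> Q r \<noteq> 0 \<and> X x \<noteq> 0 \<and> r\<^sup>2 + a\<^sup>2 * x\<^sup>2 \<noteq> 0 \<and> 1 - \<alpha> * r * x \<noteq> 0"

text \<open>Since dx = - sin \<theta> d\<theta>, the weight rho^2 / P of d\<theta>^2 becomes rho^2 /
  X for dx^2, while P sin^2 \<theta> / rho^2 is X / rho^2. The square of \<open>K\<close> is the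
  conformal factor.\<close>

definition frame_metric :: "4 \<Rightarrow> real \<Rightarrow> real \<Rightarrow> real" where
  "frame_metric i r x = q4 (- (Q r * S r x * (K r x)\<^sup>2)) ((K r x)\<^sup>2 / (Q r * S r x))
     ((K r x)\<^sup>2 / (X x * S r x)) (X x * S r x * (K r x)\<^sup>2) i"

section \<open>Derivatives of the building blocks\<close>

lemma DERIV_Q: "(Q has_real_derivative Q1 r) (at r)"
  unfolding Q_def[abs_def] Q1_def
  by (auto intro!: derivative_eq_intros simp: algebra_simps power2_eq_square power3_eq_cube)

lemma DERIV_Q1: "(Q1 has_real_derivative Q2 r) (at r)"
  unfolding Q1_def[abs_def] Q2_def
  by (auto intro!: derivative_eq_intros simp: algebra_simps power2_eq_square power3_eq_cube)

lemma DERIV_X: "(X has_real_derivative X1 x) (at x)"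
  unfolding X_def[abs_def] X1_def
  by (auto intro!: derivative_eq_intros simp: algebra_simps power2_eq_square power3_eq_cube)

lemma DERIV_X1: "(X1 has_real_derivative X2 x) (at x)"
  unfolding X1_def[abs_def] X2_def
  by (auto intro!: derivative_eq_intros simp: algebra_simps power2_eq_square power3_eq_cube)

lemma DERIV_S:
  assumes "reg r x"
  shows "((\<lambda>r. S r x) has_real_derivative - (2 * A r x * S r x)) (at r)"
    and "((\<lambda>x. S r x) has_real_derivative - (2 * a * B r x * S r x)) (at x)"
  using assms unfolding S_def[abs_def] A_def B_def reg_def
  by (auto intro!: derivative_eq_intros simp: divide_simps power2_eq_square)

lemma DERIV_K:
  assumes "reg r x"
  shows "((\<lambda>r. K r x) has_real_derivative \<alpha> * x * (K r x)\<^sup>2) (at r)"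
    and "((\<lambda>x. K r x) has_real_derivative \<alpha> * r * (K r x)\<^sup>2) (at x)"
  using assms unfolding K_def[abs_def] reg_def
  by (auto intro!: derivative_eq_intros simp: divide_simps power2_eq_square)

text \<open>\<open>S\<close> is the squared modulus of 1/(r + iax).\<close>

lemma A_B_norm:
  assumes "reg r x"
  shows "S r x = (A r x)\<^sup>2 + (B r x)\<^sup>2"
proof -
  have "(A r x)\<^sup>2 + (B r x)\<^sup>2 = S r x * ((r\<^sup>2 + a\<^sup>2 * x\<^sup>2) * S r x)"
    by (simp add: A_def B_def power2_eq_square algebra_simps)
  also have "(r\<^sup>2 + a\<^sup>2 * x\<^sup>2) * S r x = 1" using assms by (simp add: S_def reg_def)
  finally show ?thesis by simp
qed

text \<open>With z = r + iax, the derivatives of 1/z are -1/z^2 in r and -ia/z^2 in x. These are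
  their real parts; the imaginary parts give \<open>DERIV_B\<close>.\<close>

lemma DERIV_A:
  assumes "reg r x"
  shows "((\<lambda>r. A r x) has_real_derivative (B r x)\<^sup>2 - (A r x)\<^sup>2) (at r)"
    and "((\<lambda>x. A r x) has_real_derivative - (2 * a * A r x * B r x)) (at x)"
proof -
  show "((\<lambda>r. A r x) has_real_derivative (B r x)\<^sup>2 - (A r x)\<^sup>2) (at r)"
    unfolding A_def[abs_def]
    by (rule derivative_eq_intros DERIV_S assms refl)+
      (use A_B_norm[OF assms] in \<open>simp add: A_def power2_eq_square mult_ac\<close>)
  show "((\<lambda>x. A r x) has_real_derivative - (2 * a * A r x * B r x)) (at x)"
    unfolding A_def[abs_def]
    by (rule derivative_eq_intros DERIV_S assms refl)+ simp
qed

lemma DERIV_B: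
  assumes "reg r x"
  shows "((\<lambda>r. B r x) has_real_derivative - (2 * A r x * B r x)) (at r)"
    and "((\<lambda>x. B r x) has_real_derivative a * ((A r x)\<^sup>2 - (B r x)\<^sup>2)) (at x)"
proof -
  show "((\<lambda>r. B r x) has_real_derivative - (2 * A r x * B r x)) (at r)"
    unfolding B_def[abs_def]
    by (rule derivative_eq_intros DERIV_S assms refl)+ simp
  have "((\<lambda>x. B r x) has_real_derivative a * S r x - 2 * a * (B r x)\<^sup>2) (at x)"
    unfolding B_def[abs_def]
    by (rule derivative_eq_intros DERIV_S assms refl)+ (simp add: B_def power2_eq_square mult_ac)
  then show "((\<lambda>x. B r x) has_real_derivative a * ((A r x)\<^sup>2 - (B r x)\<^sup>2)) (at x)"
    by (simp add: A_B_norm[OF assms] algebra_simps)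
qed

definition k1 :: "real \<Rightarrow> real \<Rightarrow> real" where
  "k1 r x = \<alpha> * x * K r x"

definition k2 :: "real \<Rightarrow> real \<Rightarrow> real" where
  "k2 r x = \<alpha> * r * K r x"

lemma K_norm:
  assumes "reg r x"
  shows "K r x = 1 + \<alpha> * r * x * K r x"
proof -
  have "(1 - \<alpha> * r * x) * K r x = 1" using assms by (simp add: K_def reg_def)
  then show ?thesis by (simp add: algebra_simps)
qed

text \<open>\<open>k1\<close> and \<open>k2\<close> form the gradient of log \<open>K\<close>, so
  the x-derivative of \<open>k1\<close> and the r-derivative of \<open>k2\<close> are the same mixed
  second derivative.\<close>

lemma DERIV_k1:
  assumes "reg r x"
  shows "((\<lambda>r. k1 r x) has_real_derivative (k1 r x)\<^sup>2) (at r)"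
    and "((\<lambda>x. k1 r x) has_real_derivative \<alpha> * (K r x)\<^sup>2) (at x)"
proof -
  show "((\<lambda>r. k1 r x) has_real_derivative (k1 r x)\<^sup>2) (at r)"
    unfolding k1_def[abs_def]
    by (rule derivative_eq_intros DERIV_K assms refl)+ (simp add: power2_eq_square mult_ac)
  have "((\<lambda>x. k1 r x) has_real_derivative \<alpha> * K r x * (1 + \<alpha> * r * x * K r x)) (at x)"
    unfolding k1_def[abs_def]
    by (rule derivative_eq_intros DERIV_K assms refl)+ (simp add: power2_eq_square algebra_simps)
  then show "((\<lambda>x. k1 r x) has_real_derivative \<alpha> * (K r x)\<^sup>2) (at x)"
    unfolding K_norm[OF assms, symmetric] by (simp add: power2_eq_square mult_ac)
qed

lemma DERIV_k2:
  assumes "reg r x"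
  shows "((\<lambda>r. k2 r x) has_real_derivative \<alpha> * (K r x)\<^sup>2) (at r)"
    and "((\<lambda>x. k2 r x) has_real_derivative (k2 r x)\<^sup>2) (at x)"
proof -
  have "((\<lambda>r. k2 r x) has_real_derivative \<alpha> * K r x * (1 + \<alpha> * r * x * K r x)) (at r)"
    unfolding k2_def[abs_def]
    by (rule derivative_eq_intros DERIV_K assms refl)+ (simp add: power2_eq_square algebra_simps)
  then show "((\<lambda>r. k2 r x) has_real_derivative \<alpha> * (K r x)\<^sup>2) (at r)"
    unfolding K_norm[OF assms, symmetric] by (simp add: power2_eq_square mult_ac)
  show "((\<lambda>x. k2 r x) has_real_derivative (k2 r x)\<^sup>2) (at x)"
    unfolding k2_def[abs_def]
    by (rule derivative_eq_intros DERIV_K assms refl)+ (simp add: power2_eq_square mult_ac)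
qed

text \<open>\<open>conn i j k\<close> is the component along $e_i$ of $\nabla_{e_j} e_k$: four matrices with rows \<open>j\<close> and
  columns \<open>k\<close>, obtained from the Koszul formula.\<close>

definition conn :: "4 \<Rightarrow> 4 \<Rightarrow> 4 \<Rightarrow> real \<Rightarrow> real \<Rightarrow> real" where
  "conn i j k r x = (let Q = Q r; Q' = Q1 r; X = X x; X' = X1 x; S = S r x; A = A r x; B = B r x;
      k1 = k1 r x; k2 = k2 r x; T = Q * X * S\<^sup>2 in
    q4 (q4 (q4 0 (Q' / (2 * Q) - A + k1) (a * B + k2) 0)
           (q4 (Q' / (2 * Q) - A + k1) 0 0 (a * A * X / Q))
           (q4 (k2 - a * B) 0 0 B)
           (q4 0 (a * A * X / Q) (- B) 0))
       (q4 (q4 (S\<^sup>2 * (Q * Q' / 2 + Q\<^sup>2 * (k1 - A))) 0 0 (a * A * T))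
           (q4 0 (A + k1 - Q' / (2 * Q)) (a * B + k2) 0)
           (q4 0 (a * B + k2) (- (Q / X) * (A + k1)) 0)
           (q4 (a * A * T) 0 0 (- T * (A + k1))))
       (q4 (q4 (T * (a * B + k2)) 0 0 (- B * T))
           (q4 0 (- (X / Q) * (a * B + k2)) (A + k1) 0)
           (q4 0 (A + k1) (a * B + k2 - X' / (2 * X)) 0)
           (q4 (- B * T) 0 0 (- S\<^sup>2 * (X * X' / 2 + X\<^sup>2 * (k2 - a * B)))))
       (q4 (q4 0 (- a * A) (B * Q / X) 0)
           (q4 (a * A) 0 0 (k1 - A))
           (q4 (B * Q / X) 0 0 (X' / (2 * X) - a * B + k2))
           (q4 0 (k1 + A) (X' / (2 * X) - a * B + k2) 0))
     i j k)"

text \<open>\<open>q'\<close> is the r-derivative of \<open>Q' / (2 * Q)\<close>, \<open>T'\<close>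
  that of \<open>T\<close>, and \<open>k3\<close> the mixed second derivative of log
  \<open>K\<close>. In \<open>conn_x\<close>, \<open>p'\<close> and \<open>D\<close> are the
  x-derivatives of \<open>X' / (2 * X)\<close> and of \<open>a * B\<close>.\<close>

definition conn_r :: "4 \<Rightarrow> 4 \<Rightarrow> 4 \<Rightarrow> real \<Rightarrow> real \<Rightarrow> real" where
  "conn_r i j k r x = (let Q = Q r; Q' = Q1 r; Q'' = Q2 r; X = X x; X' = X1 x; S = S r x; A = A r x; B = B r x;
      k1 = k1 r x; k2 = k2 r x; k3 = \<alpha> * (K r x)\<^sup>2; T = Q * X * S\<^sup>2;
      T' = X * S\<^sup>2 * (Q' - 4 * A * Q); q' = Q'' / (2 * Q) - Q'\<^sup>2 / (2 * Q\<^sup>2) in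
    q4 (q4 (q4 0 (q' + A\<^sup>2 - B\<^sup>2 + k1\<^sup>2) (k3 - 2 * a * A * B) 0)
           (q4 (q' + A\<^sup>2 - B\<^sup>2 + k1\<^sup>2) 0 0 (a * (X / Q) * (B\<^sup>2 - A\<^sup>2 - A * Q' / Q)))
           (q4 (k3 + 2 * a * A * B) 0 0 (- 2 * A * B))
           (q4 0 (a * (X / Q) * (B\<^sup>2 - A\<^sup>2 - A * Q' / Q)) (2 * A * B) 0))
       (q4 (q4 (S\<^sup>2 * (Q'\<^sup>2 / 2 + Q * Q'' / 2 - 2 * A * Q * Q' + 2 * Q * Q' * (k1 - A)
                - 4 * A * Q\<^sup>2 * (k1 - A) + Q\<^sup>2 * (k1\<^sup>2 - B\<^sup>2 + A\<^sup>2))) 0 0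
              (a * (B\<^sup>2 - A\<^sup>2) * T + a * A * T'))
           (q4 0 (B\<^sup>2 - A\<^sup>2 + k1\<^sup>2 - q') (k3 - 2 * a * A * B) 0)
           (q4 0 (k3 - 2 * a * A * B) (- (Q' / X) * (A + k1) - (Q / X) * (B\<^sup>2 - A\<^sup>2 + k1\<^sup>2)) 0)
           (q4 (a * (B\<^sup>2 - A\<^sup>2) * T + a * A * T') 0 0 (- T' * (A + k1) - T * (B\<^sup>2 - A\<^sup>2 + k1\<^sup>2))))
       (q4 (q4 (T' * (a * B + k2) + T * (k3 - 2 * a * A * B)) 0 0 (2 * A * B * T - B * T'))
           (q4 0 (X * Q' / Q\<^sup>2 * (a * B + k2) - (X / Q) * (k3 - 2 * a * A * B)) (B\<^sup>2 - A\<^sup>2 + k1\<^sup>2) 0)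
           (q4 0 (B\<^sup>2 - A\<^sup>2 + k1\<^sup>2) (k3 - 2 * a * A * B) 0)
           (q4 (2 * A * B * T - B * T') 0 0
              (- S\<^sup>2 * (X\<^sup>2 * (k3 + 2 * a * A * B) - 2 * A * X * X' - 4 * A * X\<^sup>2 * (k2 - a * B)))))
       (q4 (q4 0 (a * (A\<^sup>2 - B\<^sup>2)) (B * Q' / X - 2 * A * B * Q / X) 0)
           (q4 (a * (B\<^sup>2 - A\<^sup>2)) 0 0 (k1\<^sup>2 + A\<^sup>2 - B\<^sup>2))
           (q4 (B * Q' / X - 2 * A * B * Q / X) 0 0 (k3 + 2 * a * A * B))
           (q4 0 (k1\<^sup>2 + B\<^sup>2 - A\<^sup>2) (k3 + 2 * a * A * B) 0))
     i j k)"

definition conn_x :: "4 \<Rightarrow> 4 \<Rightarrow> 4 \<Rightarrow> real \<Rightarrow> real \<Rightarrow> real" where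
  "conn_x i j k r x = (let Q = Q r; Q' = Q1 r; X = X x; X' = X1 x; X'' = X2 x; S = S r x; A = A r x; B = B r x;
      k1 = k1 r x; k2 = k2 r x; k3 = \<alpha> * (K r x)\<^sup>2; T = Q * X * S\<^sup>2;
      T' = Q * S\<^sup>2 * (X' - 4 * a * B * X); p' = X'' / (2 * X) - X'\<^sup>2 / (2 * X\<^sup>2);
      D = a\<^sup>2 * (A\<^sup>2 - B\<^sup>2) in
    q4 (q4 (q4 0 (k3 + 2 * a * A * B) (D + k2\<^sup>2) 0)
           (q4 (k3 + 2 * a * A * B) 0 0 (a * A * (X' - 2 * a * B * X) / Q))
           (q4 (k2\<^sup>2 - D) 0 0 (a * (A\<^sup>2 - B\<^sup>2)))
           (q4 0 (a * A * (X' - 2 * a * B * X) / Q) (a * (B\<^sup>2 - A\<^sup>2)) 0))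
       (q4 (q4 (S\<^sup>2 * (Q\<^sup>2 * (k3 + 2 * a * A * B) - 2 * a * B * Q * Q' - 4 * a * B * Q\<^sup>2 * (k1 - A))) 0 0
              (a * A * T' - 2 * a\<^sup>2 * A * B * T))
           (q4 0 (k3 - 2 * a * A * B) (D + k2\<^sup>2) 0)
           (q4 0 (D + k2\<^sup>2) (Q * X' / X\<^sup>2 * (A + k1) - (Q / X) * (k3 - 2 * a * A * B)) 0)
           (q4 (a * A * T' - 2 * a\<^sup>2 * A * B * T) 0 0 (- T' * (A + k1) - T * (k3 - 2 * a * A * B))))
       (q4 (q4 (T' * (a * B + k2) + T * (D + k2\<^sup>2)) 0 0 (a * (B\<^sup>2 - A\<^sup>2) * T - B * T'))
           (q4 0 (- (X' / Q) * (a * B + k2) - (X / Q) * (D + k2\<^sup>2)) (k3 - 2 * a * A * B) 0)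
           (q4 0 (k3 - 2 * a * A * B) (D + k2\<^sup>2 - p') 0)
           (q4 (a * (B\<^sup>2 - A\<^sup>2) * T - B * T') 0 0
              (- S\<^sup>2 * (X'\<^sup>2 / 2 + X * X'' / 2 - 2 * a * B * X * X' + 2 * X * X' * (k2 - a * B)
                - 4 * a * B * X\<^sup>2 * (k2 - a * B) + X\<^sup>2 * (k2\<^sup>2 - D)))))
       (q4 (q4 0 (2 * a\<^sup>2 * A * B) (a * (A\<^sup>2 - B\<^sup>2) * Q / X - B * Q * X' / X\<^sup>2) 0)
           (q4 (- 2 * a\<^sup>2 * A * B) 0 0 (k3 + 2 * a * A * B))
           (q4 (a * (A\<^sup>2 - B\<^sup>2) * Q / X - B * Q * X' / X\<^sup>2) 0 0 (p' - D + k2\<^sup>2))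
           (q4 0 (k3 - 2 * a * A * B) (p' - D + k2\<^sup>2) 0))
     i j k)"

lemmas DERIV_atoms = DERIV_Q DERIV_Q1 DERIV_X DERIV_X1 DERIV_S DERIV_A DERIV_B DERIV_k1 DERIV_k2 DERIV_K

lemma DERIV_conn_r:
  assumes "reg r x"
  shows "((\<lambda>r. conn i j k r x) has_real_derivative conn_r i j k r x) (at r)"
proof -
  have nz: "Q r \<noteq> 0" "X x \<noteq> 0" using assms by (auto simp: reg_def)
  have "\<forall>i j k. ((\<lambda>r. conn i j k r x) has_real_derivative conn_r i j k r x) (at r)"
    unfolding conn_def conn_r_def Let_def forall_4
    by (simp, intro conjI; (auto intro!: derivative_eq_intros DERIV_atoms assms simp: nz)?;
      simp add: nz field_simps power2_eq_square)
  then show ?thesis by blast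
qed

lemma DERIV_conn_x:
  assumes "reg r x"
  shows "((\<lambda>x. conn i j k r x) has_real_derivative conn_x i j k r x) (at x)"
proof -
  have nz: "Q r \<noteq> 0" "X x \<noteq> 0" using assms by (auto simp: reg_def)
  have "\<forall>i j k. ((\<lambda>x. conn i j k r x) has_real_derivative conn_x i j k r x) (at x)"
    unfolding conn_def conn_x_def Let_def forall_4
    by (simp, intro conjI; (auto intro!: derivative_eq_intros DERIV_atoms assms simp: nz)?;
      simp add: nz field_simps power2_eq_square)
  then show ?thesis by blast
qed

text \<open>The factor after \<open>frame_metric\<close> is half a logarithmic derivative and equals
  \<open>conn i 2 i\<close>, in \<open>metric_x\<close> it equals \<open>conn i 3 i\<close>, as
  metric compatibility on the diagonal demands.\<close>

definition metric_r :: "4 \<Rightarrow> real \<Rightarrow> real \<Rightarrow> real" where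
  "metric_r i r x = 2 * frame_metric i r x * q4 (Q1 r / (2 * Q r) - A r x + k1 r x)
     (A r x + k1 r x - Q1 r / (2 * Q r)) (A r x + k1 r x) (k1 r x - A r x) i"

definition metric_x :: "4 \<Rightarrow> real \<Rightarrow> real \<Rightarrow> real" where
  "metric_x i r x = 2 * frame_metric i r x * q4 (k2 r x - a * B r x)
     (a * B r x + k2 r x) (a * B r x + k2 r x - X1 x / (2 * X x)) (X1 x / (2 * X x) - a * B r x + k2 r x) i"

lemma S_K_nonzero:
  assumes "reg r x"
  shows "S r x \<noteq> 0" "K r x \<noteq> 0"
  using assms by (auto simp: S_def K_def reg_def)

lemma DERIV_metric:
  assumes "reg r x"
  shows "((\<lambda>r. frame_metric i r x) has_real_derivative metric_r i r x) (at r)"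
    and "((\<lambda>x. frame_metric i r x) has_real_derivative metric_x i r x) (at x)"
proof -
  have nz: "Q r \<noteq> 0" "X x \<noteq> 0" "S r x \<noteq> 0" using assms S_K_nonzero by (auto simp: reg_def)
  have "\<forall>i. ((\<lambda>r. frame_metric i r x) has_real_derivative metric_r i r x) (at r)"
    unfolding frame_metric_def metric_r_def forall_4
    by (simp, intro conjI; (auto intro!: derivative_eq_intros DERIV_atoms assms simp: nz)?;
      simp add: nz k1_def field_simps power2_eq_square)
  then show "((\<lambda>r. frame_metric i r x) has_real_derivative metric_r i r x) (at r)" by blast
  have "\<forall>i. ((\<lambda>x. frame_metric i r x) has_real_derivative metric_x i r x) (at x)"
    unfolding frame_metric_def metric_x_def forall_4
    by (simp, intro conjI; (auto intro!: derivative_eq_intros DERIV_atoms assms simp: nz)?;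
      simp add: nz k2_def field_simps power2_eq_square)
  then show "((\<lambda>x. frame_metric i r x) has_real_derivative metric_x i r x) (at x)" by blast
qed

text \<open>The coframe $dt - a\sin^2\theta\, d\phi$, $dr$, $dx$, $a\,dt - (r^2+a^2)\,d\phi$. Normalising it
  would bring in square roots of \<open>Q\<close>, which may be negative.\<close>

definition coframe :: "4 \<Rightarrow> 4 \<Rightarrow> real ^ 4 \<Rightarrow> real" where
  "coframe i j y = q4 (q4 1 0 0 (- (a * (sin (y $ 3))\<^sup>2)) j) (q4 0 1 0 0 j)
     (q4 0 0 (- sin (y $ 3)) 0 j) (q4 a 0 0 (- ((y $ 2)\<^sup>2 + a\<^sup>2)) j) i"

definition frame :: "4 \<Rightarrow> 4 \<Rightarrow> real ^ 4 \<Rightarrow> real" where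
  "frame i j y = (let S = S (y $ 2) (cos (y $ 3)) in
     q4 (q4 (((y $ 2)\<^sup>2 + a\<^sup>2) * S) 0 0 (a * S) j) (q4 0 1 0 0 j)
       (q4 0 0 (- 1 / sin (y $ 3)) 0 j) (q4 (- (a * (sin (y $ 3))\<^sup>2 * S)) 0 0 (- S) j) i)"

definition domain :: "(real ^ 4) set" where
  "domain = {y. reg (y $ 2) (cos (y $ 3)) \<and> sin (y $ 3) \<noteq> 0}"

definition dcoframe :: "4 \<Rightarrow> 4 \<Rightarrow> 4 \<Rightarrow> real ^ 4 \<Rightarrow> real" where
  "dcoframe k i j y = q4 0 (q4 0 0 0 (q4 0 0 0 (- 2 * (y $ 2)) j) i)
     (q4 (q4 0 0 0 (- 2 * a * sin (y $ 3) * cos (y $ 3)) j) 0 (q4 0 0 (- cos (y $ 3)) 0 j) 0 i) 0 k"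

definition ddcoframe :: "4 \<Rightarrow> 4 \<Rightarrow> 4 \<Rightarrow> 4 \<Rightarrow> real ^ 4 \<Rightarrow> real" where
  "ddcoframe l k i j y = q4 0 (q4 0 (q4 0 0 0 (q4 0 0 0 (- 2) j) i) 0 0 k)
     (q4 0 0 (q4 (q4 0 0 0 (- 2 * a * ((cos (y $ 3))\<^sup>2 - (sin (y $ 3))\<^sup>2)) j) 0 (q4 0 0 (sin (y $ 3)) 0 j) 0 i) 0 k) 0 l"

lemma open_domain: "open domain"
proof -
  have "open {y::real^4. reg (y $ 2) (cos (y $ 3)) \<and> sin (y $ 3) \<noteq> 0}"
    unfolding reg_def Q_def X_def
    by (intro open_Collect_conj open_Collect_neq continuous_intros)
  then show ?thesis by (simp add: domain_def)
qed

text \<open>The frame vectors 2 and 3 are the coordinate fields of r and x, while 1 and 4 do not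
  move r or x. A coordinate line changes at most one of r and x, so the two partial derivatives
  suffice and no joint differentiability enters.\<close>

lemma has_pd_chart:
  assumes "((\<lambda>r. F r (cos (y $ 3))) has_real_derivative Fr) (at (y $ 2))"
    and "(F (y $ 2) has_real_derivative Fx) (at (cos (y $ 3)))"
  shows "has_pd i (\<lambda>y. F (y $ 2) (cos (y $ 3))) (\<Sum>M\<in>UNIV. coframe M i y * q4 0 Fr Fx 0 M) y"
proof -
  have "\<forall>i::4. has_pd i (\<lambda>y. F (y $ 2) (cos (y $ 3))) (\<Sum>M\<in>UNIV. coframe M i y * q4 0 Fr Fx 0 M) y"
  proof (simp only: forall_4 sum_4 has_pd_def, simp add: coframe_def axis_def, intro conjI)
    show "((\<lambda>s. F (y $ 2 + s) (cos (y $ 3))) has_real_derivative Fr) (at 0)"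
      using DERIV_shift[of "\<lambda>r. F r (cos (y $ 3))" Fr 0 "y $ 2"] assms(1) by (simp add: add.commute)
    have "((\<lambda>s. cos (y $ 3 + s)) has_real_derivative - sin (y $ 3)) (at 0)"
      by (auto intro!: derivative_eq_intros)
    from DERIV_chain2[where g = "\<lambda>s. cos (y $ 3 + s)" and x = 0, OF _ this] assms(2)
    show "((\<lambda>s. F (y $ 2) (cos (y $ 3 + s))) has_real_derivative - (sin (y $ 3) * Fx)) (at 0)"
      by (simp add: mult.commute)
  qed
  then show ?thesis by blast
qed

abbreviation G :: "4 \<Rightarrow> real ^ 4 \<Rightarrow> real" where
  "G i y \<equiv> frame_metric i (y $ 2) (cos (y $ 3))"

abbreviation DG :: "4 \<Rightarrow> 4 \<Rightarrow> real ^ 4 \<Rightarrow> real" where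
  "DG M i y \<equiv> q4 0 (metric_r i (y $ 2) (cos (y $ 3))) (metric_x i (y $ 2) (cos (y $ 3))) 0 M"

abbreviation \<gamma> :: "4 \<Rightarrow> 4 \<Rightarrow> 4 \<Rightarrow> real ^ 4 \<Rightarrow> real" where
  "\<gamma> i j k y \<equiv> conn i j k (y $ 2) (cos (y $ 3))"

abbreviation D\<gamma> :: "4 \<Rightarrow> 4 \<Rightarrow> 4 \<Rightarrow> 4 \<Rightarrow> real ^ 4 \<Rightarrow> real" where
  "D\<gamma> M i j k y \<equiv> q4 0 (conn_r i j k (y $ 2) (cos (y $ 3))) (conn_x i j k (y $ 2) (cos (y $ 3))) 0 M"

lemma domain_reg: "y \<in> domain \<Longrightarrow> reg (y $ 2) (cos (y $ 3))"
  by (simp add: domain_def)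

lemma S_inverse: "reg r x \<Longrightarrow> (r\<^sup>2 + a\<^sup>2 * x\<^sup>2) * S r x = 1"
  by (simp add: reg_def S_def)

text \<open>The dt, d\<phi> block of the coframe has determinant - rho^2, which is what
  \<open>S\<close> inverts.\<close>

lemma coframe_dual:
  assumes "y \<in> domain"
  shows "(\<Sum>i\<in>UNIV. coframe p i y * frame q i y) = (if p = q then 1 else 0)"
proof -
  define s where "s = S (y $ 2) (cos (y $ 3))"
  have s: "((y $ 2)\<^sup>2 + a\<^sup>2 * (cos (y $ 3))\<^sup>2) * s = 1" "sin (y $ 3) \<noteq> 0"
    using S_inverse[OF domain_reg[OF assms]] assms by (auto simp: s_def domain_def)
  have "\<forall>p q. (\<Sum>i\<in>UNIV. coframe p i y * frame q i y) = (if p = q then 1 else 0)"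
    unfolding forall_4 sum_4 coframe_def frame_def Let_def s_def[symmetric]
    using s by (simp add: sin_squared_eq) (auto simp: algebra_simps power2_eq_square)
  then show ?thesis by blast
qed

lemma coframe_dual':
  assumes "y \<in> domain"
  shows "(\<Sum>p\<in>UNIV. coframe p i y * frame p j y) = (if i = j then 1 else 0)"
proof -
  define s where "s = S (y $ 2) (cos (y $ 3))"
  have s: "((y $ 2)\<^sup>2 + a\<^sup>2 * (cos (y $ 3))\<^sup>2) * s = 1" "sin (y $ 3) \<noteq> 0"
    using S_inverse[OF domain_reg[OF assms]] assms by (auto simp: s_def domain_def)
  have "\<forall>i j. (\<Sum>p\<in>UNIV. coframe p i y * frame p j y) = (if i = j then 1 else 0)"
    unfolding forall_4 sum_4 coframe_def frame_def Let_def s_def[symmetric]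
    using s by (simp add: sin_squared_eq) (auto simp: algebra_simps power2_eq_square)
  then show ?thesis by blast
qed

lemma acc_kerr_frame:
  assumes "y \<in> domain"
  shows "acc_kerr a m \<alpha> y $ i $ j = (\<Sum>p\<in>UNIV. G p y * coframe p i y * coframe p j y)"
proof -
  have nz: "Pfun a m \<alpha> (y $ 3) \<noteq> 0" "sin (y $ 3) \<noteq> 0" "rho2 a (y $ 2) (y $ 3) \<noteq> 0"
    "Omega \<alpha> (y $ 2) (y $ 3) \<noteq> 0"
    using assms by (auto simp: domain_def reg_def X_def Pfun_def rho2_def Omega_def)
  have X: "X (cos (y $ 3)) = Pfun a m \<alpha> (y $ 3) * (sin (y $ 3))\<^sup>2"
    by (simp add: X_def Pfun_def sin_squared_eq)
  have Q: "Q (y $ 2) = Qfun a m \<alpha> (y $ 2)" by (simp add: Q_def Qfun_def)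
  have S: "S (y $ 2) (cos (y $ 3)) = 1 / rho2 a (y $ 2) (y $ 3)" by (simp add: S_def rho2_def)
  have K: "K (y $ 2) (cos (y $ 3)) = 1 / Omega \<alpha> (y $ 2) (y $ 3)" by (simp add: K_def Omega_def)
  have "\<forall>i j. acc_kerr a m \<alpha> y $ i $ j = (\<Sum>p\<in>UNIV. G p y * coframe p i y * coframe p j y)"
    unfolding forall_4 sum_4 acc_kerr_def Let_def frame_metric_def coframe_def X Q S K
    using nz by (simp add: axis_def power2_eq_square field_simps)
  then show ?thesis by blast
qed

lemma coframe_pd: "has_pd k (coframe i j) (dcoframe k i j y) y"
proof -
  have "\<forall>i j k. has_pd k (coframe i j) (dcoframe k i j y) y"
    unfolding forall_4 coframe_def[abs_def] dcoframe_def has_pd_def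
    by (simp add: axis_def; intro conjI; auto intro!: derivative_eq_intros)
  then show ?thesis by blast
qed

lemma dcoframe_pd: "has_pd l (dcoframe k i j) (ddcoframe l k i j y) y"
proof -
  have "\<forall>i j k l. has_pd l (dcoframe k i j) (ddcoframe l k i j y) y"
    unfolding forall_4 ddcoframe_def dcoframe_def[abs_def] has_pd_def
    by (simp add: axis_def; intro conjI; auto intro!: derivative_eq_intros simp: power2_eq_square algebra_simps)
  then show ?thesis by blast
qed

lemma frame_pd:
  assumes "y \<in> domain"
  shows "\<exists>D. has_pd k (frame i j) D y"
proof -
  note S_pd = has_pd_chart[where F = S, OF DERIV_S(1)[OF domain_reg[OF assms]] DERIV_S(2)[OF domain_reg[OF assms]]]
  have sq: "\<exists>D. has_pd k (\<lambda>y. (y $ 2)\<^sup>2 + a\<^sup>2) D y" "\<exists>D. has_pd k (\<lambda>y. a * (sin (y $ 3))\<^sup>2) D y"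
    "\<exists>D. has_pd k (\<lambda>y. 1 / sin (y $ 3)) D y" for k :: 4
    using assms unfolding has_pd_def domain_def by (auto intro!: exI derivative_eq_intros)
  have S: "\<exists>D. has_pd k (\<lambda>y. S (y $ 2) (cos (y $ 3))) D y"
    and const: "\<exists>D. has_pd k (\<lambda>y. z) D y" for k :: 4 and z
    using S_pd has_pd_const by blast+
  have mult: "\<exists>D. has_pd k f D y \<Longrightarrow> \<exists>D. has_pd k h D y \<Longrightarrow> \<exists>D. has_pd k (\<lambda>y. f y * h y) D y"
    for k :: 4 and f h using has_pd_mult by blast
  have minus: "\<exists>D. has_pd k f D y \<Longrightarrow> \<exists>D. has_pd k (\<lambda>y. - f y) D y" for k :: 4 and f
    using mult[OF const[of k "-1"], of f] by simp
  have "\<forall>i j. \<exists>D. has_pd k (frame i j) D y"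
    unfolding forall_4 frame_def[abs_def] Let_def
    by (simp del: mult_minus_left mult_minus_right; intro conjI const S sq minus mult)
  then show ?thesis by blast
qed

text \<open>Here the table \<open>conn\<close> is certified as the Levi-Civita connection: its
  origin does not matter once \<open>torsion\<close> and \<open>metricity\<close> are
  checked.\<close>

lemma orthogonal_frame_acc_kerr:
  "orthogonal_frame (acc_kerr a m \<alpha>) domain coframe frame G DG \<gamma> D\<gamma> dcoframe ddcoframe"
proof
  show "open domain" by (rule open_domain)
next
  fix y :: "real ^ 4" and i :: 4
  assume y: "y \<in> domain"
  define r where "r = y $ 2"
  define x where "x = cos (y $ 3)"
  define s where "s = sin (y $ 3)"
  have reg: "reg r x" using y by (simp add: domain_def r_def x_def)
  have nz: "Q r \<noteq> 0" "X x \<noteq> 0" "S r x \<noteq> 0" "K r x \<noteq> 0" using reg S_K_nonzero by (auto simp: reg_def)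
  show "frame_metric p (y $ 2) (cos (y $ 3)) \<noteq> 0" for p
  proof -
    have "\<forall>p. frame_metric p r x \<noteq> 0"
      unfolding forall_4 frame_metric_def using nz by simp
    then show ?thesis by (simp add: r_def x_def)
  qed
  show "has_pd i (G p) (\<Sum>M\<in>UNIV. coframe M i y * DG M p y) y" for p
    using has_pd_chart[OF DERIV_metric[OF domain_reg[OF y]]] .
  show "has_pd i (\<gamma> p n q) (\<Sum>M\<in>UNIV. coframe M i y * D\<gamma> M p n q y) y" for p q n
    using has_pd_chart[OF DERIV_conn_r[OF domain_reg[OF y]] DERIV_conn_x[OF domain_reg[OF y]]] .
  show "ddcoframe i j p k y = ddcoframe j i p k y" for j p k
  proof -
    have "\<forall>i j. ddcoframe i j p k y = ddcoframe j i p k y"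
      unfolding forall_4 ddcoframe_def by simp
    then show ?thesis by blast
  qed
  show "dcoframe i p j y - dcoframe j p i y
      = (\<Sum>n\<in>UNIV. \<Sum>q\<in>UNIV. (\<gamma> p q n y - \<gamma> p n q y) * (coframe n i y * coframe q j y))" for p j
  proof -
    have s2: "s * s = 1 - x * x" by (simp add: s_def x_def sin_squared_eq flip: power2_eq_square)
    have "(r * r + a * a * (x * x)) * S r x = 1"
      using S_inverse[OF reg] by (simp add: power2_eq_square)
    then have "\<forall>p i j. dcoframe i p j y - dcoframe j p i y
      = (\<Sum>n\<in>UNIV. \<Sum>q\<in>UNIV. (conn p q n r x - conn p n q r x) * (coframe n i y * coframe q j y))"
      unfolding forall_4 sum_4 dcoframe_def conn_def Let_def coframe_def r_def[symmetric] x_def[symmetric] s_def[symmetric]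
      by (simp add: A_def B_def power2_eq_square s2; algebra)
    then show ?thesis by (simp add: r_def x_def)
  qed
  show "G p y * \<gamma> p n q y + G q y * \<gamma> q n p y = (if p = q then DG n p y else 0)" for p q n
  proof -
    have "\<forall>p q n. frame_metric p r x * conn p n q r x + frame_metric q r x * conn q n p r x
      = (if p = q then q4 0 (metric_r p r x) (metric_x p r x) 0 n else 0)"
      unfolding forall_4 frame_metric_def conn_def Let_def metric_r_def metric_x_def
      using nz by (simp; simp add: field_simps power2_eq_square)
    then show ?thesis unfolding r_def x_def by blast
  qed
qed (rule coframe_dual coframe_dual' acc_kerr_frame coframe_pd dcoframe_pd frame_pd; assumption)+

section \<open>Curvature\<close>

text \<open>$(u + iv)\,\Omega^3 = m(1 - i\alpha a)\,(\Omega/(r+iax))^3$ is the only nonzero Weyl scalar, up to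
  sign and conjugation.\<close>

definition u :: "real \<Rightarrow> real \<Rightarrow> real" where
  "u r x = m * ((A r x ^ 3 - 3 * A r x * (B r x)\<^sup>2) + \<alpha> * a * (B r x ^ 3 - 3 * (A r x)\<^sup>2 * B r x))"

definition v :: "real \<Rightarrow> real \<Rightarrow> real" where
  "v r x = m * ((B r x ^ 3 - 3 * (A r x)\<^sup>2 * B r x) - \<alpha> * a * (A r x ^ 3 - 3 * A r x * (B r x)\<^sup>2))"

text \<open>In \<alpha> K^2 one factor \<open>K\<close> is replaced by 1 + \<alpha> r x K, and the 1
  by rho^2 \<open>S\<close>. This makes the mixed derivative of log \<open>K\<close> a polynomial in
  \<open>A\<close>, \<open>B\<close>, \<open>k1\<close> and \<open>k2\<close>.\<close>

lemma k3_eq: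
  assumes "reg r x"
  shows "\<alpha> * (K r x)\<^sup>2 = k1 r x * k2 r x + a * B r x * k1 r x + A r x * k2 r x"
proof -
  have S: "(r\<^sup>2 + a\<^sup>2 * x\<^sup>2) * S r x = 1" by (rule S_inverse[OF assms])
  have "k1 r x * k2 r x + a * B r x * k1 r x + A r x * k2 r x
     = \<alpha> * K r x * (\<alpha> * r * x * K r x + (r\<^sup>2 + a\<^sup>2 * x\<^sup>2) * S r x)"
    by (simp add: k1_def k2_def A_def B_def algebra_simps power2_eq_square)
  also have "\<dots> = \<alpha> * K r x * K r x"
    unfolding S using K_norm[OF assms] by (simp add: add.commute)
  finally show ?thesis by (simp add: power2_eq_square)
qed

text \<open>The explicit form of \<open>Q\<close> and \<open>X\<close> enters the curvature computation only here.\<close>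

lemma vacuum_identities:
  assumes "reg r x"
  shows "- Q2 r / 2 + (2 * A r x - k1 r x) * Q1 r
      + ((B r x)\<^sup>2 - 3 * (A r x)\<^sup>2 + 2 * k1 r x * A r x - (k1 r x)\<^sup>2) * Q r
      + (3 * a\<^sup>2 * (A r x)\<^sup>2 - (a * B r x + k2 r x)\<^sup>2) * X x = 2 * u r x / (S r x * K r x)"
    and "- X2 x / 2 + (2 * a * B r x - k2 r x) * X1 x
      + (a\<^sup>2 * (A r x)\<^sup>2 - 3 * a\<^sup>2 * (B r x)\<^sup>2 + 2 * k2 r x * a * B r x - (k2 r x)\<^sup>2) * X x
      + (3 * (B r x)\<^sup>2 - (A r x + k1 r x)\<^sup>2) * Q r = 2 * u r x / (S r x * K r x)"
    and "- (A r x + k1 r x) * Q1 r / 2 - (a * B r x + k2 r x) * X1 x / 2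
      - ((k1 r x)\<^sup>2 - (A r x)\<^sup>2 + (B r x)\<^sup>2) * Q r
      - ((k2 r x)\<^sup>2 - a\<^sup>2 * (B r x)\<^sup>2 + a\<^sup>2 * (A r x)\<^sup>2) * X x = - u r x / (S r x * K r x)"
    and "a * A r x * X1 x - B r x * Q1 r - 4 * a\<^sup>2 * A r x * B r x * X x + 4 * A r x * B r x * Q r
      = 2 * v r x / (S r x * K r x)"
proof -
  define R where "R = r\<^sup>2 + a\<^sup>2 * x\<^sup>2"
  define W where "W = 1 - \<alpha> * r * x"
  have nz: "R \<noteq> 0" "W \<noteq> 0" using assms by (auto simp: reg_def R_def W_def)
  have S: "S r x = 1 / R" and K: "K r x = 1 / W" by (simp_all add: S_def K_def R_def W_def)
  \<comment> \<open>Every term has a denominator dividing R^2 W^2, up to the factor 2, so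
    multiplying by \<open>2 * c\<close> leaves polynomial identities.\<close>
  define c :: real where "c = R\<^sup>2 * W\<^sup>2"
  have c: "c \<noteq> 0" using nz by (simp add: c_def)
  note atoms = u_def v_def A_def B_def k1_def k2_def S K
  note scale = c_def power2_eq_square power3_eq_cube field_simps
  have "- Q2 r * R\<^sup>2 * W\<^sup>2 + 2 * (2 * r * W - \<alpha> * x * R) * Q1 r * R * W
    + 2 * ((a * x * W)\<^sup>2 - 3 * r\<^sup>2 * W\<^sup>2 + 2 * \<alpha> * x * r * R * W - (\<alpha> * x * R)\<^sup>2) * Q r
    + 2 * (3 * a\<^sup>2 * r\<^sup>2 * W\<^sup>2 - (a\<^sup>2 * x * W + \<alpha> * r * R)\<^sup>2) * X x
    = 4 * m * ((r ^ 3 - 3 * r * (a * x)\<^sup>2) + \<alpha> * a * ((a * x) ^ 3 - 3 * r\<^sup>2 * (a * x))) * W ^ 3" (is "?l = ?r")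
    unfolding R_def W_def Q_def Q1_def Q2_def X_def by algebra
  moreover have "(- Q2 r / 2 + (2 * A r x - k1 r x) * Q1 r
      + ((B r x)\<^sup>2 - 3 * (A r x)\<^sup>2 + 2 * k1 r x * A r x - (k1 r x)\<^sup>2) * Q r
      + (3 * a\<^sup>2 * (A r x)\<^sup>2 - (a * B r x + k2 r x)\<^sup>2) * X x) = ?l / (2 * c)"
    unfolding atoms using nz by (simp add: scale)
  moreover have "2 * u r x / (S r x * K r x) = ?r / (2 * c)"
    unfolding atoms using nz by (simp add: scale)
  ultimately show "- Q2 r / 2 + (2 * A r x - k1 r x) * Q1 r
      + ((B r x)\<^sup>2 - 3 * (A r x)\<^sup>2 + 2 * k1 r x * A r x - (k1 r x)\<^sup>2) * Q r
      + (3 * a\<^sup>2 * (A r x)\<^sup>2 - (a * B r x + k2 r x)\<^sup>2) * X x = 2 * u r x / (S r x * K r x)"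
    by simp
  have "- X2 x * R\<^sup>2 * W\<^sup>2 + 2 * (2 * a\<^sup>2 * x * W - \<alpha> * r * R) * X1 x * R * W
    + 2 * (a\<^sup>2 * r\<^sup>2 * W\<^sup>2 - 3 * (a\<^sup>2 * x * W)\<^sup>2 + 2 * \<alpha> * r * a\<^sup>2 * x * R * W - (\<alpha> * r * R)\<^sup>2) * X x
    + 2 * (3 * (a * x * W)\<^sup>2 - (r * W + \<alpha> * x * R)\<^sup>2) * Q r
    = 4 * m * ((r ^ 3 - 3 * r * (a * x)\<^sup>2) + \<alpha> * a * ((a * x) ^ 3 - 3 * r\<^sup>2 * (a * x))) * W ^ 3" (is "?l = ?r")
    unfolding R_def W_def X_def X1_def X2_def Q_def by algebra
  moreover have "- X2 x / 2 + (2 * a * B r x - k2 r x) * X1 x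
      + (a\<^sup>2 * (A r x)\<^sup>2 - 3 * a\<^sup>2 * (B r x)\<^sup>2 + 2 * k2 r x * a * B r x - (k2 r x)\<^sup>2) * X x
      + (3 * (B r x)\<^sup>2 - (A r x + k1 r x)\<^sup>2) * Q r = ?l / (2 * c)"
    unfolding atoms using nz by (simp add: scale)
  moreover have "2 * u r x / (S r x * K r x) = ?r / (2 * c)"
    unfolding atoms using nz by (simp add: scale)
  ultimately show "- X2 x / 2 + (2 * a * B r x - k2 r x) * X1 x
      + (a\<^sup>2 * (A r x)\<^sup>2 - 3 * a\<^sup>2 * (B r x)\<^sup>2 + 2 * k2 r x * a * B r x - (k2 r x)\<^sup>2) * X x
      + (3 * (B r x)\<^sup>2 - (A r x + k1 r x)\<^sup>2) * Q r = 2 * u r x / (S r x * K r x)"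
    by simp
  have "- (r * W + \<alpha> * x * R) * Q1 r * R * W - (a\<^sup>2 * x * W + \<alpha> * r * R) * X1 x * R * W
    - 2 * ((\<alpha> * x * R)\<^sup>2 - (r * W)\<^sup>2 + (a * x * W)\<^sup>2) * Q r
    - 2 * ((\<alpha> * r * R)\<^sup>2 - (a\<^sup>2 * x * W)\<^sup>2 + a\<^sup>2 * r\<^sup>2 * W\<^sup>2) * X x
    = - 2 * m * ((r ^ 3 - 3 * r * (a * x)\<^sup>2) + \<alpha> * a * ((a * x) ^ 3 - 3 * r\<^sup>2 * (a * x))) * W ^ 3" (is "?l = ?r")
    unfolding R_def W_def X_def X1_def Q1_def Q_def by algebra
  moreover have "- (A r x + k1 r x) * Q1 r / 2 - (a * B r x + k2 r x) * X1 x / 2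
      - ((k1 r x)\<^sup>2 - (A r x)\<^sup>2 + (B r x)\<^sup>2) * Q r
      - ((k2 r x)\<^sup>2 - a\<^sup>2 * (B r x)\<^sup>2 + a\<^sup>2 * (A r x)\<^sup>2) * X x = ?l / (2 * c)"
    unfolding atoms using nz by (simp add: scale)
  moreover have "- u r x / (S r x * K r x) = ?r / (2 * c)"
    unfolding atoms using nz by (simp add: scale)
  ultimately show "- (A r x + k1 r x) * Q1 r / 2 - (a * B r x + k2 r x) * X1 x / 2
      - ((k1 r x)\<^sup>2 - (A r x)\<^sup>2 + (B r x)\<^sup>2) * Q r
      - ((k2 r x)\<^sup>2 - a\<^sup>2 * (B r x)\<^sup>2 + a\<^sup>2 * (A r x)\<^sup>2) * X x = - u r x / (S r x * K r x)"
    by simp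
  \<comment> \<open>The left-hand side of the fourth identity is free of \<open>k1\<close> and
    \<open>k2\<close>, so R^2 alone clears the denominators.\<close>
  have "(a * r * X1 x - a * x * Q1 r) * R - 4 * a ^ 3 * r * x * X x + 4 * a * r * x * Q r
    = 2 * m * (((a * x) ^ 3 - 3 * r\<^sup>2 * (a * x)) - \<alpha> * a * (r ^ 3 - 3 * r * (a * x)\<^sup>2)) * W" (is "?l = ?r")
    unfolding R_def W_def X_def X1_def Q1_def Q_def by algebra
  moreover have "a * A r x * X1 x - B r x * Q1 r - 4 * a\<^sup>2 * A r x * B r x * X x + 4 * A r x * B r x * Q r
      = ?l / R\<^sup>2"
    unfolding atoms using nz by (simp add: scale)
  moreover have "2 * v r x / (S r x * K r x) = ?r / R\<^sup>2"
    unfolding atoms using nz by (simp add: scale)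
  ultimately show "a * A r x * X1 x - B r x * Q1 r - 4 * a\<^sup>2 * A r x * B r x * X x + 4 * A r x * B r x * Q r
      = 2 * v r x / (S r x * K r x)"
    by simp
qed

text \<open>After these substitutions every curvature component becomes an identity of rational
  functions in free variables.\<close>

lemma atoms_eliminated:
  assumes "reg r x"
  defines "U \<equiv> (A r x + k1 r x) * Q1 r / 2 + (a * B r x + k2 r x) * X1 x / 2
      + ((k1 r x)\<^sup>2 - (A r x)\<^sup>2 + (B r x)\<^sup>2) * Q r
      + ((k2 r x)\<^sup>2 - a\<^sup>2 * (B r x)\<^sup>2 + a\<^sup>2 * (A r x)\<^sup>2) * X x"
  shows "u r x = S r x * K r x * U"
    and "v r x = S r x * K r x * (a * A r x * X1 x - B r x * Q1 r
      - 4 * a\<^sup>2 * A r x * B r x * X x + 4 * A r x * B r x * Q r) / 2"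
    and "Q2 r = 2 * ((2 * A r x - k1 r x) * Q1 r
      + ((B r x)\<^sup>2 - 3 * (A r x)\<^sup>2 + 2 * k1 r x * A r x - (k1 r x)\<^sup>2) * Q r
      + (3 * a\<^sup>2 * (A r x)\<^sup>2 - (a * B r x + k2 r x)\<^sup>2) * X x - 2 * U)"
    and "X2 x = 2 * ((2 * a * B r x - k2 r x) * X1 x
      + (a\<^sup>2 * (A r x)\<^sup>2 - 3 * a\<^sup>2 * (B r x)\<^sup>2 + 2 * k2 r x * a * B r x - (k2 r x)\<^sup>2) * X x
      + (3 * (B r x)\<^sup>2 - (A r x + k1 r x)\<^sup>2) * Q r - 2 * U)"
proof -
  have nz: "S r x \<noteq> 0" "K r x \<noteq> 0" using S_K_nonzero[OF assms(1)] by auto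
  have U: "U = u r x / (S r x * K r x)"
    using vacuum_identities(3)[OF assms(1)] unfolding U_def by (simp only: minus_divide_left[symmetric], linarith?)
  then show "u r x = S r x * K r x * U" using nz by simp
  have solve: "- q / 2 + b + c + d = 2 * w \<Longrightarrow> q = 2 * (b + c + d - 2 * w)" for q b c d w :: real
    by simp
  have U2: "2 * u r x / (S r x * K r x) = 2 * U" by (simp add: U)
  show "v r x = S r x * K r x * (a * A r x * X1 x - B r x * Q1 r
      - 4 * a\<^sup>2 * A r x * B r x * X x + 4 * A r x * B r x * Q r) / 2"
    unfolding vacuum_identities(4)[OF assms(1)] using nz by simp
  show "Q2 r = 2 * ((2 * A r x - k1 r x) * Q1 r
      + ((B r x)\<^sup>2 - 3 * (A r x)\<^sup>2 + 2 * k1 r x * A r x - (k1 r x)\<^sup>2) * Q r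
      + (3 * a\<^sup>2 * (A r x)\<^sup>2 - (a * B r x + k2 r x)\<^sup>2) * X x - 2 * U)"
    by (rule solve[OF vacuum_identities(1)[OF assms(1), unfolded U2]])
  show "X2 x = 2 * ((2 * a * B r x - k2 r x) * X1 x
      + (a\<^sup>2 * (A r x)\<^sup>2 - 3 * a\<^sup>2 * (B r x)\<^sup>2 + 2 * k2 r x * a * B r x - (k2 r x)\<^sup>2) * X x
      + (3 * (B r x)\<^sup>2 - (A r x + k1 r x)\<^sup>2) * Q r - 2 * U)"
    by (rule solve[OF vacuum_identities(2)[OF assms(1), unfolded U2]])
qed

text \<open>The type D form of the Weyl tensor.\<close>

definition weyl_comp :: "4 \<Rightarrow> 4 \<Rightarrow> 4 \<Rightarrow> 4 \<Rightarrow> real \<Rightarrow> real \<Rightarrow> real" where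
  "weyl_comp i j k l r x = K r x *
    (u r x * (2 * (bivector 3 4 i j * bivector 3 4 k l - bivector 1 2 i j * bivector 1 2 k l)
       + Q r / X x * (bivector 1 3 i j * bivector 1 3 k l)
       - X x / Q r * (bivector 2 4 i j * bivector 2 4 k l)
       + Q r * X x * (S r x)\<^sup>2 * (bivector 1 4 i j * bivector 1 4 k l)
       - 1 / (Q r * X x * (S r x)\<^sup>2) * (bivector 2 3 i j * bivector 2 3 k l))
     + v r x * (bivector 1 4 i j * bivector 2 3 k l + bivector 2 3 i j * bivector 1 4 k l
       - bivector 1 3 i j * bivector 2 4 k l - bivector 2 4 i j * bivector 1 3 k l
       - 2 * (bivector 1 2 i j * bivector 3 4 k l + bivector 3 4 i j * bivector 1 2 k l)))"

definition conn_d :: "4 \<Rightarrow> 4 \<Rightarrow> 4 \<Rightarrow> 4 \<Rightarrow> real \<Rightarrow> real \<Rightarrow> real" where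
  "conn_d n i j k r x = q4 0 (conn_r i j k r x) (conn_x i j k r x) 0 n"

text \<open>This is \<open>frame_riemann\<close> for the table \<open>conn\<close>, as a function of
  r and x.\<close>

definition curv :: "4 \<Rightarrow> 4 \<Rightarrow> 4 \<Rightarrow> 4 \<Rightarrow> real \<Rightarrow> real \<Rightarrow> real" where
  "curv i j k l r x = conn_d k i l j r x - conn_d l i k j r x
    + (\<Sum>n\<in>UNIV. conn i k n r x * conn n l j r x - conn i l n r x * conn n k j r x
        - (conn n k l r x - conn n l k r x) * conn i n j r x)"

lemma curv_antisym: "curv i j l k r x = - curv i j k l r x"
  by (simp add: curv_def sum_subtractf sum_negf left_diff_distrib)

lemma weyl_comp_antisym:
  "weyl_comp j i k l r x = - weyl_comp i j k l r x" "weyl_comp i j l k r x = - weyl_comp i j k l r x"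
  unfolding weyl_comp_def
  by (simp_all add: bivector_antisym[of _ _ j i] bivector_antisym[of _ _ l k]) (simp_all add: algebra_simps)

text \<open>A relation that persists among the substituted variables: both sides are \<alpha> a r x
  S K.\<close>

lemma B_k2: "B r x * k2 r x = a * (A r x * k1 r x)"
  by (simp add: A_def B_def k1_def k2_def)

lemmas component_defs = frame_metric_def curv_def weyl_comp_def bivector_def conn_d_def conn_def
  conn_r_def conn_x_def Let_def

lemma nonzero_atoms:
  assumes "reg r x"
  shows "Q r \<noteq> 0" "X x \<noteq> 0" "S r x \<noteq> 0" "K r x \<noteq> 0"
  using assms S_K_nonzero[OF assms] by (auto simp: reg_def)

text \<open>Antisymmetry in the last index pair leaves six cases, one lemma each. All sixteen
  choices of the first pair are computed, so antisymmetry there is part of the outcome.\<close>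

lemma curv_12:
  assumes "reg r x"
  shows "\<forall>i j. frame_metric i r x * curv i j 1 2 r x = weyl_comp i j 1 2 r x"
proof -
  note table = k3_eq[OF assms] atoms_eliminated[OF assms] nonzero_atoms[OF assms]
  show ?thesis
    unfolding component_defs forall_4 sum_4
    by (simp add: table, (simp add: table field_simps power2_eq_square)?, (simp add: B_k2)?)
qed

lemma curv_13:
  assumes "reg r x"
  shows "\<forall>i j. frame_metric i r x * curv i j 1 3 r x = weyl_comp i j 1 3 r x"
proof -
  note table = k3_eq[OF assms] atoms_eliminated[OF assms] nonzero_atoms[OF assms]
  show ?thesis
    unfolding component_defs forall_4 sum_4
    by (simp add: table, (simp add: table field_simps power2_eq_square)?, (simp add: B_k2)?)
qed

lemma curv_14:
  assumes "reg r x"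
  shows "\<forall>i j. frame_metric i r x * curv i j 1 4 r x = weyl_comp i j 1 4 r x"
proof -
  note table = k3_eq[OF assms] atoms_eliminated[OF assms] nonzero_atoms[OF assms]
  show ?thesis
    unfolding component_defs forall_4 sum_4
    by (simp add: table, (simp add: table field_simps power2_eq_square)?, (simp add: B_k2)?)
qed

lemma curv_23:
  assumes "reg r x"
  shows "\<forall>i j. frame_metric i r x * curv i j 2 3 r x = weyl_comp i j 2 3 r x"
proof -
  note table = k3_eq[OF assms] atoms_eliminated[OF assms] nonzero_atoms[OF assms]
  show ?thesis
    unfolding component_defs forall_4 sum_4
    by (simp add: table, (simp add: table field_simps power2_eq_square)?, (simp add: B_k2)?)
qed

lemma curv_24:
  assumes "reg r x"
  shows "\<forall>i j. frame_metric i r x * curv i j 2 4 r x = weyl_comp i j 2 4 r x"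
proof -
  note table = k3_eq[OF assms] atoms_eliminated[OF assms] nonzero_atoms[OF assms]
  show ?thesis
    unfolding component_defs forall_4 sum_4
    by (simp add: table, (simp add: table field_simps power2_eq_square)?, (simp add: B_k2)?)
qed

lemma curv_34:
  assumes "reg r x"
  shows "\<forall>i j. frame_metric i r x * curv i j 3 4 r x = weyl_comp i j 3 4 r x"
proof -
  note table = k3_eq[OF assms] atoms_eliminated[OF assms] nonzero_atoms[OF assms]
  show ?thesis
    unfolding component_defs forall_4 sum_4
    by (simp add: table, (simp add: table field_simps power2_eq_square)?, (simp add: B_k2)?)
qed

lemma curv_eq_weyl_comp:
  assumes "reg r x"
  shows "frame_metric i r x * curv i j k l r x = weyl_comp i j k l r x"
proof (rule antisym_eqI[of "\<lambda>k l. frame_metric i r x * curv i j k l r x" "\<lambda>k l. weyl_comp i j k l r x"])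
  show "frame_metric i r x * curv i j l k r x = - (frame_metric i r x * curv i j k l r x)" for k l
    by (simp add: curv_antisym[of i j l k])
  show "weyl_comp i j l k r x = - weyl_comp i j k l r x" for k l
    by (rule weyl_comp_antisym)
qed (simp_all only: curv_12[OF assms] curv_13[OF assms] curv_14[OF assms] curv_23[OF assms]
  curv_24[OF assms] curv_34[OF assms])

section \<open>The covariant derivative of the Weyl tensor\<close>

text \<open>\<open>ur\<close>, \<open>vr\<close>, \<open>ux\<close>, \<open>vx\<close> are $\Omega^{-3}$ times the derivatives of $\Omega^3 u$ and $\Omega^3 v$.\<close>

definition ur :: "real \<Rightarrow> real \<Rightarrow> real" where
  "ur r x = - 3 * ((A r x + k1 r x) * u r x + B r x * v r x)"

definition vr :: "real \<Rightarrow> real \<Rightarrow> real" where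
  "vr r x = 3 * (B r x * u r x - (A r x + k1 r x) * v r x)"

definition ux :: "real \<Rightarrow> real \<Rightarrow> real" where
  "ux r x = 3 * (a * A r x * v r x - (a * B r x + k2 r x) * u r x)"

definition vx :: "real \<Rightarrow> real \<Rightarrow> real" where
  "vx r x = - 3 * (a * A r x * u r x + (a * B r x + k2 r x) * v r x)"

text \<open>u + iv is a constant times (A - iB)^3, so its derivatives are -3 (A - iB)(u + iv) in r
  and -3 ia (A - iB)(u + iv) in x. The terms with \<open>3 * k1\<close> and \<open>3 * k2\<close>
  compensate for the factor Omega^3 absorbed in \<open>ur\<close>, \<open>ux\<close>,
  \<open>vr\<close>, \<open>vx\<close>.\<close>

lemma DERIV_u_v:
  assumes "reg r x"
  shows "((\<lambda>r. u r x) has_real_derivative ur r x + 3 * k1 r x * u r x) (at r)"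
    and "((\<lambda>x. u r x) has_real_derivative ux r x + 3 * k2 r x * u r x) (at x)"
    and "((\<lambda>r. v r x) has_real_derivative vr r x + 3 * k1 r x * v r x) (at r)"
    and "((\<lambda>x. v r x) has_real_derivative vx r x + 3 * k2 r x * v r x) (at x)"
  unfolding u_def[abs_def] v_def[abs_def]
  by ((rule derivative_eq_intros DERIV_A DERIV_B assms refl)+;
    simp add: ur_def vr_def ux_def vx_def u_def v_def; algebra)+

text \<open>\<open>q\<close> and \<open>t\<close> are the logarithmic derivatives of Q / X and of
  \<open>T\<close>. Of the 4 in \<open>4 * k1\<close>, three come from Omega^3 in \<open>ur\<close>
  and \<open>vr\<close>, one from the overall factor \<open>K\<close>.\<close>

definition weyl_r :: "4 \<Rightarrow> 4 \<Rightarrow> 4 \<Rightarrow> 4 \<Rightarrow> real \<Rightarrow> real \<Rightarrow> real" where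
  "weyl_r i j k l r x = K r x * (let q = Q1 r / Q r; t = q - 4 * A r x;
      T = Q r * X x * (S r x)\<^sup>2; u = u r x; u' = ur r x + 4 * k1 r x * u; v' = vr r x + 4 * k1 r x * v r x in
    2 * u' * (bivector 3 4 i j * bivector 3 4 k l - bivector 1 2 i j * bivector 1 2 k l)
       + Q r / X x * (u' + q * u) * (bivector 1 3 i j * bivector 1 3 k l)
       - X x / Q r * (u' - q * u) * (bivector 2 4 i j * bivector 2 4 k l)
       + T * (u' + t * u) * (bivector 1 4 i j * bivector 1 4 k l)
       - 1 / T * (u' - t * u) * (bivector 2 3 i j * bivector 2 3 k l)
     + v' * (bivector 1 4 i j * bivector 2 3 k l + bivector 2 3 i j * bivector 1 4 k l
       - bivector 1 3 i j * bivector 2 4 k l - bivector 2 4 i j * bivector 1 3 k l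
       - 2 * (bivector 1 2 i j * bivector 3 4 k l + bivector 3 4 i j * bivector 1 2 k l)))"

definition weyl_x :: "4 \<Rightarrow> 4 \<Rightarrow> 4 \<Rightarrow> 4 \<Rightarrow> real \<Rightarrow> real \<Rightarrow> real" where
  "weyl_x i j k l r x = K r x * (let p = X1 x / X x; t = p - 4 * a * B r x;
      T = Q r * X x * (S r x)\<^sup>2; u = u r x; u' = ux r x + 4 * k2 r x * u; v' = vx r x + 4 * k2 r x * v r x in
    2 * u' * (bivector 3 4 i j * bivector 3 4 k l - bivector 1 2 i j * bivector 1 2 k l)
       + Q r / X x * (u' - p * u) * (bivector 1 3 i j * bivector 1 3 k l)
       - X x / Q r * (u' + p * u) * (bivector 2 4 i j * bivector 2 4 k l)
       + T * (u' + t * u) * (bivector 1 4 i j * bivector 1 4 k l)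
       - 1 / T * (u' - t * u) * (bivector 2 3 i j * bivector 2 3 k l)
     + v' * (bivector 1 4 i j * bivector 2 3 k l + bivector 2 3 i j * bivector 1 4 k l
       - bivector 1 3 i j * bivector 2 4 k l - bivector 2 4 i j * bivector 1 3 k l
       - 2 * (bivector 1 2 i j * bivector 3 4 k l + bivector 3 4 i j * bivector 1 2 k l)))"

lemma DERIV_weyl:
  assumes "reg r x"
  shows "((\<lambda>r. weyl_comp i j k l r x) has_real_derivative weyl_r i j k l r x) (at r)"
    and "((\<lambda>x. weyl_comp i j k l r x) has_real_derivative weyl_x i j k l r x) (at x)"
proof -
  note nz = nonzero_atoms[OF assms]
  \<comment> \<open>The bivector factors do not depend on r and x, so one rule with constants
    \<open>c1\<close> to \<open>c6\<close> serves all components. The functions \<open>q\<close> and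
    \<open>q'\<close> have opposite logarithmic derivatives, and so do \<open>t\<close> and
    \<open>t'\<close>.\<close>
  have D: "((\<lambda>s. K1 s * (U s * (c1 + q s * c2 - q' s * c3 + t s * c4 - t' s * c5) + V s * c6))
      has_real_derivative K1 z * ((dU + k * U z) * c1 + q z * (dU + k * U z + dq * U z) * c2
        - q' z * (dU + k * U z - dq * U z) * c3 + t z * (dU + k * U z + dt * U z) * c4
        - t' z * (dU + k * U z - dt * U z) * c5 + (dV + k * V z) * c6)) (at z)"
    if "(K1 has_real_derivative k * K1 z) (at z)" "(U has_real_derivative dU) (at z)"
      "(V has_real_derivative dV) (at z)" "(q has_real_derivative q z * dq) (at z)"
      "(q' has_real_derivative - (q' z * dq)) (at z)" "(t has_real_derivative t z * dt) (at z)"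
      "(t' has_real_derivative - (t' z * dt)) (at z)"
    for K1 U V q q' t t' :: "real \<Rightarrow> real" and k dU dV dq dt c1 c2 c3 c4 c5 c6 z
    by (rule derivative_eq_intros that refl)+ (simp add: algebra_simps)
  have Kr: "((\<lambda>r. K r x) has_real_derivative k1 r x * K r x) (at r)"
    and Kx: "((\<lambda>x. K r x) has_real_derivative k2 r x * K r x) (at x)"
    using DERIV_K[OF assms] by (simp_all add: k1_def k2_def power2_eq_square mult_ac)
  have r: "((\<lambda>r. Q r / X x) has_real_derivative Q r / X x * (Q1 r / Q r)) (at r)"
    "((\<lambda>r. X x / Q r) has_real_derivative - (X x / Q r * (Q1 r / Q r))) (at r)"
    "((\<lambda>r. Q r * X x * (S r x)\<^sup>2) has_real_derivative Q r * X x * (S r x)\<^sup>2 * (Q1 r / Q r - 4 * A r x)) (at r)"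
    "((\<lambda>r. 1 / (Q r * X x * (S r x)\<^sup>2)) has_real_derivative
      - (1 / (Q r * X x * (S r x)\<^sup>2) * (Q1 r / Q r - 4 * A r x))) (at r)"
    using nz by (auto intro!: derivative_eq_intros DERIV_atoms assms simp: field_simps power2_eq_square)
  have x: "((\<lambda>x. Q r / X x) has_real_derivative Q r / X x * (- (X1 x / X x))) (at x)"
    "((\<lambda>x. X x / Q r) has_real_derivative - (X x / Q r * (- (X1 x / X x)))) (at x)"
    "((\<lambda>x. Q r * X x * (S r x)\<^sup>2) has_real_derivative Q r * X x * (S r x)\<^sup>2 * (X1 x / X x - 4 * a * B r x)) (at x)"
    "((\<lambda>x. 1 / (Q r * X x * (S r x)\<^sup>2)) has_real_derivative
      - (1 / (Q r * X x * (S r x)\<^sup>2) * (X1 x / X x - 4 * a * B r x))) (at x)"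
    using nz by (auto intro!: derivative_eq_intros DERIV_atoms assms simp: field_simps power2_eq_square)
  note D_r = D[OF Kr DERIV_u_v(1)[OF assms] DERIV_u_v(3)[OF assms] r]
  show "((\<lambda>r. weyl_comp i j k l r x) has_real_derivative weyl_r i j k l r x) (at r)"
    unfolding weyl_comp_def[abs_def] weyl_r_def Let_def
    by (rule DERIV_cong[OF D_r]) (simp add: algebra_simps)
  note D_x = D[OF Kx DERIV_u_v(2)[OF assms] DERIV_u_v(4)[OF assms] x]
  show "((\<lambda>x. weyl_comp i j k l r x) has_real_derivative weyl_x i j k l r x) (at x)"
    unfolding weyl_comp_def[abs_def] weyl_x_def Let_def
    by (rule DERIV_cong[OF D_x]) (simp add: algebra_simps)
qed

text \<open>By the Bianchi identity only the gradient of $(u + iv)\,\Omega^3$ enters.\<close>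

definition nabla :: "4 \<Rightarrow> 4 \<Rightarrow> 4 \<Rightarrow> 4 \<Rightarrow> 4 \<Rightarrow> real \<Rightarrow> real \<Rightarrow> real" where
  "nabla n i j k l r x = K r x * (let T = Q r * X x * (S r x)\<^sup>2; c = Q r / X x; d = X x / Q r;
      P = \<lambda>p q p' q'. bivector p q i j * bivector p' q' k l + bivector p' q' i j * bivector p q k l;
      D = \<lambda>p q. bivector p q i j * bivector p q k l in
    q4 (ux r x * (P 1 2 2 3 + T * P 1 4 3 4) + vx r x * (P 2 3 3 4 - T * P 1 2 1 4))
      (ur r x * (2 * D 3 4 - 2 * D 1 2 + c * D 1 3 - d * D 2 4 + T * D 1 4 - 1 / T * D 2 3)
        + vr r x * (P 1 4 2 3 - P 1 3 2 4 - 2 * P 1 2 3 4)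
        - ux r x * (P 1 2 1 3 + d * P 2 4 3 4) + vx r x * (d * P 1 2 2 4 - P 1 3 3 4))
      (ux r x * (2 * D 3 4 - 2 * D 1 2 + c * D 1 3 - d * D 2 4 + T * D 1 4 - 1 / T * D 2 3)
        + vx r x * (P 1 4 2 3 - P 1 3 2 4 - 2 * P 1 2 3 4)
        + ur r x * (c * P 1 2 1 3 + P 2 4 3 4) + vr r x * (c * P 1 3 3 4 - P 1 2 2 4))
      (ur r x * (T * P 1 2 1 4 - P 2 3 3 4) + vr r x * (P 1 2 2 3 + T * P 1 4 3 4)) n)"

definition cov_weyl :: "4 \<Rightarrow> 4 \<Rightarrow> 4 \<Rightarrow> 4 \<Rightarrow> 4 \<Rightarrow> real \<Rightarrow> real \<Rightarrow> real" where
  "cov_weyl n i j k l r x = q4 0 (weyl_r i j k l r x) (weyl_x i j k l r x) 0 n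
     - (\<Sum>p\<in>UNIV. conn p n i r x * weyl_comp p j k l r x) - (\<Sum>p\<in>UNIV. conn p n j r x * weyl_comp i p k l r x)
     - (\<Sum>p\<in>UNIV. conn p n k r x * weyl_comp i j p l r x) - (\<Sum>p\<in>UNIV. conn p n l r x * weyl_comp i j k p r x)"

lemma nabla_antisym: "nabla n j i k l r x = - nabla n i j k l r x" "nabla n i j l k r x = - nabla n i j k l r x"
proof -
  have a: "nabla n j i k l r x = - nabla n i j k l r x" for n i j k l
  proof -
    have "\<forall>n. nabla n j i k l r x = - nabla n i j k l r x"
      unfolding forall_4 nabla_def Let_def by (simp add: bivector_antisym[of _ _ j i]) (simp add: algebra_simps add_divide_distrib diff_divide_distrib)
    then show ?thesis by blast
  qed
  \<comment> \<open>Symmetry under exchange of the index pairs carries antisymmetry of the first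
    pair over to the second.\<close>
  have s: "nabla n k l i j r x = nabla n i j k l r x" for n i j k l
  proof -
    have "\<forall>n. nabla n k l i j r x = nabla n i j k l r x"
      unfolding forall_4 nabla_def Let_def by (simp add: mult.commute add.commute)
    then show ?thesis by blast
  qed
  show "nabla n j i k l r x = - nabla n i j k l r x" by (rule a)
  show "nabla n i j l k r x = - nabla n i j k l r x"
    using a[of n l k i j] by (simp add: s)
qed

lemma weyl_deriv_antisym:
  "weyl_r j i k l r x = - weyl_r i j k l r x" "weyl_r i j l k r x = - weyl_r i j k l r x"
  "weyl_x j i k l r x = - weyl_x i j k l r x" "weyl_x i j l k r x = - weyl_x i j k l r x"
  unfolding weyl_r_def weyl_x_def Let_def
  by (simp_all add: bivector_antisym[of _ _ j i] bivector_antisym[of _ _ l k]) (simp_all add: algebra_simps)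

lemma cov_weyl_antisym:
  "cov_weyl n j i k l r x = - cov_weyl n i j k l r x" "cov_weyl n i j l k r x = - cov_weyl n i j k l r x"
proof -
  have q: "q4 0 (- a) (- b) 0 n = - q4 0 a b 0 n" for a b :: real
    by (simp add: q4_def)
  have w: "weyl_comp p q l k r x = - weyl_comp p q k l r x" "weyl_comp q p k l r x = - weyl_comp p q k l r x" for p q k l
    by (rule weyl_comp_antisym)+
  show "cov_weyl n j i k l r x = - cov_weyl n i j k l r x"
    unfolding cov_weyl_def weyl_deriv_antisym(1,3)[of j i] q w(2)[of j] w(2)[of _ i]
    by (simp add: sum_negf)
  show "cov_weyl n i j l k r x = - cov_weyl n i j k l r x"
    unfolding cov_weyl_def weyl_deriv_antisym(2,4)[of i j l k] q w(1)[of i j l] w(1)[of i j _ k]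
      w(1)[of _ j l k] w(1)[of i _ l k]
    by (simp add: sum_negf)
qed

lemmas cov_weyl_defs = cov_weyl_def nabla_def weyl_r_def weyl_x_def weyl_comp_def conn_def Let_def bivector_values
lemmas weyl_deriv_defs = ur_def vr_def ux_def vx_def

text \<open>The terms with \<open>Q1\<close> and \<open>X1\<close> cancel between the derivative of
  the components and the connection; the rest combines into \<open>ur\<close>, \<open>vr\<close>,
  \<open>ux\<close> and \<open>vx\<close>.\<close>

lemma cov_weyl_12:
  assumes "reg r x"
  shows "\<forall>n. cov_weyl n 1 2 1 2 r x = nabla n 1 2 1 2 r x"
    and "\<forall>n. cov_weyl n 1 3 1 2 r x = nabla n 1 3 1 2 r x"
    and "\<forall>n. cov_weyl n 1 4 1 2 r x = nabla n 1 4 1 2 r x"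
    and "\<forall>n. cov_weyl n 2 3 1 2 r x = nabla n 2 3 1 2 r x"
    and "\<forall>n. cov_weyl n 2 4 1 2 r x = nabla n 2 4 1 2 r x"
    and "\<forall>n. cov_weyl n 3 4 1 2 r x = nabla n 3 4 1 2 r x"
  unfolding cov_weyl_defs forall_4 sum_4
  by (simp; simp add: weyl_deriv_defs nonzero_atoms[OF assms] field_simps power2_eq_square)+

lemma cov_weyl_13:
  assumes "reg r x"
  shows "\<forall>n. cov_weyl n 1 2 1 3 r x = nabla n 1 2 1 3 r x"
    and "\<forall>n. cov_weyl n 1 3 1 3 r x = nabla n 1 3 1 3 r x"
    and "\<forall>n. cov_weyl n 1 4 1 3 r x = nabla n 1 4 1 3 r x"
    and "\<forall>n. cov_weyl n 2 3 1 3 r x = nabla n 2 3 1 3 r x"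
    and "\<forall>n. cov_weyl n 2 4 1 3 r x = nabla n 2 4 1 3 r x"
    and "\<forall>n. cov_weyl n 3 4 1 3 r x = nabla n 3 4 1 3 r x"
  unfolding cov_weyl_defs forall_4 sum_4
  by (simp; simp add: weyl_deriv_defs nonzero_atoms[OF assms] field_simps power2_eq_square)+

lemma cov_weyl_14:
  assumes "reg r x"
  shows "\<forall>n. cov_weyl n 1 2 1 4 r x = nabla n 1 2 1 4 r x"
    and "\<forall>n. cov_weyl n 1 3 1 4 r x = nabla n 1 3 1 4 r x"
    and "\<forall>n. cov_weyl n 1 4 1 4 r x = nabla n 1 4 1 4 r x"
    and "\<forall>n. cov_weyl n 2 3 1 4 r x = nabla n 2 3 1 4 r x"
    and "\<forall>n. cov_weyl n 2 4 1 4 r x = nabla n 2 4 1 4 r x"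
    and "\<forall>n. cov_weyl n 3 4 1 4 r x = nabla n 3 4 1 4 r x"
  unfolding cov_weyl_defs forall_4 sum_4
  by (simp; simp add: weyl_deriv_defs nonzero_atoms[OF assms] field_simps power2_eq_square)+

lemma cov_weyl_23:
  assumes "reg r x"
  shows "\<forall>n. cov_weyl n 1 2 2 3 r x = nabla n 1 2 2 3 r x"
    and "\<forall>n. cov_weyl n 1 3 2 3 r x = nabla n 1 3 2 3 r x"
    and "\<forall>n. cov_weyl n 1 4 2 3 r x = nabla n 1 4 2 3 r x"
    and "\<forall>n. cov_weyl n 2 3 2 3 r x = nabla n 2 3 2 3 r x"
    and "\<forall>n. cov_weyl n 2 4 2 3 r x = nabla n 2 4 2 3 r x"
    and "\<forall>n. cov_weyl n 3 4 2 3 r x = nabla n 3 4 2 3 r x"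
  unfolding cov_weyl_defs forall_4 sum_4
  by (simp; simp add: weyl_deriv_defs nonzero_atoms[OF assms] field_simps power2_eq_square)+

lemma cov_weyl_24:
  assumes "reg r x"
  shows "\<forall>n. cov_weyl n 1 2 2 4 r x = nabla n 1 2 2 4 r x"
    and "\<forall>n. cov_weyl n 1 3 2 4 r x = nabla n 1 3 2 4 r x"
    and "\<forall>n. cov_weyl n 1 4 2 4 r x = nabla n 1 4 2 4 r x"
    and "\<forall>n. cov_weyl n 2 3 2 4 r x = nabla n 2 3 2 4 r x"
    and "\<forall>n. cov_weyl n 2 4 2 4 r x = nabla n 2 4 2 4 r x"
    and "\<forall>n. cov_weyl n 3 4 2 4 r x = nabla n 3 4 2 4 r x"
  unfolding cov_weyl_defs forall_4 sum_4
  by (simp; simp add: weyl_deriv_defs nonzero_atoms[OF assms] field_simps power2_eq_square)+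

lemma cov_weyl_34:
  assumes "reg r x"
  shows "\<forall>n. cov_weyl n 1 2 3 4 r x = nabla n 1 2 3 4 r x"
    and "\<forall>n. cov_weyl n 1 3 3 4 r x = nabla n 1 3 3 4 r x"
    and "\<forall>n. cov_weyl n 1 4 3 4 r x = nabla n 1 4 3 4 r x"
    and "\<forall>n. cov_weyl n 2 3 3 4 r x = nabla n 2 3 3 4 r x"
    and "\<forall>n. cov_weyl n 2 4 3 4 r x = nabla n 2 4 3 4 r x"
    and "\<forall>n. cov_weyl n 3 4 3 4 r x = nabla n 3 4 3 4 r x"
  unfolding cov_weyl_defs forall_4 sum_4
  by (simp; simp add: weyl_deriv_defs nonzero_atoms[OF assms] field_simps power2_eq_square)+

lemma cov_weyl_eq_nabla:
  assumes "reg r x"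
  shows "cov_weyl n i j k l r x = nabla n i j k l r x"
proof (rule antisym_eqI[of "\<lambda>k l. cov_weyl n i j k l r x" "\<lambda>k l. nabla n i j k l r x"])
  note first_pair = antisym_eqI[of "\<lambda>i j. cov_weyl n i j k l r x" "\<lambda>i j. nabla n i j k l r x" for k l,
    OF cov_weyl_antisym(1) nabla_antisym(1)]
  show "cov_weyl n i j 1 2 r x = nabla n i j 1 2 r x"
    by (rule first_pair) (simp_all only: cov_weyl_12[OF assms])
  show "cov_weyl n i j 1 3 r x = nabla n i j 1 3 r x"
    by (rule first_pair) (simp_all only: cov_weyl_13[OF assms])
  show "cov_weyl n i j 1 4 r x = nabla n i j 1 4 r x"
    by (rule first_pair) (simp_all only: cov_weyl_14[OF assms])
  show "cov_weyl n i j 2 3 r x = nabla n i j 2 3 r x"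
    by (rule first_pair) (simp_all only: cov_weyl_23[OF assms])
  show "cov_weyl n i j 2 4 r x = nabla n i j 2 4 r x"
    by (rule first_pair) (simp_all only: cov_weyl_24[OF assms])
  show "cov_weyl n i j 3 4 r x = nabla n i j 3 4 r x"
    by (rule first_pair) (simp_all only: cov_weyl_34[OF assms])
qed (rule cov_weyl_antisym(2) nabla_antisym(2))+

section \<open>The invariant\<close>

text \<open>The weights are $K^4/(G_i G_j)$.\<close>

definition pair_sum :: "(4 \<Rightarrow> 4 \<Rightarrow> real) \<Rightarrow> real \<Rightarrow> real \<Rightarrow> real" where
  "pair_sum h r x = (h 3 4 - h 1 2 + Q r / X x * h 2 4 - X x / Q r * h 1 3
     + Q r * X x * (S r x)\<^sup>2 * h 2 3 - 1 / (Q r * X x * (S r x)\<^sup>2) * h 1 4)"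

lemma pair_sum_scale: "pair_sum (\<lambda>i j. z * h i j) r x = z * pair_sum h r x"
  by (simp add: pair_sum_def algebra_simps)

lemma sum_pairs_metric:
  assumes "reg r x" and "\<And>i j. h j i = h i j" and "\<And>i. h i i = 0"
  shows "(\<Sum>i\<in>UNIV. (\<Sum>j\<in>UNIV. h i j / frame_metric j r x) / frame_metric i r x)
    = 2 / (K r x ^ 4) * pair_sum h r x"
proof -
  have w: "h 1 2 / (frame_metric 1 r x * frame_metric 2 r x) = - h 1 2 / K r x ^ 4"
    "h 1 3 / (frame_metric 1 r x * frame_metric 3 r x) = - (X x / Q r * h 1 3) / K r x ^ 4"
    "h 1 4 / (frame_metric 1 r x * frame_metric 4 r x) = - (1 / (Q r * X x * (S r x)\<^sup>2) * h 1 4) / K r x ^ 4"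
    "h 2 3 / (frame_metric 2 r x * frame_metric 3 r x) = Q r * X x * (S r x)\<^sup>2 * h 2 3 / K r x ^ 4"
    "h 2 4 / (frame_metric 2 r x * frame_metric 4 r x) = Q r / X x * h 2 4 / K r x ^ 4"
    "h 3 4 / (frame_metric 3 r x * frame_metric 4 r x) = h 3 4 / K r x ^ 4"
    using nonzero_atoms[OF assms(1)]
    by (simp_all add: frame_metric_def field_simps power2_eq_square power4_eq_xxxx)
  show ?thesis
    unfolding sum_pairs[of h, OF assms(2,3)] w pair_sum_def
    by (simp add: add_divide_distrib diff_divide_distrib distrib_left right_diff_distrib mult_ac)
qed

text \<open>Index pairs containing 1 carry a minus sign in \<open>pair_sum\<close>. A component
  joining a pair with 1 to a pair without 1 therefore counts negatively. Along direction 1 these are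
  the \<open>ux\<close> components, along the others the \<open>vr\<close> and \<open>vx\<close>
  components, which yields differences of squares.\<close>

lemma nabla_square_sum_1:
  assumes "reg r x"
  shows "pair_sum (\<lambda>i j. pair_sum (\<lambda>k l. (nabla 1 i j k l r x)\<^sup>2) r x) r x
      = 4 * (K r x)\<^sup>2 * (Q r * X x * (S r x)\<^sup>2) * ((vx r x)\<^sup>2 - (ux r x)\<^sup>2)"
  unfolding pair_sum_def nabla_def Let_def bivector_values
  using nonzero_atoms[OF assms]
  by (simp, simp add: power2_eq_square ring_distribs add_divide_distrib diff_divide_distrib)

text \<open>The coefficient 12 of the \<open>ur\<close> square is 4 + 4 from the pairs 34 and 12 and
  1 from each of the other four pairs; that of the \<open>vr\<close> square is 2 + 2 + 8 with the
  opposite sign.\<close>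

lemma nabla_square_sum_2:
  assumes "reg r x"
  shows "pair_sum (\<lambda>i j. pair_sum (\<lambda>k l. (nabla 2 i j k l r x)\<^sup>2) r x) r x
      = 4 * (K r x)\<^sup>2 * (3 * ((ur r x)\<^sup>2 - (vr r x)\<^sup>2) + X x / Q r * ((ux r x)\<^sup>2 - (vx r x)\<^sup>2))"
  unfolding pair_sum_def nabla_def Let_def bivector_values
  using nonzero_atoms[OF assms]
  by (simp, simp add: power2_eq_square ring_distribs add_divide_distrib diff_divide_distrib)

lemma nabla_square_sum_3:
  assumes "reg r x"
  shows "pair_sum (\<lambda>i j. pair_sum (\<lambda>k l. (nabla 3 i j k l r x)\<^sup>2) r x) r x
      = 4 * (K r x)\<^sup>2 * (3 * ((ux r x)\<^sup>2 - (vx r x)\<^sup>2) + Q r / X x * ((ur r x)\<^sup>2 - (vr r x)\<^sup>2))"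
  unfolding pair_sum_def nabla_def Let_def bivector_values
  using nonzero_atoms[OF assms]
  by (simp, simp add: power2_eq_square ring_distribs add_divide_distrib diff_divide_distrib)

lemma nabla_square_sum_4:
  assumes "reg r x"
  shows "pair_sum (\<lambda>i j. pair_sum (\<lambda>k l. (nabla 4 i j k l r x)\<^sup>2) r x) r x
      = 4 * (K r x)\<^sup>2 * (Q r * X x * (S r x)\<^sup>2) * ((ur r x)\<^sup>2 - (vr r x)\<^sup>2)"
  unfolding pair_sum_def nabla_def Let_def bivector_values
  using nonzero_atoms[OF assms]
  by (simp, simp add: power2_eq_square ring_distribs add_divide_distrib diff_divide_distrib)

lemma I3_eq:
  assumes "y \<in> domain"
  defines "r \<equiv> y $ 2" and "x \<equiv> cos (y $ 3)"
  shows "I3 (acc_kerr a m \<alpha>) y = 80 * S r x / K r x ^ 8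
     * (Q r * ((ur r x)\<^sup>2 - (vr r x)\<^sup>2) + X x * ((ux r x)\<^sup>2 - (vx r x)\<^sup>2))"
proof -
  interpret F: orthogonal_frame "acc_kerr a m \<alpha>" domain coframe frame G DG \<gamma> D\<gamma> dcoframe ddcoframe
    by (rule orthogonal_frame_acc_kerr)
  have frame_riemann: "F.frame_riemann i j k l y = curv i j k l (y $ 2) (cos (y $ 3))" for i j k l y
    by (simp add: F.frame_riemann_def curv_def conn_d_def)
  define W where "W i j k l y = weyl_comp i j k l (y $ 2) (cos (y $ 3))" for i j k l and y :: "real ^ 4"
  define DW where "DW n i j k l y = q4 0 (weyl_r i j k l (y $ 2) (cos (y $ 3))) (weyl_x i j k l (y $ 2) (cos (y $ 3))) 0 n"
    for n i j k l and y :: "real ^ 4"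
  have W: "G i y * F.frame_riemann i j k l y = W i j k l y" if "y \<in> domain" for i j k l y
    using curv_eq_weyl_comp[OF domain_reg[OF that]] by (simp add: frame_riemann W_def)
  have weyl: "weyl (acc_kerr a m \<alpha>) y = F.pullback4 W y" if y: "y \<in> domain" for y
  proof -
    have reg: "reg (y $ 2) (cos (y $ 3))" by (rule domain_reg[OF y])
    have R: "F.frame_riemann i j k l y = W i j k l y / G i y" for i j k l
      using W[OF y, of i j k l] F.G_nz[OF y, of i] by (simp add: field_simps)
    \<comment> \<open>The terms with \<open>v\<close> have four distinct indices and contribute no
      trace. In those with \<open>u\<close>, the coefficient 2 of the pairs 12 and 34 balances two
      coefficients 1 in each diagonal trace.\<close>
    have "\<forall>j l. (\<Sum>i\<in>UNIV. F.frame_riemann i j i l y) = 0"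
      unfolding forall_4 sum_4 R W_def weyl_comp_def bivector_values frame_metric_def
      using nonzero_atoms[OF reg] by (simp; simp add: field_simps power2_eq_square)
    then have "weyl (acc_kerr a m \<alpha>) y = F.pullback4 (\<lambda>i j k l y. G i y * F.frame_riemann i j k l y) y"
      by (intro F.weyl_frame_of_ricci_flat[OF y]) blast
    then show ?thesis by (simp add: F.pullback4_def W[OF y] fun_eq_iff)
  qed
  have DW: "has_pd n (W i j k l) (\<Sum>M\<in>UNIV. coframe M n y * DW M i j k l y) y" for n i j k l
    unfolding W_def[abs_def] DW_def by (rule has_pd_chart) (rule DERIV_weyl domain_reg assms)+
  have reg: "reg r x" unfolding r_def x_def by (rule domain_reg[OF assms(1)])
  have N: "F.frame_cov_deriv4 W DW y n i j k l = nabla n i j k l r x" for n i j k l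
    using cov_weyl_eq_nabla[OF reg, of n i j k l]
    by (simp add: cov_weyl_def F.frame_cov_deriv4_def W_def DW_def r_def x_def)
  let ?N = "\<lambda>n i j k l. nabla n i j k l r x"
  have "I3 (acc_kerr a m \<alpha>) y = (\<Sum>n\<in>UNIV. (\<Sum>i\<in>UNIV. (\<Sum>j\<in>UNIV. (\<Sum>k\<in>UNIV. (\<Sum>l\<in>UNIV.
      (?N n i j k l)\<^sup>2 / G l y) / G k y) / G j y) / G i y) / G n y)"
    by (rule F.I3_frame[OF assms(1)]) (simp only: F.cov_deriv4_frame[where T = W and DT = DW, OF assms(1) weyl DW] N)
  also have "\<dots> = (\<Sum>n\<in>UNIV. 2 / K r x ^ 4 * (2 / K r x ^ 4 *
      pair_sum (\<lambda>i j. pair_sum (\<lambda>k l. (?N n i j k l)\<^sup>2) r x) r x) / frame_metric n r x)"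
  proof (rule sum.cong[OF refl])
    fix n
    have sq: "(?N n j i k l)\<^sup>2 = (?N n i j k l)\<^sup>2" "(?N n i j l k)\<^sup>2 = (?N n i j k l)\<^sup>2"
      "?N n i i k l = 0" "?N n i j k k = 0" for i j k l
      using nabla_antisym(1)[of n j i k l r x] nabla_antisym(2)[of n i j l k r x]
        nabla_antisym(1)[of n i i k l r x] nabla_antisym(2)[of n i j k k r x] by simp_all
    have inner: "(\<Sum>k\<in>UNIV. (\<Sum>l\<in>UNIV. (?N n i j k l)\<^sup>2 / G l y) / G k y)
      = 2 / K r x ^ 4 * pair_sum (\<lambda>k l. (?N n i j k l)\<^sup>2) r x" for i j
      unfolding r_def[symmetric] x_def[symmetric] by (rule sum_pairs_metric[OF reg]) (simp_all add: sq)
    have "(\<Sum>i\<in>UNIV. (\<Sum>j\<in>UNIV. (2 / K r x ^ 4 * pair_sum (\<lambda>k l. (?N n i j k l)\<^sup>2) r x) / G j y) / G i y)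
      = 2 / K r x ^ 4 * pair_sum (\<lambda>i j. 2 / K r x ^ 4 * pair_sum (\<lambda>k l. (?N n i j k l)\<^sup>2) r x) r x"
      unfolding r_def[symmetric] x_def[symmetric]
      by (rule sum_pairs_metric[OF reg]) (simp_all add: sq pair_sum_def[of _ r x])
    also have "pair_sum (\<lambda>i j. 2 / K r x ^ 4 * pair_sum (\<lambda>k l. (?N n i j k l)\<^sup>2) r x) r x
      = 2 / K r x ^ 4 * pair_sum (\<lambda>i j. pair_sum (\<lambda>k l. (?N n i j k l)\<^sup>2) r x) r x"
      by (rule pair_sum_scale)
    finally show "(\<Sum>i\<in>UNIV. (\<Sum>j\<in>UNIV. (\<Sum>k\<in>UNIV. (\<Sum>l\<in>UNIV. (?N n i j k l)\<^sup>2 / G l y) / G k y) / G j y) / G i y) / G n y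
      = 2 / K r x ^ 4 * (2 / K r x ^ 4 *
        pair_sum (\<lambda>i j. pair_sum (\<lambda>k l. (?N n i j k l)\<^sup>2) r x) r x) / frame_metric n r x"
      unfolding inner by (simp add: r_def x_def)
  qed
  also have "\<dots> = 4 / K r x ^ 8 * (\<Sum>n\<in>UNIV.
      pair_sum (\<lambda>i j. pair_sum (\<lambda>k l. (?N n i j k l)\<^sup>2) r x) r x / frame_metric n r x)"
  proof -
    have "K r x ^ 8 = K r x ^ 4 * K r x ^ 4" by (simp flip: power_add)
    then show ?thesis by (simp add: sum_distrib_left)
  qed
  \<comment> \<open>Over the four directions, \<open>Q\<close> collects 12 + 4 + 4 and
    \<open>X\<close> likewise; with the factor 4 in front this is the constant 80.\<close>
  moreover have sums:
    "4 * (K r x)\<^sup>2 * (Q r * X x * (S r x)\<^sup>2) * z / frame_metric 1 r x = - (4 * X x * S r x * z)"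
    "4 * (K r x)\<^sup>2 * (3 * z + X x / Q r * z') / frame_metric 2 r x = 12 * Q r * S r x * z + 4 * X x * S r x * z'"
    "4 * (K r x)\<^sup>2 * (3 * z' + Q r / X x * z) / frame_metric 3 r x = 12 * X x * S r x * z' + 4 * Q r * S r x * z"
    "4 * (K r x)\<^sup>2 * (Q r * X x * (S r x)\<^sup>2) * z / frame_metric 4 r x = 4 * Q r * S r x * z" for z z'
    using nonzero_atoms[OF reg] by (simp_all add: frame_metric_def field_simps power2_eq_square)
  ultimately show ?thesis
    unfolding sum_4 nabla_square_sum_1[OF reg] nabla_square_sum_2[OF reg] nabla_square_sum_3[OF reg]
      nabla_square_sum_4[OF reg] sums by (simp add: algebra_simps)
qed

text \<open>$p + iq = (r - iax)^4$; the other factors are $(1-i\alpha a)(1+i\alpha a x^2)$ and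
  $(1-i\alpha a)(\alpha r^2 + ia)$.\<close>

lemma ur_vr_ux_vx:
  assumes "reg r x"
  defines "p \<equiv> r ^ 4 - 6 * r\<^sup>2 * a\<^sup>2 * x\<^sup>2 + a ^ 4 * x ^ 4" and "q \<equiv> 4 * r * a ^ 3 * x ^ 3 - 4 * r ^ 3 * a * x"
    and "M \<equiv> - 3 * m * K r x * S r x ^ 4"
  shows "ur r x = M * ((1 + \<alpha>\<^sup>2 * a\<^sup>2 * x\<^sup>2) * p - \<alpha> * a * (x\<^sup>2 - 1) * q)"
    and "vr r x = M * ((1 + \<alpha>\<^sup>2 * a\<^sup>2 * x\<^sup>2) * q + \<alpha> * a * (x\<^sup>2 - 1) * p)"
    and "ux r x = M * (\<alpha> * (r\<^sup>2 + a\<^sup>2) * p - a * (1 - \<alpha>\<^sup>2 * r\<^sup>2) * q)"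
    and "vx r x = M * (\<alpha> * (r\<^sup>2 + a\<^sup>2) * q + a * (1 - \<alpha>\<^sup>2 * r\<^sup>2) * p)"
proof -
  define R where "R = r\<^sup>2 + a\<^sup>2 * x\<^sup>2"
  have S: "R * S r x = 1" unfolding R_def by (rule S_inverse[OF assms(1)])
  have K: "(1 - \<alpha> * r * x) * K r x = 1" using assms(1) by (simp add: reg_def K_def)
  \<comment> \<open>Over the common denominator, A - iB + k1 collapses to K (1 + i \<alpha> a
    x^2)/(r + iax), and aB + k2 + iaA to K (\<alpha> r^2 + ia)/(r + iax).\<close>
  have K1: "A r x + k1 r x = K r x * S r x * ((1 - \<alpha> * r * x) * r + \<alpha> * x * R)"
    "a * B r x + k2 r x = K r x * S r x * ((1 - \<alpha> * r * x) * a\<^sup>2 * x + \<alpha> * r * R)"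
    "A r x = K r x * S r x * ((1 - \<alpha> * r * x) * r)" "B r x = K r x * S r x * ((1 - \<alpha> * r * x) * a * x)"
    using S K unfolding A_def B_def k1_def k2_def by algebra+
  have uv: "u r x = m * S r x ^ 3 * ((r ^ 3 - 3 * r * (a * x)\<^sup>2) + \<alpha> * a * ((a * x) ^ 3 - 3 * r\<^sup>2 * (a * x)))"
    "v r x = m * S r x ^ 3 * (((a * x) ^ 3 - 3 * r\<^sup>2 * (a * x)) - \<alpha> * a * (r ^ 3 - 3 * r * (a * x)\<^sup>2))"
    unfolding u_def v_def A_def B_def by algebra+
  show "ur r x = M * ((1 + \<alpha>\<^sup>2 * a\<^sup>2 * x\<^sup>2) * p - \<alpha> * a * (x\<^sup>2 - 1) * q)"
    unfolding ur_def K1(1,4) uv M_def p_def q_def R_def by algebra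
  show "vr r x = M * ((1 + \<alpha>\<^sup>2 * a\<^sup>2 * x\<^sup>2) * q + \<alpha> * a * (x\<^sup>2 - 1) * p)"
    unfolding vr_def K1(1,4) uv M_def p_def q_def R_def by algebra
  show "ux r x = M * (\<alpha> * (r\<^sup>2 + a\<^sup>2) * p - a * (1 - \<alpha>\<^sup>2 * r\<^sup>2) * q)"
    unfolding ux_def K1(2,3) uv M_def p_def q_def R_def by algebra
  show "vx r x = M * (\<alpha> * (r\<^sup>2 + a\<^sup>2) * q + a * (1 - \<alpha>\<^sup>2 * r\<^sup>2) * p)"
    unfolding vx_def K1(2,3) uv M_def p_def q_def R_def by algebra
qed

end

text \<open>The left-hand side is the real part of (1 - i \<alpha> a)^2 (r - iax)^8 times Q (1 + i
  \<alpha> a x^2)^2 + X (\<alpha> r^2 + ia)^2. Where \<alpha> r x = 1, X equals - Q / (\<alpha>^2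
  r^4) and 1 + i \<alpha> a x^2 equals (\<alpha> r^2 + ia)/(\<alpha> r^2), so the sum vanishes. This
  explains the factor 1 - \<alpha> r x.\<close>

lemma final_polynomial:
  fixes a m \<alpha> r x :: real
  defines "p \<equiv> r ^ 4 - 6 * r\<^sup>2 * a\<^sup>2 * x\<^sup>2 + a ^ 4 * x ^ 4" and "q \<equiv> 4 * r * a ^ 3 * x ^ 3 - 4 * r ^ 3 * a * x"
  shows "accelerating_kerr.Q a m \<alpha> r * (((1 + \<alpha>\<^sup>2 * a\<^sup>2 * x\<^sup>2) * p - \<alpha> * a * (x\<^sup>2 - 1) * q)\<^sup>2
       - ((1 + \<alpha>\<^sup>2 * a\<^sup>2 * x\<^sup>2) * q + \<alpha> * a * (x\<^sup>2 - 1) * p)\<^sup>2)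
    + accelerating_kerr.X a m \<alpha> x * ((\<alpha> * (r\<^sup>2 + a\<^sup>2) * p - a * (1 - \<alpha>\<^sup>2 * r\<^sup>2) * q)\<^sup>2
       - (\<alpha> * (r\<^sup>2 + a\<^sup>2) * q + a * (1 - \<alpha>\<^sup>2 * r\<^sup>2) * p)\<^sup>2)
    = (1 - \<alpha> * r * x) *
    ( \<alpha> * a^10 * (a^4*\<alpha>^4*r - 2*\<alpha>^2*(\<alpha>^2*m*r^2 - m - r)*a^2 + 2*\<alpha>^2*m*r^2 - 2*m + r) * x^11
    + (a^6*\<alpha>^4 + (- 2*\<alpha>^4*m*r + 2*\<alpha>^2)*a^4 + (34*\<alpha>^4*m*r^3 - 38*\<alpha>^2*m*r + 1)*a^2
        - 2*m*r^3*\<alpha>^2) * a^8 * x^10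
    - 2 * (\<alpha>^2*(27*r^3*\<alpha>^2/2 + m)*a^4
        + (- 28*m*r^4*\<alpha>^4 + 31*\<alpha>^2*m*r^2 + 27*r^3*\<alpha>^2 - m)*a^2
        + 44*\<alpha>^2*m*r^4 - 43*m*r^2 + 27*r^3/2) * \<alpha> * a^8 * x^9
    - 27 * (a^6*r*\<alpha>^4 - 22*(\<alpha>^2*m*r^2 + 17/11*m - 27/11*r)*\<alpha>^2*a^4/27
        + (280/27*m*r^4*\<alpha>^4 - 394/27*\<alpha>^2*m*r^2 + 2/27*m + r)*a^2
        - 56*\<alpha>^2*m*r^4/27) * a^6 * r * x^8
    + 56 * (\<alpha>^2*(3*r^3*\<alpha>^2/4 + m)*a^4
        + (- 5/2*m*r^4*\<alpha>^4 + 85/14*\<alpha>^2*m*r^2 + 3/2*r^3*\<alpha>^2 - 11/7*m)*a^2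
        + 13*(\<alpha>^2*m*r^2 - 11/13*m + 3/26*r)*r^2/2) * \<alpha> * a^6 * r^2 * x^7
    + 42 * a^4 * r^3 * (a^6*r*\<alpha>^4 + 10*(\<alpha>^2*m*r^2 - 2*m + 3/5*r)*\<alpha>^2*a^4/3
        + (26/3*m*r^4*\<alpha>^4 - 50/3*\<alpha>^2*m*r^2 + 4/3*m + r)*a^2
        - 10*\<alpha>^2*m*r^4/3) * x^6
    - 140 * (\<alpha>^2*(- 3*r^3*\<alpha>^2/10 + m)*a^4
        + (- 2/5*m*r^4*\<alpha>^4 + 5*\<alpha>^2*m*r^2 - 3/5*r^3*\<alpha>^2 - 13/5*m)*a^2
        + 2*r^2*(\<alpha>^2*m*r^2 - 1/2*m - 3/20*r)) * \<alpha> * a^4 * r^4 * x^5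
    + 42 * (a^6*r*\<alpha>^4 - 22*(\<alpha>^2*m*r^2 - 13/11*m - 3/11*r)*\<alpha>^2*a^4/3
        + (- 44/21*m*r^4*\<alpha>^4 + 170/21*\<alpha>^2*m*r^2 - 10/3*m + r)*a^2
        + 4*\<alpha>^2*m*r^4/3) * a^2 * r^5 * x^4
    + 56 * \<alpha> * a^2 * r^6 * (\<alpha>^2*(- 27*r^3*\<alpha>^2/56 + m)*a^4
        + (- 1/28*m*r^4*\<alpha>^4 + 197/28*\<alpha>^2*m*r^2 - 27/28*r^3*\<alpha>^2 - 5*m)*a^2
        + 17*(\<alpha>^2*m*r^2 + 11/17*m - 27/34*r)*r^2/28) * x^3
    - 27 * (a^6*r*\<alpha>^4 - 86*(\<alpha>^2*m*r^2 - 44/43*m - 27/43*r)*\<alpha>^2*a^4/27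
        + (- 2/27*m*r^4*\<alpha>^4 + 62/27*\<alpha>^2*m*r^2 - 56/27*m + r)*a^2
        + 2*\<alpha>^2*m*r^4/27) * r^7 * x^2
    - 2 * \<alpha> * (\<alpha>^2*(- (r^3*\<alpha>^2/2) + m)*a^4 + (19*\<alpha>^2*m*r^2 - r^3*\<alpha>^2 - 17*m)*a^2
        + r^2*(m - r/2)) * r^8 * x
    + r^9 * (a^4*\<alpha>^4*r - 2*\<alpha>^2*(\<alpha>^2*m*r^2 - m - r)*a^2 + 2*\<alpha>^2*m*r^2 - 2*m + r))"
  unfolding p_def q_def accelerating_kerr.Q_def accelerating_kerr.X_def
  by algebra

theorem theorem37:
  fixes a m \<alpha> t r \<theta> \<phi> c :: real
  assumes c: "c = cos \<theta>"
    and Omega_pos: "Omega \<alpha> r \<theta> > 0"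
    and rho2_nonzero: "rho2 a r \<theta> \<noteq> 0"
    and Q_nonzero: "Qfun a m \<alpha> r \<noteq> 0"
    and P_pos: "Pfun a m \<alpha> \<theta> > 0"
    and sin_nonzero: "sin \<theta> \<noteq> 0"
  shows "I3 (acc_kerr a m \<alpha>) (vector [t, r, \<theta>, \<phi>]) =
    - (720 * (\<alpha>*r*c - 1)^7 * m^2 / (r^2 + a^2*c^2)^9) *
    ( \<alpha> * a^10 * (a^4*\<alpha>^4*r - 2*\<alpha>^2*(\<alpha>^2*m*r^2 - m - r)*a^2 + 2*\<alpha>^2*m*r^2 - 2*m + r) * c^11
    + (a^6*\<alpha>^4 + (- 2*\<alpha>^4*m*r + 2*\<alpha>^2)*a^4 + (34*\<alpha>^4*m*r^3 - 38*\<alpha>^2*m*r + 1)*a^2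
        - 2*m*r^3*\<alpha>^2) * a^8 * c^10
    - 2 * (\<alpha>^2*(27*r^3*\<alpha>^2/2 + m)*a^4
        + (- 28*m*r^4*\<alpha>^4 + 31*\<alpha>^2*m*r^2 + 27*r^3*\<alpha>^2 - m)*a^2
        + 44*\<alpha>^2*m*r^4 - 43*m*r^2 + 27*r^3/2) * \<alpha> * a^8 * c^9
    - 27 * (a^6*r*\<alpha>^4 - 22*(\<alpha>^2*m*r^2 + 17/11*m - 27/11*r)*\<alpha>^2*a^4/27
        + (280/27*m*r^4*\<alpha>^4 - 394/27*\<alpha>^2*m*r^2 + 2/27*m + r)*a^2
        - 56*\<alpha>^2*m*r^4/27) * a^6 * r * c^8
    + 56 * (\<alpha>^2*(3*r^3*\<alpha>^2/4 + m)*a^4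
        + (- 5/2*m*r^4*\<alpha>^4 + 85/14*\<alpha>^2*m*r^2 + 3/2*r^3*\<alpha>^2 - 11/7*m)*a^2
        + 13*(\<alpha>^2*m*r^2 - 11/13*m + 3/26*r)*r^2/2) * \<alpha> * a^6 * r^2 * c^7
    + 42 * a^4 * r^3 * (a^6*r*\<alpha>^4 + 10*(\<alpha>^2*m*r^2 - 2*m + 3/5*r)*\<alpha>^2*a^4/3
        + (26/3*m*r^4*\<alpha>^4 - 50/3*\<alpha>^2*m*r^2 + 4/3*m + r)*a^2
        - 10*\<alpha>^2*m*r^4/3) * c^6
    - 140 * (\<alpha>^2*(- 3*r^3*\<alpha>^2/10 + m)*a^4
        + (- 2/5*m*r^4*\<alpha>^4 + 5*\<alpha>^2*m*r^2 - 3/5*r^3*\<alpha>^2 - 13/5*m)*a^2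
        + 2*r^2*(\<alpha>^2*m*r^2 - 1/2*m - 3/20*r)) * \<alpha> * a^4 * r^4 * c^5
    + 42 * (a^6*r*\<alpha>^4 - 22*(\<alpha>^2*m*r^2 - 13/11*m - 3/11*r)*\<alpha>^2*a^4/3
        + (- 44/21*m*r^4*\<alpha>^4 + 170/21*\<alpha>^2*m*r^2 - 10/3*m + r)*a^2
        + 4*\<alpha>^2*m*r^4/3) * a^2 * r^5 * c^4
    + 56 * \<alpha> * a^2 * r^6 * (\<alpha>^2*(- 27*r^3*\<alpha>^2/56 + m)*a^4
        + (- 1/28*m*r^4*\<alpha>^4 + 197/28*\<alpha>^2*m*r^2 - 27/28*r^3*\<alpha>^2 - 5*m)*a^2
        + 17*(\<alpha>^2*m*r^2 + 11/17*m - 27/34*r)*r^2/28) * c^3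
    - 27 * (a^6*r*\<alpha>^4 - 86*(\<alpha>^2*m*r^2 - 44/43*m - 27/43*r)*\<alpha>^2*a^4/27
        + (- 2/27*m*r^4*\<alpha>^4 + 62/27*\<alpha>^2*m*r^2 - 56/27*m + r)*a^2
        + 2*\<alpha>^2*m*r^4/27) * r^7 * c^2
    - 2 * \<alpha> * (\<alpha>^2*(- (r^3*\<alpha>^2/2) + m)*a^4 + (19*\<alpha>^2*m*r^2 - r^3*\<alpha>^2 - 17*m)*a^2
        + r^2*(m - r/2)) * r^8 * c
    + r^9 * (a^4*\<alpha>^4*r - 2*\<alpha>^2*(\<alpha>^2*m*r^2 - m - r)*a^2 + 2*\<alpha>^2*m*r^2 - 2*m + r))"
proof -
  interpret accelerating_kerr a m \<alpha> .
  let ?y = "vector [t, r, \<theta>, \<phi>] :: real ^ 4"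
  let ?poly = "( \<alpha> * a^10 * (a^4*\<alpha>^4*r - 2*\<alpha>^2*(\<alpha>^2*m*r^2 - m - r)*a^2 + 2*\<alpha>^2*m*r^2 - 2*m + r) * c^11
    + (a^6*\<alpha>^4 + (- 2*\<alpha>^4*m*r + 2*\<alpha>^2)*a^4 + (34*\<alpha>^4*m*r^3 - 38*\<alpha>^2*m*r + 1)*a^2
        - 2*m*r^3*\<alpha>^2) * a^8 * c^10
    - 2 * (\<alpha>^2*(27*r^3*\<alpha>^2/2 + m)*a^4
        + (- 28*m*r^4*\<alpha>^4 + 31*\<alpha>^2*m*r^2 + 27*r^3*\<alpha>^2 - m)*a^2
        + 44*\<alpha>^2*m*r^4 - 43*m*r^2 + 27*r^3/2) * \<alpha> * a^8 * c^9
    - 27 * (a^6*r*\<alpha>^4 - 22*(\<alpha>^2*m*r^2 + 17/11*m - 27/11*r)*\<alpha>^2*a^4/27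
        + (280/27*m*r^4*\<alpha>^4 - 394/27*\<alpha>^2*m*r^2 + 2/27*m + r)*a^2
        - 56*\<alpha>^2*m*r^4/27) * a^6 * r * c^8
    + 56 * (\<alpha>^2*(3*r^3*\<alpha>^2/4 + m)*a^4
        + (- 5/2*m*r^4*\<alpha>^4 + 85/14*\<alpha>^2*m*r^2 + 3/2*r^3*\<alpha>^2 - 11/7*m)*a^2
        + 13*(\<alpha>^2*m*r^2 - 11/13*m + 3/26*r)*r^2/2) * \<alpha> * a^6 * r^2 * c^7
    + 42 * a^4 * r^3 * (a^6*r*\<alpha>^4 + 10*(\<alpha>^2*m*r^2 - 2*m + 3/5*r)*\<alpha>^2*a^4/3
        + (26/3*m*r^4*\<alpha>^4 - 50/3*\<alpha>^2*m*r^2 + 4/3*m + r)*a^2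
        - 10*\<alpha>^2*m*r^4/3) * c^6
    - 140 * (\<alpha>^2*(- 3*r^3*\<alpha>^2/10 + m)*a^4
        + (- 2/5*m*r^4*\<alpha>^4 + 5*\<alpha>^2*m*r^2 - 3/5*r^3*\<alpha>^2 - 13/5*m)*a^2
        + 2*r^2*(\<alpha>^2*m*r^2 - 1/2*m - 3/20*r)) * \<alpha> * a^4 * r^4 * c^5
    + 42 * (a^6*r*\<alpha>^4 - 22*(\<alpha>^2*m*r^2 - 13/11*m - 3/11*r)*\<alpha>^2*a^4/3
        + (- 44/21*m*r^4*\<alpha>^4 + 170/21*\<alpha>^2*m*r^2 - 10/3*m + r)*a^2
        + 4*\<alpha>^2*m*r^4/3) * a^2 * r^5 * c^4
    + 56 * \<alpha> * a^2 * r^6 * (\<alpha>^2*(- 27*r^3*\<alpha>^2/56 + m)*a^4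
        + (- 1/28*m*r^4*\<alpha>^4 + 197/28*\<alpha>^2*m*r^2 - 27/28*r^3*\<alpha>^2 - 5*m)*a^2
        + 17*(\<alpha>^2*m*r^2 + 11/17*m - 27/34*r)*r^2/28) * c^3
    - 27 * (a^6*r*\<alpha>^4 - 86*(\<alpha>^2*m*r^2 - 44/43*m - 27/43*r)*\<alpha>^2*a^4/27
        + (- 2/27*m*r^4*\<alpha>^4 + 62/27*\<alpha>^2*m*r^2 - 56/27*m + r)*a^2
        + 2*\<alpha>^2*m*r^4/27) * r^7 * c^2
    - 2 * \<alpha> * (\<alpha>^2*(- (r^3*\<alpha>^2/2) + m)*a^4 + (19*\<alpha>^2*m*r^2 - r^3*\<alpha>^2 - 17*m)*a^2
        + r^2*(m - r/2)) * r^8 * c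
    + r^9 * (a^4*\<alpha>^4*r - 2*\<alpha>^2*(\<alpha>^2*m*r^2 - m - r)*a^2 + 2*\<alpha>^2*m*r^2 - 2*m + r))"
  have y: "?y $ 2 = r" "?y $ 3 = \<theta>" by (simp_all add: vector_4)
  have X: "X (cos \<theta>) = Pfun a m \<alpha> \<theta> * (sin \<theta>)\<^sup>2"
    by (simp add: X_def Pfun_def sin_squared_eq)
  have reg: "reg r c"
    using assms X by (simp add: reg_def Q_def Qfun_def rho2_def Omega_def)
  have dom: "?y \<in> domain"
    using reg sin_nonzero by (simp add: domain_def y c)
  have K: "1 / K r c = 1 - \<alpha> * r * c" by (simp add: K_def)
  have S: "S r c = 1 / (r\<^sup>2 + a\<^sup>2 * c\<^sup>2)" by (simp add: S_def)
  define p where "p = r ^ 4 - 6 * r\<^sup>2 * a\<^sup>2 * c\<^sup>2 + a ^ 4 * c ^ 4"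
  define q where "q = 4 * r * a ^ 3 * c ^ 3 - 4 * r ^ 3 * a * c"
  define M where "M = - 3 * m * K r c * S r c ^ 4"
  have M2: "M\<^sup>2 = 9 * m\<^sup>2 * (K r c)\<^sup>2 * S r c ^ 8"
    by (simp add: M_def power_mult_distrib flip: power_mult)
  \<comment> \<open>720 is 80 times the 9 in the square of \<open>M\<close>. That square also
    carries two powers of \<open>K\<close>, which reduce the eighth power of Omega to the sixth, and
    eight powers of \<open>S\<close>, which become nine.\<close>
  have scale: "80 * S r c / K r c ^ 8 * (M\<^sup>2 * (w * z)) = 720 * m\<^sup>2 * (1 / K r c) ^ 6 * w * S r c ^ 9 * z"
    for w z
  proof -
    have eqs: "K r c ^ 8 = (K r c)\<^sup>2 * K r c ^ 6" "S r c ^ 9 = S r c * S r c ^ 8"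
      by (simp_all flip: power_add power_Suc)
    have cancel: "80 * s / (k2 * k6) * (9 * n * k2 * s8 * (w * z)) = 720 * n * (1 / k6) * w * (s * s8) * z"
      if "k2 \<noteq> 0" for s k2 k6 n s8 :: real
      using that by simp
    show ?thesis
      unfolding eqs M2 power_one_over by (rule cancel) (simp add: nonzero_atoms(4)[OF reg])
  qed
  have "I3 (acc_kerr a m \<alpha>) ?y = 80 * S r c / K r c ^ 8
      * (Q r * ((ur r c)\<^sup>2 - (vr r c)\<^sup>2) + X c * ((ux r c)\<^sup>2 - (vx r c)\<^sup>2))"
    using I3_eq[OF dom] by (simp add: y c)
  also have "Q r * ((ur r c)\<^sup>2 - (vr r c)\<^sup>2) + X c * ((ux r c)\<^sup>2 - (vx r c)\<^sup>2)
      = M\<^sup>2 * ((1 - \<alpha> * r * c) * ?poly)"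
    unfolding ur_vr_ux_vx[OF reg] final_polynomial[symmetric] p_def[symmetric] q_def[symmetric] M_def[symmetric]
      power_mult_distrib by (simp add: algebra_simps)
  also have "80 * S r c / K r c ^ 8 * (M\<^sup>2 * ((1 - \<alpha> * r * c) * ?poly))
      = 720 * m\<^sup>2 * (1 / K r c) ^ 6 * (1 - \<alpha> * r * c) * S r c ^ 9 * ?poly"
    by (rule scale)
  also have "\<dots> = 720 * m\<^sup>2 * (1 - \<alpha> * r * c) ^ 7 * S r c ^ 9 * ?poly"
    unfolding K by (simp add: eval_nat_numeral)
  \<comment> \<open>The odd exponent turns the seventh power of Omega into minus that of \<alpha> r
    c - 1, which is the leading sign of the stated formula.\<close>
  also have "(1 - \<alpha> * r * c) ^ 7 = - ((\<alpha> * r * c - 1) ^ 7)"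
    using power_minus_odd[of 7 "\<alpha> * r * c - 1"] by simp
  finally show ?thesis
    unfolding S by (simp add: power_divide)
qed

end
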